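(* In the setting described in the context, let $g:\Upsilon\to(0,\infty)$ be $\mathfrak B(\Upsilon)$-measurable and let $Q$ be a probability measure on $\Sigma$ satisfying conditions (a1) and (a2) and such that $S$ is a $Q$-CMPP$(g(\Theta),Q_{X_1})$. Suppose there exists a regular conditional probability $\{Q_\theta\}_{\theta\in\Upsilon}$ of $Q$ over $Q_\Theta$ consistent with $\Theta$. Then the following are equivalent: (i) $Q\stackrel{pr}{\sim}P$. (ii) $Q_{X_1}\sim P_{X_1}$ and $Q_\Theta\sim P_\Theta$. (iii) There exists an essentially unique $\beta\in\mathcal F_P$, $\beta(x,\theta)=\alpha(\theta)+\gamma(x)$, such that $g(\theta)=\theta e^{\alpha(\theta)}$ for every $\theta\in\Upsilon$ and $\gamma=\ln f$, where $f$ is a $P_{X_1}$-a.s. positive Radon–Nikodým derivative of $Q_{X_1}$ with respect to $P_{X_1}$; and there exists a $P_\Theta$-null set $V_*\in\mathfrak B(\Upsilon)$ such that for every $\theta\notin V_*$ $$Q_\theta(A)=\int_A\widetilde M_t^{(\beta)}(\theta)\,dP_\theta\qquad\text{for all }0\le s\le t\text{ and all }A\in\mathcal F_s,$$ where $\widetilde M_t^{(\beta)}(\theta):=e^{S_t^{(\beta)}(\theta)-t\theta(e^{\alpha(\theta)}-1)}$ with $S_t^{(\beta)}(\theta):=\sum_{k=1}^{N_t}\beta(X_k,\theta)$, and the family $\{\widetilde M_t^{(\beta)}(\theta)\}_{t\ge0}$ is a martingale in $\mathcal L^1(P_\theta)$. (iv) There exists an essentially unique pair $(\beta,\xi)\in\mathcal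 F_P\times\mathcal R_+(\Upsilon)$, $\beta(x,\theta)=\alpha(\theta)+\gamma(x)$, where $\xi$ is a Radon–Nikodým derivative of $Q_\Theta$ with respect to $P_\Theta$, such that $g(\Theta)=\Theta e^{\alpha(\Theta)}$ and $\gamma=\ln f$, where $f$ is a $P_{X_1}$-a.s. positive Radon–Nikodým derivative of $Q_{X_1}$ with respect to $P_{X_1}$, and such that $$Q(A)=\int_A M_t^{(\beta)}(\Theta)\,dP\qquad\text{for all }0\le s\le t\text{ and all }A\in\mathcal F_s,$$ where $M_t^{(\beta)}(\Theta):=\xi(\Theta)\,e^{S_t^{(\beta)}(\Theta)-t\Theta(e^{\alpha(\Theta)}-1)}$, and the family $\{M_t^{(\beta)}(\Theta)\}_{t\ge0}$ is a martingale in $\mathcal L^1(P)$.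
   Context: **Setting.** $\Upsilon:=(0,\infty)$ with Borel $\sigma$-algebra $\mathfrak B(\Upsilon)$. $(\Omega,\Sigma,P)$ is a probability space and $\Theta$ a real random variable with $P(\Theta\in(0,\infty))=1$; the laws $P_\Theta,Q_\Theta$ are regarded as probability measures on $\mathfrak B(\Upsilon)$. For a measure $R$ and random variable $Z$, $R_Z$ is the law of $Z$ under $R$; $\sim$ denotes mutual absolute continuity. $N=\{N_t\}_{t\ge0}$ is a counting process: $N_0=0$, its paths are non-decreasing, right-continuous, integer valued, with jumps of size one, and tend to infinity as $t\to\infty$ (the exceptional null set and the explosion event $\{\sup_nT_n<\infty\}$ are assumed empty). Arrival times: $T_0=0$, $T_n=\inf\{t:N_t=n\}$; interarrival process $W=\{W_n\}_{n\ge1}$, $W_n=T_n-T_{n-1}$. $X=\{X_n\}_{n\ge1}$ is a sequence of positive random variables, and $S=\{S_t\}_{t\ge0}$, $S_t=\sum_{k=1}^{N_t}X_k$. $\mathcal F_t:=\sigma(\{S_u:u\le t\}\cup\{\Theta\})$. **Standing assumptions on $P$.** $P$ satisfies (a1) and (a2), $S$ is a $P$-CMPP$(\Theta,P_{X_1})$ (i.e. the case $g=\mathrm{id}_\Upsilon$ of the definition below), and there is a regular conditional probability $\{P_\theta\}_{\theta\in\Upsilon}$ of $P$ over $P_\Theta$ consistent with $\Theta$, which is fixed. **Definitions.** A regular conditional probability of $R$ over $R_\Theta$ is a family $\{R_\theta\}_{\theta\in\Upsilon}$ of probability measures on $\Sigma$ such that $\theta\mapsto R_\theta(D)$ is $\mathfrak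 B(\Upsilon)$-measurable and $\int R_\theta(D)R_\Theta(d\theta)=R(D)$ for each $D\in\Sigma$; it is consistent with $\Theta$ if for each $B\in\mathfrak B(\Upsilon)$, $R_\theta(\Theta^{-1}(B))=1$ for $R_\Theta$-a.a. $\theta\in B$. (a1) for $R$: $W$ and $X$ are $R$-conditionally independent given $\Theta$. (a2) for $R$: $\Theta$ and $X$ are $R$-independent. $S$ is an $R$-CMPP$(g(\Theta),R_{X_1})$ if: $X$ is $R$-i.i.d.; $N$ and $X$ are $R$-independent; and, under $R$ and conditionally given $\Theta$, $N$ has stationary independent increments with $N_t$ having conditional law Poisson with mean $tg(\Theta)$ for every $t>0$. $Q\stackrel{pr}{\sim}P$ (progressive equivalence) means $Q$ and $P$ are equivalent on each $\mathcal F_t$, $t\ge0$. A martingale in $\mathcal L^1(R)$ is an $R$-integrable $\{\mathcal F_t\}$-adapted process with the martingale property under $R$ with respect to $\{\mathcal F_t\}_{t\ge0}$. $\mathcal F_P$: all functions $\beta:\Upsilon\times\Upsilon\to\mathbb R$ of the form $\beta(x,\theta)=\alpha(\theta)+\gamma(x)$ with $\alpha,\gamma:\Upsilon\to\mathbb R$ Borel measurable and $\mathbb E_P[e^{\gamma(X_1)}]=1$. $\mathcal R_+(\Upsilon)$: all Borel measurable $\xi:\Upsilon\to\mathbb R$ with $P_\Theta(\{\xi>0\})=1$ and $\mathbb E_P[\xi(\Theta)]=1$. Essential uniqueness of $\beta$ (or $(\beta,\xi)$) means uniqueness up to changing $\alpha,\xi$ on $P_\Theta$-null sets and $\gamma$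 on $P_{X_1}$-null sets.
   Formalization: Item (iii) alone does not imply (i) (e.g. Θ=1 P-a.s. but Θ uniform on {1,2} under Q, g=id), so the formal theorem proves (i)⇔(ii)⇔(iv)⇔[(iii) together with Q_Θ∼P_Θ]; in particular (i) still implies (iii) as stated. *)

theory Defs
  imports "HOL-Probability.Probability"
begin

section \<open>Laws, regular conditional probabilities, equivalence\<close>

abbreviation Ups :: "real set" where
  "Ups \<equiv> {0<..}"

abbreviation borel_Ups :: "real measure" where
  "borel_Ups \<equiv> restrict_space borel Ups"

text \<open>Functions on \<open>Ups\<close> are represented by total functions \<open>real \<Rightarrow> real\<close> that are measurable
  with respect to \<open>borel_Ups\<close>; their values outside \<open>Ups\<close> are irrelevant.  Likewise, laws are
  measures on \<open>borel_Ups\<close>; this is a probability measure whenever \<open>Z\<close> is almost surely positive.\<close>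

definition law :: "'a measure \<Rightarrow> ('a \<Rightarrow> real) \<Rightarrow> real measure" where
  "law R Z = restrict_space (distr R borel Z) Ups"

definition equivalent_measures :: "'a measure \<Rightarrow> 'a measure \<Rightarrow> bool" where
  "equivalent_measures M M' \<longleftrightarrow> absolutely_continuous M M' \<and> absolutely_continuous M' M"

definition is_RN_derivative :: "(real \<Rightarrow> real) \<Rightarrow> real measure \<Rightarrow> real measure \<Rightarrow> bool" where
  "is_RN_derivative f M' M \<longleftrightarrow>
     f \<in> borel_measurable M \<and> (AE x in M. 0 \<le> f x) \<and> density M (\<lambda>x. ennreal (f x)) = M'"

definition regular_cond_prob ::
  "'a measure \<Rightarrow> ('a \<Rightarrow> real) \<Rightarrow> (real \<Rightarrow> 'a measure) \<Rightarrow> bool" where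
  "regular_cond_prob R \<Theta> K \<longleftrightarrow>
     (\<forall>\<theta>\<in>Ups. prob_space (K \<theta>) \<and> sets (K \<theta>) = sets R) \<and>
     (\<forall>D\<in>sets R. (\<lambda>\<theta>. measure (K \<theta>) D) \<in> borel_measurable borel_Ups \<and>
                 (\<integral>\<theta>. measure (K \<theta>) D \<partial>law R \<Theta>) = measure R D)"

definition consistent_with ::
  "'a measure \<Rightarrow> ('a \<Rightarrow> real) \<Rightarrow> (real \<Rightarrow> 'a measure) \<Rightarrow> bool" where
  "consistent_with R \<Theta> K \<longleftrightarrow>
     (\<forall>B\<in>sets borel_Ups. AE \<theta> in law R \<Theta>. \<theta> \<in> B \<longrightarrow> measure (K \<theta>) (\<Theta> -` B \<inter> space R) = 1)"

section \<open>Conditional independence\<close>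

text \<open>These mirror \<^const>\<open>prob_space.indep_sets\<close>, \<^const>\<open>prob_space.indep_set\<close> and
  \<^const>\<open>prob_space.indep_vars\<close>, with conditional probabilities given \<open>G\<close>.\<close>

definition cond_indep_sets ::
  "'a measure \<Rightarrow> 'a measure \<Rightarrow> ('i \<Rightarrow> 'a set set) \<Rightarrow> 'i set \<Rightarrow> bool" where
  "cond_indep_sets R G F I \<longleftrightarrow>
     (\<forall>i\<in>I. F i \<subseteq> sets R) \<and>
     (\<forall>J\<subseteq>I. J \<noteq> {} \<longrightarrow> finite J \<longrightarrow> (\<forall>A\<in>Pi J F.
        AE \<omega> in R. real_cond_exp R G (indicator (\<Inter>j\<in>J. A j)) \<omega> =
                   (\<Prod>j\<in>J. real_cond_exp R G (indicator (A j)) \<omega>)))"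

definition cond_indep_set ::
  "'a measure \<Rightarrow> 'a measure \<Rightarrow> 'a set set \<Rightarrow> 'a set set \<Rightarrow> bool" where
  "cond_indep_set R G A B \<longleftrightarrow> cond_indep_sets R G (case_bool A B) UNIV"

definition cond_indep_vars ::
  "'a measure \<Rightarrow> 'a measure \<Rightarrow> ('i \<Rightarrow> 'b measure) \<Rightarrow> ('i \<Rightarrow> 'a \<Rightarrow> 'b) \<Rightarrow> 'i set \<Rightarrow> bool" where
  "cond_indep_vars R G M' Z I \<longleftrightarrow>
     (\<forall>i\<in>I. Z i \<in> measurable R (M' i)) \<and>
     cond_indep_sets R G (\<lambda>i. {Z i -` A \<inter> space R | A. A \<in> sets (M' i)}) I"

section \<open>Processes\<close>

definition process_sigma :: "'a set \<Rightarrow> 'i set \<Rightarrow> ('i \<Rightarrow> 'a \<Rightarrow> 'b) \<Rightarrow> 'b measure \<Rightarrow> 'a set set" where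
  "process_sigma \<Omega> I Z M = sigma_sets \<Omega> (\<Union>i\<in>I. {Z i -` B \<inter> \<Omega> | B. B \<in> sets M})"

definition arrival_time :: "(real \<Rightarrow> 'a \<Rightarrow> nat) \<Rightarrow> nat \<Rightarrow> 'a \<Rightarrow> real" where
  "arrival_time N n \<omega> = Inf {t. 0 \<le> t \<and> N t \<omega> = n}"

definition interarrival :: "(real \<Rightarrow> 'a \<Rightarrow> nat) \<Rightarrow> nat \<Rightarrow> 'a \<Rightarrow> real" where
  "interarrival N n \<omega> = arrival_time N n \<omega> - arrival_time N (n - 1) \<omega>"

text \<open>A non-decreasing integer valued process started at 0 takes its values in the natural numbers.
  Time is indexed by \<open>real\<close>, but only the times \<open>t \<ge> 0\<close> matter.\<close>

definition counting_process :: "'a measure \<Rightarrow> (real \<Rightarrow> 'a \<Rightarrow> nat) \<Rightarrow> bool" where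
  "counting_process R N \<longleftrightarrow>
     (\<forall>t\<ge>0. N t \<in> measurable R (count_space UNIV)) \<and>
     (\<forall>\<omega>\<in>space R.
        N 0 \<omega> = 0 \<and>
        (\<forall>s t. 0 \<le> s \<and> s \<le> t \<longrightarrow> N s \<omega> \<le> N t \<omega>) \<and>
        (\<forall>t\<ge>0. continuous (at_right t) (\<lambda>s. real (N s \<omega>))) \<and>
        (\<forall>t>0. \<exists>l. ((\<lambda>s. real (N s \<omega>)) \<longlongrightarrow> l) (at_left t) \<and> real (N t \<omega>) - l \<in> {0, 1}) \<and>
        filterlim (\<lambda>t. N t \<omega>) at_top at_top \<and>
        \<not> bdd_above (range (\<lambda>n. arrival_time N n \<omega>)))"

definition aggregate :: "(real \<Rightarrow> 'a \<Rightarrow> nat) \<Rightarrow> (nat \<Rightarrow> 'a \<Rightarrow> real) \<Rightarrow> real \<Rightarrow> 'a \<Rightarrow> real" where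
  "aggregate N X t \<omega> = (\<Sum>k=1..N t \<omega>. X k \<omega>)"

definition filt ::
  "'a set \<Rightarrow> ('a \<Rightarrow> real) \<Rightarrow> (real \<Rightarrow> 'a \<Rightarrow> real) \<Rightarrow> real \<Rightarrow> 'a measure" where
  "filt \<Omega> \<Theta> S t = sigma \<Omega>
     ((\<Union>u\<in>{0..t}. {S u -` B \<inter> \<Omega> | B. B \<in> sets borel}) \<union> {\<Theta> -` B \<inter> \<Omega> | B. B \<in> sets borel})"

definition prog_equivalent ::
  "(real \<Rightarrow> 'a measure) \<Rightarrow> 'a measure \<Rightarrow> 'a measure \<Rightarrow> bool" where
  "prog_equivalent F Q P \<longleftrightarrow>
     (\<forall>t\<ge>0. equivalent_measures (restr_to_subalg Q (F t)) (restr_to_subalg P (F t)))"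

definition L1_martingale ::
  "'a measure \<Rightarrow> (real \<Rightarrow> 'a measure) \<Rightarrow> (real \<Rightarrow> 'a \<Rightarrow> real) \<Rightarrow> bool" where
  "L1_martingale R F Y \<longleftrightarrow>
     (\<forall>t\<ge>0. integrable R (Y t) \<and> Y t \<in> borel_measurable (F t)) \<and>
     (\<forall>s t. 0 \<le> s \<and> s \<le> t \<longrightarrow> (AE \<omega> in R. real_cond_exp R (F s) (Y t) \<omega> = Y s \<omega>))"

section \<open>Compound mixed Poisson processes\<close>

abbreviation sigma_of :: "'a measure \<Rightarrow> ('a \<Rightarrow> real) \<Rightarrow> 'a measure" where
  "sigma_of R \<Theta> \<equiv> vimage_algebra (space R) \<Theta> borel"

definition condition_a1 ::
  "'a measure \<Rightarrow> ('a \<Rightarrow> real) \<Rightarrow> (real \<Rightarrow> 'a \<Rightarrow> nat) \<Rightarrow> (nat \<Rightarrow> 'a \<Rightarrow> real) \<Rightarrow> bool" where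
  "condition_a1 R \<Theta> N X \<longleftrightarrow>
     cond_indep_set R (sigma_of R \<Theta>)
       (process_sigma (space R) {1..} (interarrival N) borel)
       (process_sigma (space R) {1..} X borel)"

definition condition_a2 ::
  "'a measure \<Rightarrow> ('a \<Rightarrow> real) \<Rightarrow> (nat \<Rightarrow> 'a \<Rightarrow> real) \<Rightarrow> bool" where
  "condition_a2 R \<Theta> X \<longleftrightarrow>
     prob_space.indep_set R (sets (sigma_of R \<Theta>)) (process_sigma (space R) {1..} X borel)"

definition cond_stationary_increments ::
  "'a measure \<Rightarrow> 'a measure \<Rightarrow> (real \<Rightarrow> 'a \<Rightarrow> nat) \<Rightarrow> bool" where
  "cond_stationary_increments R G N \<longleftrightarrow>
     (\<forall>s t h B. 0 \<le> s \<and> s \<le> t \<and> 0 \<le> h \<longrightarrow>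
        (AE \<omega> in R.
           real_cond_exp R G (indicator {\<omega>\<in>space R. N (t + h) \<omega> - N (s + h) \<omega> \<in> B}) \<omega> =
           real_cond_exp R G (indicator {\<omega>\<in>space R. N t \<omega> - N s \<omega> \<in> B}) \<omega>))"

definition cond_independent_increments ::
  "'a measure \<Rightarrow> 'a measure \<Rightarrow> (real \<Rightarrow> 'a \<Rightarrow> nat) \<Rightarrow> bool" where
  "cond_independent_increments R G N \<longleftrightarrow>
     (\<forall>n (\<tau>::nat \<Rightarrow> real). 0 \<le> \<tau> 0 \<and> (\<forall>j<n. \<tau> j < \<tau> (Suc j)) \<longrightarrow>
        cond_indep_vars R G (\<lambda>_. count_space UNIV)
          (\<lambda>j \<omega>. N (\<tau> (Suc j)) \<omega> - N (\<tau> j) \<omega>) {..<n})"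

text \<open>\<open>S\<close> is an \<open>R\<close>-CMPP with mixing variable \<open>g \<circ> \<Theta>\<close>.  The parameter \<open>R\<^sub>X\<^sub>1\<close> of the
  notion is determined by \<open>R\<close> and \<open>X\<close>.\<close>

definition CMPP ::
  "'a measure \<Rightarrow> ('a \<Rightarrow> real) \<Rightarrow> (real \<Rightarrow> real) \<Rightarrow> (real \<Rightarrow> 'a \<Rightarrow> nat) \<Rightarrow> (nat \<Rightarrow> 'a \<Rightarrow> real) \<Rightarrow> bool"
where
  "CMPP R \<Theta> g N X \<longleftrightarrow>
     prob_space.indep_vars R (\<lambda>_. borel) X {1..} \<and>
     (\<forall>n\<ge>1. distr R borel (X n) = distr R borel (X 1)) \<and>
     prob_space.indep_set R
       (process_sigma (space R) {0..} N (count_space UNIV))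
       (process_sigma (space R) {1..} X borel) \<and>
     cond_stationary_increments R (sigma_of R \<Theta>) N \<and>
     cond_independent_increments R (sigma_of R \<Theta>) N \<and>
     (\<forall>t>0. \<forall>B.
        AE \<omega> in R. real_cond_exp R (sigma_of R \<Theta>) (indicator {\<omega>\<in>space R. N t \<omega> \<in> B}) \<omega> =
                   measure_pmf.prob (poisson_pmf (t * g (\<Theta> \<omega>))) B)"

section \<open>The classes of functions and the density processes\<close>

text \<open>\<open>\<alpha>\<close> and \<open>\<gamma>\<close> are determined by \<open>\<beta>\<close> on \<open>Ups\<close>, owing to the normalization of \<open>\<gamma>\<close>.\<close>

definition FP_decomposition ::
  "'a measure \<Rightarrow> (nat \<Rightarrow> 'a \<Rightarrow> real) \<Rightarrow> (real \<Rightarrow> real \<Rightarrow> real) \<Rightarrow> (real \<Rightarrow> real) \<Rightarrow> (real \<Rightarrow> real) \<Rightarrow> bool"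
where
  "FP_decomposition P X \<beta> \<alpha> \<gamma> \<longleftrightarrow>
     \<alpha> \<in> borel_measurable borel_Ups \<and> \<gamma> \<in> borel_measurable borel_Ups \<and>
     (\<forall>x\<in>Ups. \<forall>\<theta>\<in>Ups. \<beta> x \<theta> = \<alpha> \<theta> + \<gamma> x) \<and>
     integrable P (\<lambda>\<omega>. exp (\<gamma> (X 1 \<omega>))) \<and> (\<integral>\<omega>. exp (\<gamma> (X 1 \<omega>)) \<partial>P) = 1"

definition R_plus :: "'a measure \<Rightarrow> ('a \<Rightarrow> real) \<Rightarrow> (real \<Rightarrow> real) set" where
  "R_plus P \<Theta> =
     {\<xi>. \<xi> \<in> borel_measurable borel_Ups \<and> (AE \<theta> in law P \<Theta>. 0 < \<xi> \<theta>) \<and>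
         integrable (law P \<Theta>) \<xi> \<and> (\<integral>\<theta>. \<xi> \<theta> \<partial>law P \<Theta>) = 1}"

text \<open>\<open>ln f\<close> makes sense only where \<open>f\<close> is positive; on the exceptional null set \<open>\<gamma>\<close> is arbitrary.\<close>

definition log_RN ::
  "'a measure \<Rightarrow> 'a measure \<Rightarrow> (nat \<Rightarrow> 'a \<Rightarrow> real) \<Rightarrow> (real \<Rightarrow> real) \<Rightarrow> bool" where
  "log_RN P Q X \<gamma> \<longleftrightarrow>
     (\<exists>f. is_RN_derivative f (law Q (X 1)) (law P (X 1)) \<and> (AE x in law P (X 1). 0 < f x) \<and>
          (\<forall>x\<in>Ups. 0 < f x \<longrightarrow> \<gamma> x = ln (f x)))"

definition S_beta ::
  "(real \<Rightarrow> 'a \<Rightarrow> nat) \<Rightarrow> (nat \<Rightarrow> 'a \<Rightarrow> real) \<Rightarrow> (real \<Rightarrow> real \<Rightarrow> real) \<Rightarrow> real \<Rightarrow> real \<Rightarrow> 'a \<Rightarrow> real"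
where
  "S_beta N X \<beta> \<theta> t \<omega> = (\<Sum>k=1..N t \<omega>. \<beta> (X k \<omega>) \<theta>)"

definition M_tilde ::
  "(real \<Rightarrow> 'a \<Rightarrow> nat) \<Rightarrow> (nat \<Rightarrow> 'a \<Rightarrow> real) \<Rightarrow> (real \<Rightarrow> real \<Rightarrow> real) \<Rightarrow> (real \<Rightarrow> real) \<Rightarrow>
   real \<Rightarrow> real \<Rightarrow> 'a \<Rightarrow> real"
where
  "M_tilde N X \<beta> \<alpha> \<theta> t \<omega> = exp (S_beta N X \<beta> \<theta> t \<omega> - t * \<theta> * (exp (\<alpha> \<theta>) - 1))"

text \<open>Since \<open>\<alpha>\<close>, \<open>\<beta>\<close> and \<open>\<xi>\<close> live on \<open>Ups\<close>, the random variable is meaningful only where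
  \<open>\<Theta>\<close> is positive; it is set to 0 on the remaining null event.\<close>

definition M_mixed ::
  "('a \<Rightarrow> real) \<Rightarrow> (real \<Rightarrow> 'a \<Rightarrow> nat) \<Rightarrow> (nat \<Rightarrow> 'a \<Rightarrow> real) \<Rightarrow> (real \<Rightarrow> real \<Rightarrow> real) \<Rightarrow>
   (real \<Rightarrow> real) \<Rightarrow> (real \<Rightarrow> real) \<Rightarrow> real \<Rightarrow> 'a \<Rightarrow> real"
where
  "M_mixed \<Theta> N X \<beta> \<alpha> \<xi> t \<omega> =
     (if \<Theta> \<omega> \<in> Ups
      then \<xi> (\<Theta> \<omega>) * exp (S_beta N X \<beta> (\<Theta> \<omega>) t \<omega> - t * \<Theta> \<omega> * (exp (\<alpha> (\<Theta> \<omega>)) - 1))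
      else 0)"

text \<open>The properties required of \<open>\<beta>\<close> (with its components \<open>\<alpha>\<close>, \<open>\<gamma>\<close>) in the disintegrated
  characterization, and of the pair \<open>\<beta>\<close>, \<open>\<xi>\<close> in the mixed one.

  The former does not relate the laws of \<open>\<Theta>\<close> under \<open>P\<close> and \<open>Q\<close>: \<open>Qk\<close> is arbitrary on null sets
  of the law under \<open>Q\<close>, and nothing is required on the null set \<open>V\<close> of the law under \<open>P\<close>.  For
  example, let \<open>\<Theta> = 1\<close> \<open>P\<close>-a.s. and \<open>\<Theta> = 2\<close> \<open>Q\<close>-a.s., let \<open>N\<close> be Poisson with rate \<open>\<Theta>\<close> under
  both, let \<open>X\<close> have the same law under both, and put \<open>Pk \<theta> = P\<close> for all \<open>\<theta>\<close>, \<open>Qk 1 = P\<close>, and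
  \<open>Qk \<theta> = Q\<close> otherwise; then \<open>\<alpha> = 0\<close>, \<open>\<gamma> = 0\<close>, \<open>V = Ups - {1}\<close> satisfy it, although \<open>P\<close> and \<open>Q\<close>
  are mutually singular on the \<open>\<sigma>\<close>-algebra of \<open>\<Theta>\<close>.  To characterize equivalence it has to be
  combined with the equivalence of the laws of \<open>\<Theta>\<close>.\<close>

definition disintegrated_density where
  "disintegrated_density P Q \<Theta> N X g Pk Qk \<beta> \<alpha> \<gamma> \<longleftrightarrow>
     FP_decomposition P X \<beta> \<alpha> \<gamma> \<and>
     (\<forall>\<theta>\<in>Ups. g \<theta> = \<theta> * exp (\<alpha> \<theta>)) \<and>
     log_RN P Q X \<gamma> \<and>
     (\<exists>V\<in>null_sets (law P \<Theta>). \<forall>\<theta>\<in>Ups - V.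
        (\<forall>s t. 0 \<le> s \<and> s \<le> t \<longrightarrow>
           (\<forall>A\<in>sets (filt (space P) \<Theta> (aggregate N X) s).
              measure (Qk \<theta>) A = (LINT \<omega>:A|Pk \<theta>. M_tilde N X \<beta> \<alpha> \<theta> t \<omega>))) \<and>
        L1_martingale (Pk \<theta>) (filt (space P) \<Theta> (aggregate N X)) (M_tilde N X \<beta> \<alpha> \<theta>))"

definition mixed_density where
  "mixed_density P Q \<Theta> N X g \<beta> \<alpha> \<gamma> \<xi> \<longleftrightarrow>
     FP_decomposition P X \<beta> \<alpha> \<gamma> \<and> \<xi> \<in> R_plus P \<Theta> \<and>
     is_RN_derivative \<xi> (law Q \<Theta>) (law P \<Theta>) \<and>
     (AE \<omega> in P. g (\<Theta> \<omega>) = \<Theta> \<omega> * exp (\<alpha> (\<Theta> \<omega>))) \<and>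
     log_RN P Q X \<gamma> \<and>
     (\<forall>s t. 0 \<le> s \<and> s \<le> t \<longrightarrow>
        (\<forall>A\<in>sets (filt (space P) \<Theta> (aggregate N X) s).
           measure Q A = (LINT \<omega>:A|P. M_mixed \<Theta> N X \<beta> \<alpha> \<xi> t \<omega>))) \<and>
     L1_martingale P (filt (space P) \<Theta> (aggregate N X)) (M_mixed \<Theta> N X \<beta> \<alpha> \<xi>)"

end

theory Submission
  imports Defs
begin

text \<open>
  The key is a change of measure formula.  Given \<open>\<Theta>\<close>, the process \<open>N\<close> is Poisson and, by (a1) and (a2),
  the pair \<open>(\<Theta>, N)\<close> is independent of the i.i.d. claims.  So on an event fixing \<open>\<Theta> \<in> B\<close>, the values of
  \<open>N\<close> at finitely many times up to \<open>t\<close>, and \<open>X\<^sub>k \<in> D\<^sub>k\<close> for \<open>k \<le> N\<^sub>t\<close>, both \<open>Q\<close> and the measure with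
  \<open>P\<close>-density \<open>M\<^sub>t\<close> factor into explicit integrals, which agree by the scaling of the Poisson weights under
  \<open>\<theta> \<mapsto> \<theta> e\<^sup>\<alpha>\<close>.  As the claims are positive, \<open>N\<close> and the claims up to time \<open>t\<close> can be recovered from
  \<open>S\<close>; hence these events generate \<open>\<F>\<^sub>t\<close> and \<open>M\<^sub>t\<close> is \<open>\<F>\<^sub>t\<close>-measurable, which gives (iv) from (ii).
  Positivity of \<open>M\<^sub>t\<close> yields (i), and (i) yields (ii) by testing events in \<open>\<sigma>(\<Theta>)\<close> and events
  \<open>{X\<^sub>1 \<in> B, N\<^sub>n \<ge> 1}\<close>.  Disintegrating (iv) over \<open>\<Theta>\<close> for rational times and a countable generator
  of \<open>\<F>\<^sub>t\<close>, and passing to real times by right continuity, gives (iii) off a single null set.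
\<close>

section \<open>Paths of counting processes\<close>

text \<open>Two mismatches shape the proof. Condition (a1) concerns the interarrival times, while
  the Poisson property concerns increments of \<open>N\<close>; arrival times carry one into the
  other. And the functions of the statement live only on \<open>Ups\<close>, with densities
  determined only almost everywhere. So \<open>f\<close>, \<open>\<xi>\<close> and the rate under
  \<open>Q\<close> are replaced by Borel functions on the whole line that are positive everywhere;
  logarithms and cancellations then create no exceptional sets. Such choices lose nothing:
  \<open>\<alpha>\<close> is forced by \<open>g\<close>, and \<open>\<gamma>\<close> and
  \<open>\<xi>\<close> by uniqueness of Radon-Nikodym derivatives, which is also the source of
  essential uniqueness. Density identities are proved for non-negative extended integrals; they
  become Bochner integrals and martingales once the finite total mass of the target measure gives
  integrability. The way back from (iii) is short: it contains a positive density of the claim laws,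
  and together with the equivalence of the laws of \<Theta> this is (ii).\<close>

lemma counting_process_zero: "counting_process R N \<Longrightarrow> \<omega> \<in> space R \<Longrightarrow> N 0 \<omega> = 0"
  by (simp add: counting_process_def)

lemma counting_process_mono:
  "counting_process R N \<Longrightarrow> \<omega> \<in> space R \<Longrightarrow> 0 \<le> s \<Longrightarrow> s \<le> t \<Longrightarrow> N s \<omega> \<le> N t \<omega>"
  by (simp add: counting_process_def)

lemma counting_process_measurable:
  "counting_process R N \<Longrightarrow> 0 \<le> t \<Longrightarrow> N t \<in> measurable R (count_space UNIV)"
  by (simp add: counting_process_def)

lemma counting_process_left_limit:
  "counting_process R N \<Longrightarrow> \<omega> \<in> space R \<Longrightarrow> 0 < t \<Longrightarrow>
    \<exists>l. ((\<lambda>s. real (N s \<omega>)) \<longlongrightarrow> l) (at_left t) \<and> real (N t \<omega>) - l \<in> {0, 1}"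
  by (simp add: counting_process_def)

lemma counting_process_eventually_const:
  assumes "counting_process R N" "\<omega> \<in> space R" "0 \<le> t"
  shows "eventually (\<lambda>s. N s \<omega> = N t \<omega>) (at_right t)"
proof -
  have "((\<lambda>s. real (N s \<omega>)) \<longlongrightarrow> real (N t \<omega>)) (at_right t)"
    using assms by (simp add: counting_process_def continuous_within)
  then have "eventually (\<lambda>s. dist (real (N s \<omega>)) (real (N t \<omega>)) < 1) (at_right t)"
    by (rule tendstoD) simp
  then show ?thesis
    by eventually_elim (simp add: dist_real_def)
qed

lemma counting_process_const_right:
  assumes "counting_process R N" "\<omega> \<in> space R" "0 \<le> t"
  obtains u where "t < u" "\<And>s. t \<le> s \<Longrightarrow> s < u \<Longrightarrow> N s \<omega> = N t \<omega>"
proof -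
  obtain b where b: "t < b" "\<And>y. t < y \<Longrightarrow> y < b \<Longrightarrow> N y \<omega> = N t \<omega>"
    using counting_process_eventually_const[OF assms] unfolding eventually_at_right_field by blast
  show ?thesis
    by (rule that[OF b(1)]) (metis b(2) order_le_less)
qed

text \<open>Let \<open>s\<close> be the infimum of the times at which \<open>N\<close> is at least n
  > 0. Right continuity puts \<open>N\<close> at n or above at time \<open>s\<close>; the left limit
  there is at most n - 1 and the jump at most 1, which forces equality. Thus no level is
  skipped.\<close>

lemma counting_process_first_hit:
  assumes N: "counting_process R N" "\<omega> \<in> space R" and t: "0 \<le> t" "n \<le> N t \<omega>"
  shows "\<exists>s. 0 \<le> s \<and> s \<le> t \<and> N s \<omega> = n \<and> (\<forall>r. 0 \<le> r \<longrightarrow> r < s \<longrightarrow> N r \<omega> < n)"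
proof (cases "n = 0")
  case True
  show ?thesis
    by (rule exI[of _ 0]) (use t True counting_process_zero[OF N] in auto)
next
  case False
  define A where "A = {r. 0 \<le> r \<and> n \<le> N r \<omega>}"
  define s where "s = Inf A"
  have tA: "t \<in> A" and bdd: "bdd_below A" using t by (auto simp: A_def intro: bdd_belowI[of _ 0])
  have "0 \<le> s" unfolding s_def by (rule cInf_greatest) (use tA in \<open>auto simp: A_def\<close>)
  have "s \<le> t" unfolding s_def by (rule cInf_lower[OF tA bdd])
  have below: "N r \<omega> < n" if "0 \<le> r" "r < s" for r
    using cInf_lower[OF _ bdd, of r] that by (force simp: A_def s_def)
  obtain u where u: "s < u" "\<And>r. s \<le> r \<Longrightarrow> r < u \<Longrightarrow> N r \<omega> = N s \<omega>"
    using counting_process_const_right[OF N \<open>0 \<le> s\<close>] by blast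
  obtain r where "r \<in> A" "r < u" using cInf_lessD[of A u] tA u(1) by (auto simp: s_def)
  moreover have "s \<le> r" unfolding s_def by (rule cInf_lower[OF \<open>r \<in> A\<close> bdd])
  ultimately have ge: "n \<le> N s \<omega>" using u(2)[of r] by (simp add: A_def)
  with False have "0 < s" using \<open>0 \<le> s\<close> counting_process_zero[OF N] by (cases "s = 0") auto
  then obtain l where l: "((\<lambda>r. real (N r \<omega>)) \<longlongrightarrow> l) (at_left s)" "real (N s \<omega>) - l \<in> {0, 1}"
    using counting_process_left_limit[OF N] by blast
  have "eventually (\<lambda>r. r \<in> {0<..<s}) (at_left s)"
    using eventually_at_left_real[OF \<open>0 < s\<close>] .
  then have "eventually (\<lambda>r. real (N r \<omega>) \<le> real n - 1) (at_left s)"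
  proof eventually_elim
    case (elim r)
    then have "N r \<omega> < n" using below by simp
    then show ?case by linarith
  qed
  then have "l \<le> real n - 1"
    by (intro tendsto_upperbound[OF l(1)]) simp_all
  with l(2) ge have "N s \<omega> = n" by auto
  with \<open>0 \<le> s\<close> \<open>s \<le> t\<close> below show ?thesis by blast
qed

lemma counting_process_unbounded:
  assumes "counting_process R N" "\<omega> \<in> space R"
  obtains t where "0 \<le> t" "n \<le> N t \<omega>"
proof -
  have "eventually (\<lambda>t. n \<le> N t \<omega>) at_top"
    using assms by (auto simp: counting_process_def filterlim_at_top)
  then have "eventually (\<lambda>t. 0 \<le> t \<and> n \<le> N t \<omega>) at_top"
    using eventually_ge_at_top[of 0] by eventually_elim simp
  then show ?thesis using that by (auto dest: eventually_happens)
qed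

text \<open>The infimum defining the arrival time is attained, namely at the first hit of level n.
  This duality translates between \<open>N\<close> and its arrival times.\<close>

lemma arrival_time_le_iff:
  assumes N: "counting_process R N" "\<omega> \<in> space R" and t: "0 \<le> t"
  shows "arrival_time N n \<omega> \<le> t \<longleftrightarrow> n \<le> N t \<omega>"
proof -
  obtain t' where t': "0 \<le> t'" "n \<le> N t' \<omega>" using counting_process_unbounded[OF N] by blast
  obtain s where s: "0 \<le> s" "N s \<omega> = n" "\<And>r. 0 \<le> r \<Longrightarrow> r < s \<Longrightarrow> N r \<omega> < n"
    using counting_process_first_hit[OF N t'] by blast
  have "arrival_time N n \<omega> = s"
    unfolding arrival_time_def by (rule cInf_eq_minimum) (use s in force)+
  then show ?thesis
    using s counting_process_mono[OF N s(1), of t] t by force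
qed

text \<open>Level k is held from its first hit up to the first hit of k + 1, an interval of positive
  length that contains a rational. This turns unions over all earlier times into countable
  ones.\<close>

lemma counting_process_rational_hit:
  assumes N: "counting_process R N" "\<omega> \<in> space R" and s: "0 \<le> s" "k < N s \<omega>"
  obtains q where "q \<in> \<rat>" "0 \<le> q" "q < s" "N q \<omega> = k"
proof -
  obtain b where b: "0 \<le> b" "b \<le> s" "N b \<omega> = Suc k" "\<And>r. 0 \<le> r \<Longrightarrow> r < b \<Longrightarrow> N r \<omega> < Suc k"
    using counting_process_first_hit[OF N s(1) Suc_leI[OF s(2)]] by blast
  obtain a where a: "0 \<le> a" "N a \<omega> = k"
    using counting_process_first_hit[OF N s(1) less_imp_le[OF s(2)]] by blast
  have "a < b" using counting_process_mono[OF N b(1), of a] a b by force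
  then obtain q where q: "q \<in> \<rat>" "a < q" "q < b" using Rats_dense_in_real by blast
  then have "N q \<omega> = k"
    using counting_process_mono[OF N a(1), of q] b(4)[of q] a by force
  with q a b that show ?thesis by force
qed

lemma arrival_time_sum:
  assumes N: "counting_process R N" "\<omega> \<in> space R"
  shows "arrival_time N n \<omega> = (\<Sum>k=1..n. interarrival N k \<omega>)"
proof (induction n)
  case 0
  have "arrival_time N 0 \<omega> = 0"
    unfolding arrival_time_def by (rule cInf_eq_minimum) (use counting_process_zero[OF N] in auto)
  then show ?case by simp
qed (simp add: interarrival_def)

lemma sets_sigma_process_sigma:
  "sets (sigma \<Omega> (\<Union>i\<in>I. {Z i -` B \<inter> \<Omega> | B. B \<in> sets M})) = process_sigma \<Omega> I Z M"
  unfolding process_sigma_def by (rule sets_measure_of) auto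

section \<open>Reading a counting process off its interarrival times\<close>

definition process_algebra :: "'a set \<Rightarrow> 'i set \<Rightarrow> ('i \<Rightarrow> 'a \<Rightarrow> 'b) \<Rightarrow> 'b measure \<Rightarrow> 'a measure" where
  "process_algebra \<Omega> I Z M = sigma \<Omega> (\<Union>i\<in>I. {Z i -` B \<inter> \<Omega> | B. B \<in> sets M})"

lemma space_process_algebra [simp]: "space (process_algebra \<Omega> I Z M) = \<Omega>"
  by (simp add: process_algebra_def space_measure_of_conv)

lemma sets_process_algebra: "sets (process_algebra \<Omega> I Z M) = process_sigma \<Omega> I Z M"
  by (simp add: process_algebra_def sets_sigma_process_sigma)

lemma measurable_process_algebra:
  assumes "i \<in> I"  "\<And>\<omega>. \<omega> \<in> \<Omega> \<Longrightarrow> Z i \<omega> \<in> space M"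
  shows "Z i \<in> measurable (process_algebra \<Omega> I Z M) M"
proof (rule measurableI)
  show "Z i -` A \<inter> space (process_algebra \<Omega> I Z M) \<in> sets (process_algebra \<Omega> I Z M)"
    if "A \<in> sets M" for A
    using assms(1) that unfolding sets_process_algebra process_sigma_def
    by (auto intro!: sigma_sets.Basic)
qed (use assms in simp)

text \<open>This makes (a1), a condition on interarrival times, applicable to events about
  \<open>N\<close>: at least n claims have occurred by time t exactly if the first n interarrival
  times sum to at most t.\<close>

lemma counting_process_interarrival_measurable:
  assumes N: "counting_process R N" and t: "0 \<le> t"
  shows "N t \<in> measurable (process_algebra (space R) {1..} (interarrival N) borel) (count_space UNIV)"
proof -
  define G where "G = process_algebra (space R) {1..} (interarrival N) borel"
  have W: "interarrival N i \<in> borel_measurable G" if "1 \<le> i" for i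
    unfolding G_def by (rule measurable_process_algebra) (use that in auto)
  have sp: "space G = space R" by (simp add: G_def)
  have "{\<omega> \<in> space G. (\<Sum>k=1..n. interarrival N k \<omega>) \<le> t} \<in> sets G" for n
  proof -
    have "(\<lambda>\<omega>. \<Sum>k=1..n. interarrival N k \<omega>) \<in> borel_measurable G"
      by (rule borel_measurable_sum) (use W in auto)
    then show ?thesis by measurable
  qed
  moreover have "{\<omega> \<in> space G. (\<Sum>k=1..n. interarrival N k \<omega>) \<le> t} = {\<omega> \<in> space G. n \<le> N t \<omega>}" for n
    by (rule Collect_cong, rule conj_cong[OF refl],
        subst arrival_time_sum[OF N, symmetric]) (simp_all add: sp arrival_time_le_iff[OF N _ t])
  ultimately have ge: "{\<omega> \<in> space G. n \<le> N t \<omega>} \<in> sets G" for n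
    by simp
  have "N t -` {n} \<inter> space G = {\<omega> \<in> space G. n \<le> N t \<omega>} - {\<omega> \<in> space G. Suc n \<le> N t \<omega>}" for n
    by auto
  then have "N t -` {n} \<inter> space G \<in> sets G" for n
    using ge by auto
  then show ?thesis
    unfolding G_def[symmetric] by (simp add: measurable_count_space_eq2_countable)
qed

section \<open>The filtration of the aggregate process\<close>

locale claim_process =
  fixes R :: "'a measure" and \<Theta> :: "'a \<Rightarrow> real" and N :: "real \<Rightarrow> 'a \<Rightarrow> nat" and X :: "nat \<Rightarrow> 'a \<Rightarrow> real"
  assumes \<Theta>_measurable [measurable]: "\<Theta> \<in> borel_measurable R"
    and counting: "counting_process R N"
    and claims: "\<forall>n\<ge>1. X n \<in> borel_measurable R \<and> (\<forall>\<omega>\<in>space R. 0 < X n \<omega>)"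
begin

abbreviation "F \<equiv> filt (space R) \<Theta> (aggregate N X)"

text \<open>The information about the k-th claim that is available at time t. The default 1 for a
  claim not yet made is positive, so that functions measurable only on \<open>Ups\<close> can be
  applied.\<close>

definition visible_claim :: "real \<Rightarrow> nat \<Rightarrow> 'a \<Rightarrow> real" where
  "visible_claim t k \<omega> = (if k \<le> N t \<omega> then X k \<omega> else 1)"

lemma claim_measurable [measurable]: "1 \<le> n \<Longrightarrow> X n \<in> borel_measurable R"
  using claims by auto

lemma claim_pos: "1 \<le> n \<Longrightarrow> \<omega> \<in> space R \<Longrightarrow> 0 < X n \<omega>"
  using claims by auto

lemmas N_zero = counting_process_zero[OF counting]
  and N_mono = counting_process_mono[OF counting]
  and N_measurable [measurable] = counting_process_measurable[OF counting]

lemma space_F [simp]: "space (F t) = space R"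
  by (simp add: filt_def space_measure_of_conv)

lemma sets_F: "sets (F t) = sigma_sets (space R)
     ((\<Union>u\<in>{0..t}. {aggregate N X u -` B \<inter> space R | B. B \<in> sets borel}) \<union>
      {\<Theta> -` B \<inter> space R | B. B \<in> sets borel})"
  unfolding filt_def by (rule sets_measure_of) auto

lemma sets_F_mono: "s \<le> t \<Longrightarrow> sets (F s) \<subseteq> sets (F t)"
  unfolding sets_F by (intro sigma_sets_mono' Un_mono UN_mono) auto

lemma sets_F_least:
  assumes sp: "space G = space R" and "\<Theta> \<in> borel_measurable G"
    and "\<And>u. 0 \<le> u \<Longrightarrow> u \<le> t \<Longrightarrow> aggregate N X u \<in> borel_measurable G"
  shows "sets (F t) \<subseteq> sets G"
proof -
  have "sigma_sets (space G) ((\<Union>u\<in>{0..t}. {aggregate N X u -` B \<inter> space R | B. B \<in> sets borel}) \<union>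
      {\<Theta> -` B \<inter> space R | B. B \<in> sets borel}) \<subseteq> sets G"
    using measurable_sets[OF assms(2)] measurable_sets[OF assms(3)]
    by (intro sets.sigma_sets_subset) (auto simp: sp)
  then show ?thesis by (simp add: sets_F sp)
qed

lemma \<Theta>_measurable_F [measurable]: "\<Theta> \<in> borel_measurable (F t)"
  by (rule measurableI) (auto simp: sets_F intro: sigma_sets.Basic)

lemma aggregate_measurable_F: "0 \<le> u \<Longrightarrow> u \<le> t \<Longrightarrow> aggregate N X u \<in> borel_measurable (F t)"
proof (rule measurableI)
  show "aggregate N X u -` A \<inter> space (F t) \<in> sets (F t)" if "0 \<le> u" "u \<le> t" "A \<in> sets borel" for A
    unfolding sets_F space_F by (rule sigma_sets.Basic) (use that in fastforce)
qed simp

lemma measurable_random_sum: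
  fixes K :: "'b \<Rightarrow> nat"
  assumes "K \<in> measurable G (count_space UNIV)" and "\<And>k. 1 \<le> k \<Longrightarrow> f k \<in> borel_measurable G"
  shows "(\<lambda>\<omega>. \<Sum>k=1..K \<omega>. f k \<omega> :: real) \<in> borel_measurable G"
proof (rule measurable_compose_countable[where f = "\<lambda>n \<omega>. \<Sum>k=1..n. f k \<omega>" and g = K])
  show "(\<lambda>\<omega>. \<Sum>k=1..n. f k \<omega>) \<in> borel_measurable G" for n
    by (rule borel_measurable_sum) (use assms(2) in auto)
qed (fact assms(1))

text \<open>For u <= t, every claim counted by \<open>N u\<close> is visible at time t. The
  \<sigma>-algebra is a parameter because the lemma serves both for \<open>R\<close> itself and for
  the one generated by the elementary events.\<close>

lemma aggregate_measurable_visible: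
  assumes G: "space G = space R" "N u \<in> measurable G (count_space UNIV)"
    "\<And>k. 1 \<le> k \<Longrightarrow> visible_claim t k \<in> borel_measurable G" and u: "0 \<le> u" "u \<le> t"
  shows "aggregate N X u \<in> borel_measurable G"
proof (rule measurable_cong[THEN iffD1])
  show "(\<lambda>\<omega>. \<Sum>k=1..N u \<omega>. visible_claim t k \<omega>) \<in> borel_measurable G"
    using G(2,3) by (rule measurable_random_sum)
  show "(\<Sum>k=1..N u \<omega>. visible_claim t k \<omega>) = aggregate N X u \<omega>" if "\<omega> \<in> space G" for \<omega>
    unfolding aggregate_def
    by (rule sum.cong[OF refl]) (use N_mono[OF _ u, of \<omega>] that G(1) in \<open>auto simp: visible_claim_def\<close>)
qed

lemma subalgebra_F: "subalgebra R (F t)"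
proof -
  have "sets (F t) \<subseteq> sets R"
  proof (rule sets_F_least)
    fix u :: real assume u: "0 \<le> u" "u \<le> t"
    have [measurable]: "N u \<in> measurable R (count_space UNIV)" using u by measurable
    show "aggregate N X u \<in> borel_measurable R"
    proof (rule aggregate_measurable_visible)
      fix k :: nat assume [arith]: "1 \<le> k"
      have "(\<lambda>\<omega>. if k \<le> N u \<omega> then X k \<omega> else 1) \<in> borel_measurable R" by measurable
      then show "visible_claim u k \<in> borel_measurable R" by (simp add: visible_claim_def[abs_def])
    qed (use u in auto)
  qed auto
  then show ?thesis by (simp add: subalgebra_def)
qed

lemma sets_F_R: "A \<in> sets (F t) \<Longrightarrow> A \<in> sets R"
  using subalgebra_F by (auto simp: subalgebra_def)

section \<open>Recovering claim numbers and claim sizes from the aggregate process\<close>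

lemma aggregate_less_iff:
  assumes \<omega>: "\<omega> \<in> space R" and "0 \<le> q" "q \<le> s"
  shows "aggregate N X q \<omega> < aggregate N X s \<omega> \<longleftrightarrow> N q \<omega> < N s \<omega>"
proof
  assume "N q \<omega> < N s \<omega>"
  then have "{1..N q \<omega>} \<subset> {1..N s \<omega>}" by (auto simp: psubset_eq)
  then show "aggregate N X q \<omega> < aggregate N X s \<omega>"
    unfolding aggregate_def
    by (intro sum_strict_mono2[of _ _ "N s \<omega>"])
      (use claim_pos[OF _ \<omega>] \<open>N q \<omega> < N s \<omega>\<close> in \<open>auto intro: less_imp_le\<close>)
next
  assume "aggregate N X q \<omega> < aggregate N X s \<omega>"
  then have "N q \<omega> \<noteq> N s \<omega>" by (auto simp: aggregate_def)
  then show "N q \<omega> < N s \<omega>" using N_mono[OF \<omega> assms(2,3)] by simp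
qed

text \<open>The claims being positive, \<open>N\<close> can be recovered from the jumps of the aggregate process.\<close>

lemma N_ge_in_F: "0 \<le> s \<Longrightarrow> {\<omega>\<in>space R. k \<le> N s \<omega>} \<in> sets (F s)"
proof (induction k arbitrary: s)
  case 0
  then show ?case using sets.top[of "F s"] by simp
next
  case (Suc k)
  define I where "I = \<rat> \<inter> {0..<s}"
  have "countable I" by (simp add: I_def countable_rat)
  \<comment> \<open>The count exceeds k at time s exactly if it is at least k at some earlier
    rational time after which the aggregate process still grows. The rational time is found in the
    interval on which \<open>N\<close> equals k.\<close>
  have eq: "{\<omega>\<in>space R. Suc k \<le> N s \<omega>} =
    (\<Union>q\<in>I. {\<omega>\<in>space R. k \<le> N q \<omega>} \<inter> {\<omega>\<in>space (F s). aggregate N X q \<omega> < aggregate N X s \<omega>})"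
    (is "?L = ?R")
  proof (intro set_eqI iffI)
    fix \<omega> assume "\<omega> \<in> ?L"
    then have \<omega>: "\<omega> \<in> space R" "k < N s \<omega>" by auto
    then obtain q where "q \<in> \<rat>" "0 \<le> q" "q < s" "N q \<omega> = k"
      using counting_process_rational_hit[OF counting \<omega>(1) Suc.prems \<omega>(2)] by blast
    with \<omega> show "\<omega> \<in> ?R" using aggregate_less_iff[OF \<omega>(1), of q s] by (auto simp: I_def)
  next
    fix \<omega> assume "\<omega> \<in> ?R"
    then obtain q where q: "q \<in> I" "\<omega> \<in> space R" "k \<le> N q \<omega>" "aggregate N X q \<omega> < aggregate N X s \<omega>"
      by auto
    then show "\<omega> \<in> ?L" using aggregate_less_iff[OF q(2), of q s] by (auto simp: I_def)
  qed
  have "{\<omega>\<in>space R. k \<le> N q \<omega>} \<inter> {\<omega>\<in>space (F s). aggregate N X q \<omega> < aggregate N X s \<omega>} \<in> sets (F s)"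
    if "q \<in> I" for q
  proof (rule sets.Int)
    show "{\<omega>\<in>space R. k \<le> N q \<omega>} \<in> sets (F s)"
      using Suc.IH[of q] sets_F_mono[of q s] that by (auto simp: I_def)
    have [measurable]: "aggregate N X q \<in> borel_measurable (F s)" "aggregate N X s \<in> borel_measurable (F s)"
      using that by (auto intro!: aggregate_measurable_F simp: I_def)
    show "{\<omega>\<in>space (F s). aggregate N X q \<omega> < aggregate N X s \<omega>} \<in> sets (F s)"
      by measurable
  qed
  then show ?case unfolding eq by (intro sets.countable_UN'' \<open>countable I\<close>)
qed

lemma N_measurable_F_self: "0 \<le> s \<Longrightarrow> N s \<in> measurable (F s) (count_space UNIV)"
proof -
  assume "0 \<le> s"
  have "N s -` {n} \<inter> space (F s) = {\<omega> \<in> space R. n \<le> N s \<omega>} - {\<omega> \<in> space R. Suc n \<le> N s \<omega>}" for n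
    by auto
  then have "N s -` {n} \<inter> space (F s) \<in> sets (F s)" for n
    using N_ge_in_F[OF \<open>0 \<le> s\<close>] by auto
  then show ?thesis by (simp add: measurable_count_space_eq2_countable)
qed

lemma N_measurable_F: "0 \<le> s \<Longrightarrow> s \<le> t \<Longrightarrow> N s \<in> measurable (F t) (count_space UNIV)"
  using N_measurable_F_self[of s] measurable_mono[of "count_space UNIV" "count_space UNIV" "F s" "F t"]
    sets_F_mono[of s t] by auto

text \<open>If \<open>N s\<close> exceeds k, the k-th partial sum is the aggregate value at any
  rational time at which \<open>N\<close> equals k. If \<open>N s\<close> equals k, level k may have
  been reached only at \<open>s\<close> itself, so there the value at \<open>s\<close> is
  used.\<close>

lemma partial_sum_measurable_F:
  assumes s: "0 \<le> s"
  shows "(\<lambda>\<omega>. if k \<le> N s \<omega> then \<Sum>i=1..k. X i \<omega> else 0) \<in> borel_measurable (F s)"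
    (is "?V \<in> _")
proof (rule measurableI)
  fix B :: "real set" assume B: "B \<in> sets borel"
  define I where "I = \<rat> \<inter> {0..<s}"
  have "countable I" by (simp add: I_def countable_rat)
  have agg [measurable]: "aggregate N X q \<in> borel_measurable (F s)" if "0 \<le> q" "q \<le> s" for q
    using that by (rule aggregate_measurable_F)
  have [measurable]: "N q \<in> measurable (F s) (count_space UNIV)" if "0 \<le> q" "q \<le> s" for q
    using that by (rule N_measurable_F)
  have eq: "?V -` B \<inter> space (F s) = {\<omega>\<in>space (F s). N s \<omega> < k \<and> 0 \<in> B} \<union>
      {\<omega>\<in>space (F s). N s \<omega> = k \<and> aggregate N X s \<omega> \<in> B} \<union>
      (\<Union>q\<in>I. {\<omega>\<in>space (F s). k < N s \<omega> \<and> N q \<omega> = k \<and> aggregate N X q \<omega> \<in> B})" (is "?L = ?R")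
  proof (intro set_eqI iffI)
    fix \<omega> assume L: "\<omega> \<in> ?L"
    then have \<omega>: "\<omega> \<in> space R" by simp
    consider "N s \<omega> < k" | "N s \<omega> = k" | "k < N s \<omega>" by linarith
    then show "\<omega> \<in> ?R"
    proof cases
      case 3
      then obtain q where "q \<in> \<rat>" "0 \<le> q" "q < s" "N q \<omega> = k"
        using counting_process_rational_hit[OF counting \<omega> s] by blast
      with L 3 show ?thesis by (auto simp: I_def aggregate_def)
    qed (use L in \<open>auto simp: aggregate_def\<close>)
  qed (auto simp: aggregate_def)
  have "(\<Union>q\<in>I. {\<omega>\<in>space (F s). k < N s \<omega> \<and> N q \<omega> = k \<and> aggregate N X q \<omega> \<in> B}) \<in> sets (F s)"
  proof (intro sets.countable_UN'' \<open>countable I\<close>)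
    fix q assume "q \<in> I"
    then have [arith]: "0 \<le> q" "q \<le> s" by (auto simp: I_def)
    show "{\<omega>\<in>space (F s). k < N s \<omega> \<and> N q \<omega> = k \<and> aggregate N X q \<omega> \<in> B} \<in> sets (F s)"
      using B s by measurable
  qed
  moreover have "{\<omega>\<in>space (F s). N s \<omega> < k \<and> 0 \<in> B} \<in> sets (F s)"
    "{\<omega>\<in>space (F s). N s \<omega> = k \<and> aggregate N X s \<omega> \<in> B} \<in> sets (F s)"
    using B s by measurable
  ultimately show "?V -` B \<inter> space (F s) \<in> sets (F s)"
    unfolding eq by (intro sets.Un)
qed simp

text \<open>A claim is the difference of two consecutive partial sums, both of which are observable
  once the claim has been made.\<close>

lemma visible_claim_measurable_F:
  assumes s: "0 \<le> s" and k: "1 \<le> k"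
  shows "visible_claim s k \<in> borel_measurable (F s)"
proof -
  obtain j where j: "k = Suc j" using k by (cases k) auto
  have [measurable]: "N s \<in> measurable (F s) (count_space UNIV)"
    using s by (rule N_measurable_F_self)
  note [measurable] = partial_sum_measurable_F[OF s]
  have "visible_claim s k = (\<lambda>\<omega>. if k \<le> N s \<omega> then (if k \<le> N s \<omega> then \<Sum>i=1..k. X i \<omega> else 0)
      - (if j \<le> N s \<omega> then \<Sum>i=1..j. X i \<omega> else 0) else 1)"
    by (auto simp: visible_claim_def j)
  also have "\<dots> \<in> borel_measurable (F s)" by measurable
  finally show ?thesis .
qed

text \<open>The k-th claim itself need not be measurable at time t, but its visible version is and
  agrees with it for every index in the sum. Being positive everywhere, it can be inserted into
  \<open>\<gamma>\<close>, which is measurable on \<open>Ups\<close> only.\<close>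

lemma random_sum_measurable_F:
  assumes t: "0 \<le> t" and \<gamma>: "\<gamma> \<in> borel_measurable borel_Ups"
  shows "(\<lambda>\<omega>. \<Sum>k=1..N t \<omega>. \<gamma> (X k \<omega>) :: real) \<in> borel_measurable (F t)"
proof (rule measurable_cong[THEN iffD1])
  show "(\<lambda>\<omega>. \<Sum>k=1..N t \<omega>. \<gamma> (visible_claim t k \<omega>)) \<in> borel_measurable (F t)"
  proof (rule measurable_random_sum[OF N_measurable_F_self[OF t]])
    fix k :: nat assume k: "1 \<le> k"
    have "visible_claim t k \<in> measurable (F t) borel_Ups"
      by (rule measurable_restrict_space2[OF _ visible_claim_measurable_F[OF t k]])
        (use claim_pos[OF k] in \<open>auto simp: visible_claim_def\<close>)
    then show "(\<lambda>\<omega>. \<gamma> (visible_claim t k \<omega>)) \<in> borel_measurable (F t)"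
      using \<gamma> by (rule measurable_compose)
  qed
qed (auto simp: visible_claim_def intro!: sum.cong)

text \<open>Requiring \<open>t \<in> U\<close> fixes the number of claims up to time \<open>t\<close> on each event.  This makes the
  family stable under intersections and turns the density at time \<open>t\<close> into a product.\<close>

definition elementary_events :: "real \<Rightarrow> 'a set set" where
  "elementary_events t = {{\<omega>\<in>space R. \<Theta> \<omega> \<in> B \<and> (\<forall>u\<in>U. N u \<omega> = c u) \<and> (\<forall>k\<in>{1..c t}. X k \<omega> \<in> D k)} |
      B U c D. B \<in> sets borel \<and> finite U \<and> U \<subseteq> {0..t} \<and> t \<in> U \<and> (\<forall>k. D k \<in> sets borel)}"

lemma elementary_eventsI:
  assumes "B \<in> sets borel" "finite U" "U \<subseteq> {0..t}" "t \<in> U" "\<And>k. D k \<in> sets borel"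
    and "A = {\<omega>\<in>space R. \<Theta> \<omega> \<in> B \<and> (\<forall>u\<in>U. N u \<omega> = c u) \<and> (\<forall>k\<in>{1..c t}. X k \<omega> \<in> D k)}"
  shows "A \<in> elementary_events t"
  unfolding elementary_events_def mem_Collect_eq
  by (rule exI[of _ B], rule exI[of _ U], rule exI[of _ c], rule exI[of _ D]) (use assms in simp)

lemma elementary_eventsE:
  assumes "A \<in> elementary_events t"
  obtains B U D c where "B \<in> sets borel" "finite U" "U \<subseteq> {0..t}" "t \<in> U" "\<forall>k. D k \<in> sets borel"
    "A = {\<omega>\<in>space R. \<Theta> \<omega> \<in> B \<and> (\<forall>u\<in>U. N u \<omega> = c u) \<and> (\<forall>k\<in>{1..c t}. X k \<omega> \<in> D k)}"
proof -
  obtain B U c D where "B \<in> sets borel" "finite U" "U \<subseteq> {0..t}" "t \<in> U" "\<forall>k. D k \<in> sets borel"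
    "A = {\<omega>\<in>space R. \<Theta> \<omega> \<in> B \<and> (\<forall>u\<in>U. N u \<omega> = c u) \<and> (\<forall>k\<in>{1..c t}. X k \<omega> \<in> D k)}"
    using assms unfolding elementary_events_def mem_Collect_eq by (elim exE conjE) (rule that)
  then show thesis by (rule that)
qed

text \<open>Prescriptions that disagree at a common time have empty intersection, which is
  elementary with empty \<open>B\<close>. Otherwise they merge into one; since t belongs to both
  time sets, they restrict the same number of claims.\<close>

lemma Int_stable_elementary_events: "Int_stable (elementary_events t)"
proof (rule Int_stableI)
  fix A A' assume A: "A \<in> elementary_events t" and A': "A' \<in> elementary_events t"
  obtain B U D c where 1: "B \<in> sets borel" "finite U" "U \<subseteq> {0..t}" "t \<in> U" "\<forall>k. D k \<in> sets borel"
    "A = {\<omega>\<in>space R. \<Theta> \<omega> \<in> B \<and> (\<forall>u\<in>U. N u \<omega> = c u) \<and> (\<forall>k\<in>{1..c t}. X k \<omega> \<in> D k)}"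
    by (rule elementary_eventsE[OF A])
  obtain B' U' D' c' where 2: "B' \<in> sets borel" "finite U'" "U' \<subseteq> {0..t}" "t \<in> U'" "\<forall>k. D' k \<in> sets borel"
    "A' = {\<omega>\<in>space R. \<Theta> \<omega> \<in> B' \<and> (\<forall>u\<in>U'. N u \<omega> = c' u) \<and> (\<forall>k\<in>{1..c' t}. X k \<omega> \<in> D' k)}"
    by (rule elementary_eventsE[OF A'])
  show "A \<inter> A' \<in> elementary_events t"
  proof (cases "\<exists>u\<in>U \<inter> U'. c u \<noteq> c' u")
    case True
    then show ?thesis
      by (intro elementary_eventsI[of "{}" "{t}" _ "\<lambda>_. UNIV"]) (use 1 2 in auto)
  next
    case False
    then have "c t = c' t" "\<And>u. u \<in> U \<Longrightarrow> u \<in> U' \<Longrightarrow> c u = c' u" using 1(4) 2(4) by auto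
    then show ?thesis
      using 1 2
      by (intro elementary_eventsI[of "B \<inter> B'" "U \<union> U'" _ "\<lambda>k. D k \<inter> D' k" _ "\<lambda>u. if u \<in> U then c u else c' u"])
        (auto split: if_splits)
  qed
qed

text \<open>Since the aggregate process up to t is a function of the earlier counts and the visible
  claims, it suffices to generate these and \<Theta>. Each generating event is a countable union
  over the possible values n of \<open>N t\<close>, which an elementary event has to fix.\<close>

lemma sets_F_elementary_events:
  assumes t: "0 \<le> t"
  shows "sets (F t) \<subseteq> sigma_sets (space R) (elementary_events t)"
proof -
  define G where "G = sigma (space R) (elementary_events t)"
  have sub: "elementary_events t \<subseteq> Pow (space R)" by (auto simp: elementary_events_def)
  have G: "space G = space R" "sets G = sigma_sets (space R) (elementary_events t)"
    using sub by (auto simp: G_def)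
  have basic: "{\<omega>\<in>space R. \<Theta> \<omega> \<in> B \<and> (\<forall>u\<in>U. N u \<omega> = c u) \<and> (\<forall>k\<in>{1..c t}. X k \<omega> \<in> D k)} \<in> sets G"
    if "B \<in> sets borel" "finite U" "U \<subseteq> {0..t}" "t \<in> U" "\<And>k. D k \<in> sets borel" for B U c D
    unfolding G(2) by (rule sigma_sets.Basic, rule elementary_eventsI[OF that refl])
  have "\<Theta> -` B \<inter> space G \<in> sets G" if "B \<in> sets borel" for B
  proof -
    have "\<Theta> -` B \<inter> space G = (\<Union>n. {\<omega>\<in>space R. \<Theta> \<omega> \<in> B \<and> (\<forall>u\<in>{t}. N u \<omega> = n) \<and> (\<forall>k\<in>{1..n}. X k \<omega> \<in> UNIV)})"
      by (auto simp: G)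
    also have "\<dots> \<in> sets G"
      using that t basic[of B "{t}" "\<lambda>_. UNIV" "\<lambda>_. n" for n] by (intro sets.countable_UN) auto
    finally show ?thesis .
  qed
  then have 1: "\<Theta> \<in> borel_measurable G" by (intro measurableI) auto
  have 2: "N u \<in> measurable G (count_space UNIV)" if u: "0 \<le> u" "u \<le> t" for u
  proof -
    have "N u -` {m} \<inter> space G \<in> sets G" for m
    proof -
      have "N u -` {m} \<inter> space G = (\<Union>n. {\<omega>\<in>space R. \<Theta> \<omega> \<in> UNIV \<and>
          (\<forall>v\<in>{u,t}. N v \<omega> = (if v = u then m else n)) \<and>
          (\<forall>k\<in>{1..(if t = u then m else n)}. X k \<omega> \<in> UNIV)})"
        by (auto simp: G)
      also have "\<dots> \<in> sets G"
        using u basic[of UNIV "{u,t}" "\<lambda>_. UNIV" "\<lambda>v. if v = u then m else n" for n]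
        by (intro sets.countable_UN) auto
      finally show ?thesis .
    qed
    then show ?thesis by (simp add: measurable_count_space_eq2_countable)
  qed
  have 3: "visible_claim t k \<in> borel_measurable G" if k: "1 \<le> k" for k
  proof (rule measurableI)
    fix B :: "real set" assume B: "B \<in> sets borel"
    \<comment> \<open>If the claim is not yet visible, the event is decided by whether the default 1
      lies in \<open>B\<close>. This deterministic alternative is encoded as a condition on \<Theta>
      that holds always or never.\<close>
    have "visible_claim t k -` B \<inter> space G = (\<Union>n. {\<omega>\<in>space R. \<Theta> \<omega> \<in> {\<theta>. k \<le> n \<or> 1 \<in> B} \<and>
       (\<forall>u\<in>{t}. N u \<omega> = n) \<and> (\<forall>i\<in>{1..n}. X i \<omega> \<in> (if i = k then B else UNIV))})"
    proof (intro set_eqI)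
      fix \<omega>
      show "(\<omega> \<in> visible_claim t k -` B \<inter> space G) \<longleftrightarrow> (\<omega> \<in> (\<Union>n. {\<omega>\<in>space R. \<Theta> \<omega> \<in> {\<theta>. k \<le> n \<or> 1 \<in> B} \<and>
         (\<forall>u\<in>{t}. N u \<omega> = n) \<and> (\<forall>i\<in>{1..n}. X i \<omega> \<in> (if i = k then B else UNIV))}))"
        by (cases "k \<le> N t \<omega>") (use k in \<open>auto simp: G visible_claim_def\<close>)
    qed
    also have "\<dots> \<in> sets G"
      by (intro sets.countable_UN image_subsetI basic) (use t B in auto)
    finally show "visible_claim t k -` B \<inter> space G \<in> sets G" .
  qed simp
  have "sets (F t) \<subseteq> sets G"
    by (rule sets_F_least[OF G(1) 1]) (use aggregate_measurable_visible[OF G(1) 2 3] in auto)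
  then show ?thesis by (simp add: G)
qed

text \<open>By right continuity, rational times suffice to generate the \<open>\<sigma>\<close>-algebra at a rational time.\<close>

definition rational_generator :: "real \<Rightarrow> 'a set set" where
  "rational_generator t = (\<lambda>(q, b). {\<omega>\<in>space R. aggregate N X q \<omega> \<le> b}) ` ((\<rat> \<inter> {0..t}) \<times> \<rat>) \<union>
     (\<lambda>b. {\<omega>\<in>space R. \<Theta> \<omega> \<le> b}) ` \<rat>"

lemma sets_F_rational_generator:
  assumes t: "t \<in> \<rat>"
  shows "sets (F t) = sigma_sets (space R) (rational_generator t)"
proof
  define G where "G = sigma (space R) (rational_generator t)"
  have G: "space G = space R" "sets G = sigma_sets (space R) (rational_generator t)"
    unfolding G_def by (auto simp: rational_generator_def space_measure_of_conv intro!: sets_measure_of)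
  have meas: "f \<in> borel_measurable G" if "\<And>b. b \<in> \<rat> \<Longrightarrow> {\<omega>\<in>space R. f \<omega> \<le> b} \<in> sets G" for f :: "'a \<Rightarrow> real"
  proof (rule borel_measurableI_le)
    fix y
    have "{\<omega>\<in>space G. f \<omega> \<le> y} = (\<Inter>b\<in>{b\<in>\<rat>. y < b}. {\<omega>\<in>space R. f \<omega> \<le> b})" (is "?L = ?R")
    proof (intro set_eqI iffI)
      fix \<omega> assume R: "\<omega> \<in> ?R"
      obtain b where "b \<in> \<rat>" "y < b" using Rats_dense_in_real[of y "y + 1"] by auto
      with R have \<omega>: "\<omega> \<in> space R" by auto
      have "f \<omega> \<le> y"
      proof (rule ccontr)
        assume "\<not> f \<omega> \<le> y"
        then obtain b where "b \<in> \<rat>" "y < b" "b < f \<omega>" using Rats_dense_in_real[of y "f \<omega>"] by auto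
        with R show False by force
      qed
      with \<omega> show "\<omega> \<in> ?L" by (simp add: G)
    qed (auto simp: G)
    also have "\<dots> \<in> sets G"
    proof (rule sets.countable_INT')
      show "countable {b\<in>\<rat>. y < b}" by (rule countable_subset[OF _ countable_rat]) auto
      show "{b\<in>\<rat>. y < b} \<noteq> {}" using Rats_dense_in_real[of y "y + 1"] by auto
    qed (use that in auto)
    finally show "{\<omega>\<in>space G. f \<omega> \<le> y} \<in> sets G" .
  qed
  have rat: "aggregate N X q \<in> borel_measurable G" if "q \<in> \<rat>" "0 \<le> q" "q \<le> t" for q
  proof (rule meas)
    fix b :: real assume "b \<in> \<rat>"
    show "{\<omega>\<in>space R. aggregate N X q \<omega> \<le> b} \<in> sets G"
      unfolding G(2) rational_generator_def
      by (intro sigma_sets.Basic UnI1 image_eqI[of _ _ "(q, b)"]) (use that \<open>b \<in> \<rat>\<close> in auto)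
  qed
  have "sets (F t) \<subseteq> sets G"
  proof (rule sets_F_least[OF G(1)])
    show "\<Theta> \<in> borel_measurable G"
      by (rule meas) (auto simp: G(2) rational_generator_def intro: sigma_sets.Basic)
    fix u :: real assume u: "0 \<le> u" "u \<le> t"
    show "aggregate N X u \<in> borel_measurable G"
    proof (cases "u = t")
      case True
      with rat t u show ?thesis by auto
    next
      case False
      with u have "u < t" by simp
      \<comment> \<open>The approximating times must be rational, approach u from the right and stay
        below t. This is possible because u < t; at u = t the rationality of t takes over.\<close>
      have "\<exists>q. q \<in> \<rat> \<and> u < q \<and> q < min t (u + 1 / real (Suc n))" for n
        using Rats_dense_in_real[of u "min t (u + 1 / real (Suc n))"] \<open>u < t\<close> by auto
      then obtain q where q: "\<And>n. q n \<in> \<rat>" "\<And>n. u < q n" "\<And>n. q n < min t (u + 1 / real (Suc n))"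
        by metis
      have lim: "(\<lambda>n. u + 1 / real (Suc n)) \<longlonglongrightarrow> u"
        using tendsto_add[OF tendsto_const[of u] LIMSEQ_Suc[OF lim_1_over_n]] by simp
      have "u \<le> q n \<and> q n \<le> u + 1 / real (Suc n)" for n
        using q(2,3)[of n] by linarith
      then have "q \<longlonglongrightarrow> u"
        by (intro tendsto_sandwich[OF _ _ tendsto_const lim] always_eventually allI) auto
      then have q_lim: "filterlim q (at_right u) sequentially"
        using q(2) by (auto simp: filterlim_at intro!: always_eventually)
      show ?thesis
      proof (rule borel_measurable_LIMSEQ_real)
        show "aggregate N X (q n) \<in> borel_measurable G" for n
        proof (rule rat[OF q(1)])
          show "0 \<le> q n" using q(2)[of n] u(1) by linarith
          show "q n \<le> t" using q(3)[of n] by linarith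
        qed
        fix \<omega> assume "\<omega> \<in> space G"
        then have "eventually (\<lambda>s. N s \<omega> = N u \<omega>) (at_right u)"
          by (intro counting_process_eventually_const[OF counting]) (use u G in auto)
        then have "eventually (\<lambda>n. N (q n) \<omega> = N u \<omega>) sequentially"
          using q_lim by (rule eventually_compose_filterlim)
        then have "eventually (\<lambda>n. aggregate N X (q n) \<omega> = aggregate N X u \<omega>) sequentially"
          by eventually_elim (simp add: aggregate_def)
        then show "(\<lambda>n. aggregate N X (q n) \<omega>) \<longlonglongrightarrow> aggregate N X u \<omega>"
          by (rule tendsto_eventually)
      qed
    qed
  qed
  then show "sets (F t) \<subseteq> sigma_sets (space R) (rational_generator t)" by (simp add: G)
  have "rational_generator t \<subseteq> sets (F t)"
  proof
    fix A assume "A \<in> rational_generator t"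
    then consider q b where "0 \<le> q" "q \<le> t" "A = {\<omega>\<in>space R. aggregate N X q \<omega> \<le> b}"
      | b where "A = {\<omega>\<in>space R. \<Theta> \<omega> \<le> b}"
      by (auto simp: rational_generator_def)
    then show "A \<in> sets (F t)"
    proof cases
      case 1
      then show ?thesis
        using borel_measurable_le[OF aggregate_measurable_F[of q t] borel_measurable_const[of b]] by simp
    next
      case 2
      then show ?thesis
        using borel_measurable_le[OF \<Theta>_measurable_F[of t] borel_measurable_const[of b]] by simp
    qed
  qed
  then show "sigma_sets (space R) (rational_generator t) \<subseteq> sets (F t)"
    using sets.sigma_sets_subset[of "rational_generator t" "F t"] by simp
qed

lemma countable_rational_generator: "countable (rational_generator t)"
  unfolding rational_generator_def by (intro countable_Un countable_image countable_SIGMA countable_Int1 countable_rat)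

section \<open>Elementary events in terms of increments\<close>

lemma elementary_events_sets: "elementary_events t \<subseteq> sets R"
proof
  fix E assume E: "E \<in> elementary_events t"
  obtain B U D c where 1: "B \<in> sets borel" "finite U" "U \<subseteq> {0..t}" "t \<in> U" "\<forall>k. D k \<in> sets borel"
    "E = {\<omega>\<in>space R. \<Theta> \<omega> \<in> B \<and> (\<forall>u\<in>U. N u \<omega> = c u) \<and> (\<forall>k\<in>{1..c t}. X k \<omega> \<in> D k)}"
    by (rule elementary_eventsE[OF E])
  note [measurable] = 1(1) 1(5)[rule_format]
  have "{\<omega>\<in>space R. N u \<omega> = c u} \<in> sets R" if "u \<in> U" for u
  proof -
    have [measurable]: "N u \<in> measurable R (count_space UNIV)"
      using 1(3) that by (auto intro: N_measurable)
    show ?thesis by measurable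
  qed
  then have "{\<omega>\<in>space R. \<forall>u\<in>U. N u \<omega> = c u} \<in> sets R"
    using 1(2) by (intro sets.sets_Collect_finite_All) auto
  moreover have "{\<omega>\<in>space R. \<forall>k\<in>{1..c t}. X k \<omega> \<in> D k} \<in> sets R"
    by (intro sets.sets_Collect_finite_All) auto
  moreover have "{\<omega>\<in>space R. \<Theta> \<omega> \<in> B} \<in> sets R" by measurable
  ultimately have "{\<omega>\<in>space R. \<Theta> \<omega> \<in> B} \<inter> {\<omega>\<in>space R. \<forall>u\<in>U. N u \<omega> = c u} \<inter>
      {\<omega>\<in>space R. \<forall>k\<in>{1..c t}. X k \<omega> \<in> D k} \<in> sets R"
    by (intro sets.Int)
  moreover have "E = {\<omega>\<in>space R. \<Theta> \<omega> \<in> B} \<inter> {\<omega>\<in>space R. \<forall>u\<in>U. N u \<omega> = c u} \<inter>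
      {\<omega>\<in>space R. \<forall>k\<in>{1..c t}. X k \<omega> \<in> D k}"
    unfolding 1(6) by blast
  ultimately show "E \<in> sets R" by metis
qed

text \<open>Prescribed values at the times in \<open>U\<close> become prescribed increments along 0
  and the ordered points of \<open>U\<close>. The sample point \<open>\<omega>0\<close> guarantees
  that the prescription starts from \<open>N 0 = 0\<close> and is monotone, so that truncated
  subtraction of naturals loses nothing.\<close>

lemma elementary_event_increments:
  assumes U: "finite U" "U \<subseteq> {0..t}" "t \<in> U" and ne: "\<omega>0 \<in> space R" "\<forall>u\<in>U. N u \<omega>0 = c u"
  obtains \<tau> n ks where "\<tau> 0 = 0" "\<tau> n = t" "\<forall>j<n. \<tau> j < \<tau> (Suc j)" "(\<Sum>j<n. ks j) = c t"
    "{\<omega>\<in>space R. \<forall>u\<in>U. N u \<omega> = c u} = {\<omega>\<in>space R. \<forall>j<n. N (\<tau> (Suc j)) \<omega> - N (\<tau> j) \<omega> = ks j}"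
proof -
  define us where "us = sorted_list_of_set (insert 0 U)"
  define n where "n = length us - 1"
  define \<tau> where "\<tau> j = us ! j" for j
  \<comment> \<open>The prescribed increments are read off the path of the witness, which realizes
    the values \<open>c\<close>.\<close>
  define ks where "ks j = N (\<tau> (Suc j)) \<omega>0 - N (\<tau> j) \<omega>0" for j
  have set_us: "set us = insert 0 U" using U unfolding us_def by (intro set_sorted_list_of_set) simp
  have ss: "sorted_wrt (<) us" unfolding us_def by (rule strict_sorted_list_of_set)
  have len: "length us = Suc n" using set_us by (cases us) (auto simp: n_def)
  have \<tau>_less: "\<tau> i < \<tau> j" if "i < j" "j \<le> n" for i j
    unfolding \<tau>_def using that len by (intro sorted_wrt_nth_less[OF ss]) auto
  have range: "insert 0 U = \<tau> ` {..n}"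
    unfolding set_us[symmetric] \<tau>_def using len by (auto simp: set_conv_nth less_Suc_eq_le)
  have mem: "\<tau> j \<in> insert 0 U" if "j \<le> n" for j using range that by auto
  have t: "0 \<le> t" using U by auto
  have \<tau>0: "\<tau> 0 = 0"
  proof -
    obtain j where j: "j \<le> n" "\<tau> j = 0" using range by (metis (no_types) atMost_iff imageE insertI1)
    have "0 \<le> \<tau> 0" using mem[of 0] U by auto
    with j \<tau>_less[of 0 j] show ?thesis by (cases "j = 0") auto
  qed
  have \<tau>n: "\<tau> n = t"
  proof -
    obtain j where j: "j \<le> n" "\<tau> j = t" using range U(3) by (metis (no_types) atMost_iff imageE insertI2)
    have "\<tau> n \<le> t" using mem[of n] U t by auto
    with j \<tau>_less[of j n] show ?thesis by (cases "j = n") auto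
  qed
  have \<tau>_pos: "0 \<le> \<tau> j" if "j \<le> n" for j using \<tau>_less[of 0 j] \<tau>0 that by (cases "j = 0") auto
  have mono: "N (\<tau> j) \<omega> \<le> N (\<tau> (Suc j)) \<omega>" if "\<omega> \<in> space R" "j < n" for j \<omega>
    using that \<tau>_pos[of j] \<tau>_less[of j "Suc j"] by (intro N_mono) auto
  have sum: "(\<Sum>j<m. ks j) = N (\<tau> m) \<omega>0" if "m \<le> n" for m
    using that
  proof (induction m)
    case 0
    then show ?case using N_zero[OF ne(1)] \<tau>0 by simp
  next
    case (Suc m)
    then show ?case using mono[OF ne(1), of m] by (simp add: ks_def)
  qed
  have "{\<omega>\<in>space R. \<forall>u\<in>U. N u \<omega> = c u} = {\<omega>\<in>space R. \<forall>u\<in>insert 0 U. N u \<omega> = N u \<omega>0}"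
    using ne N_zero by auto
  also have "\<dots> = {\<omega>\<in>space R. \<forall>j\<le>n. N (\<tau> j) \<omega> = N (\<tau> j) \<omega>0}"
    unfolding range by auto
  also have "\<dots> = {\<omega>\<in>space R. \<forall>j<n. N (\<tau> (Suc j)) \<omega> - N (\<tau> j) \<omega> = ks j}"
  proof (intro Collect_cong conj_cong refl iffI allI impI)
    fix \<omega> j assume \<omega>: "\<omega> \<in> space R" and inc: "\<forall>j<n. N (\<tau> (Suc j)) \<omega> - N (\<tau> j) \<omega> = ks j" and "j \<le> n"
    then show "N (\<tau> j) \<omega> = N (\<tau> j) \<omega>0"
    proof (induction j)
      case 0
      then show ?case using N_zero[OF ne(1)] N_zero[OF \<omega>] \<tau>0 by simp
    next
      case (Suc j)
      then have "N (\<tau> j) \<omega> = N (\<tau> j) \<omega>0" by simp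
      moreover have "N (\<tau> (Suc j)) \<omega> - N (\<tau> j) \<omega> = ks j" using Suc.prems by (meson Suc_le_lessD)
      ultimately show ?case using mono[OF ne(1), of j] mono[OF \<omega>, of j] Suc.prems by (simp add: ks_def)
    qed
  qed (simp add: ks_def)
  finally have "{\<omega>\<in>space R. \<forall>u\<in>U. N u \<omega> = c u} = {\<omega>\<in>space R. \<forall>j<n. N (\<tau> (Suc j)) \<omega> - N (\<tau> j) \<omega> = ks j}" .
  moreover have "(\<Sum>j<n. ks j) = c t" using sum[of n] \<tau>n ne U(3) by simp
  ultimately show thesis using \<tau>0 \<tau>n \<tau>_less by (intro that[of \<tau> n ks]) auto
qed

end

section \<open>Laws, densities and Poisson weights\<close>

lemma space_law [simp]: "space (law R Z) = Ups"
  by (simp add: law_def space_restrict_space)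

lemma sets_law [measurable_cong]: "sets (law R Z) = sets borel_Ups"
  by (simp add: law_def sets_restrict_space)

lemma measurable_borel_Ups: "f \<in> measurable borel M \<Longrightarrow> f \<in> measurable borel_Ups M"
  by (rule measurable_restrict_space1)

lemma measurable_law: "f \<in> measurable borel M \<Longrightarrow> f \<in> measurable (law R Z) M"
  unfolding measurable_cong_sets[OF sets_law refl] by (rule measurable_borel_Ups)

lemma sets_borel_Ups_iff: "B \<in> sets borel_Ups \<longleftrightarrow> B \<subseteq> Ups \<and> B \<in> sets borel"
  by (subst sets_restrict_space_iff) auto

lemma emeasure_law:
  assumes "Z \<in> borel_measurable R" "B \<in> sets borel_Ups"
  shows "emeasure (law R Z) B = emeasure R (Z -` B \<inter> space R)"
  using assms by (simp add: law_def sets_borel_Ups_iff emeasure_restrict_space emeasure_distr)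

lemma AE_law_D:
  assumes "Z \<in> borel_measurable R" "AE x in law R Z. P x"
  shows "AE \<omega> in R. Z \<omega> \<in> Ups \<longrightarrow> P (Z \<omega>)"
proof -
  have "AE x in distr R borel Z. x \<in> Ups \<longrightarrow> P x"
    using assms(2) unfolding law_def by (subst (asm) AE_restrict_space_iff) simp_all
  then show ?thesis by (rule AE_distrD[OF assms(1)])
qed

lemma AE_law_I:
  assumes "Z \<in> borel_measurable R" "{x\<in>Ups. P x} \<in> sets borel_Ups" "AE \<omega> in R. Z \<omega> \<in> Ups \<longrightarrow> P (Z \<omega>)"
  shows "AE x in law R Z. P x"
proof -
  have "- (Ups - {x\<in>Ups. P x}) \<in> sets borel"
    using assms(2) by (auto simp: sets_borel_Ups_iff)
  also have "- (Ups - {x\<in>Ups. P x}) = {x. x \<in> Ups \<longrightarrow> P x}" by auto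
  finally have "AE x in distr R borel Z. x \<in> Ups \<longrightarrow> P x"
    using assms(1,3) by (subst AE_distr_iff) auto
  then show ?thesis unfolding law_def by (subst AE_restrict_space_iff) simp_all
qed

lemma nn_integral_law:
  assumes [measurable]: "Z \<in> borel_measurable R" "h \<in> borel_measurable borel" and "AE \<omega> in R. Z \<omega> \<in> Ups"
  shows "(\<integral>\<^sup>+x. h x \<partial>law R Z) = (\<integral>\<^sup>+\<omega>. h (Z \<omega>) \<partial>R)"
proof -
  have "(\<integral>\<^sup>+x. h x \<partial>law R Z) = (\<integral>\<^sup>+\<omega>. h (Z \<omega>) * indicator Ups (Z \<omega>) \<partial>R)"
    by (simp add: law_def nn_integral_restrict_space nn_integral_distr)
  also have "\<dots> = (\<integral>\<^sup>+\<omega>. h (Z \<omega>) \<partial>R)"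
    by (rule nn_integral_cong_AE) (use assms(3) in auto)
  finally show ?thesis .
qed

lemma nn_integral_law_density:
  assumes [measurable]: "Z \<in> borel_measurable P" "Z \<in> borel_measurable Q" "f \<in> borel_measurable borel" "h \<in> borel_measurable borel"
    and AE: "AE \<omega> in P. Z \<omega> \<in> Ups" "AE \<omega> in Q. Z \<omega> \<in> Ups"
    and f: "density (law P Z) f = law Q Z"
  shows "(\<integral>\<^sup>+\<omega>. h (Z \<omega>) \<partial>Q) = (\<integral>\<^sup>+\<omega>. f (Z \<omega>) * h (Z \<omega>) \<partial>P)"
proof -
  have "(\<integral>\<^sup>+\<omega>. h (Z \<omega>) \<partial>Q) = (\<integral>\<^sup>+x. h x \<partial>law Q Z)"
    by (rule nn_integral_law[symmetric]) (use AE in auto)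
  also have "\<dots> = (\<integral>\<^sup>+x. f x * h x \<partial>law P Z)"
    unfolding f[symmetric] by (intro nn_integral_density measurable_law) auto
  also have "\<dots> = (\<integral>\<^sup>+\<omega>. f (Z \<omega>) * h (Z \<omega>) \<partial>P)"
    by (rule nn_integral_law) (use AE in auto)
  finally show ?thesis .
qed

lemma (in prob_space) prob_space_law:
  assumes [measurable]: "Z \<in> borel_measurable M" and "AE \<omega> in M. Z \<omega> \<in> Ups"
  shows "prob_space (law M Z)"
proof
  have "emeasure (law M Z) Ups = emeasure M {\<omega>\<in>space M. Z \<omega> \<in> Ups}"
    by (subst emeasure_law) (auto simp: sets_borel_Ups_iff vimage_def Int_def conj_commute)
  also have "\<dots> = 1" using assms by (subst emeasure_eq_1_AE) auto
  finally show "emeasure (law M Z) (space (law M Z)) = 1" by simp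
qed

text \<open>Absolute continuity in the reverse direction makes the Radon-Nikodym derivative positive
  almost everywhere. Where it vanishes, and outside \<open>Ups\<close>, it is replaced by 1; this
  leaves the density measure unchanged and makes the logarithm meaningful everywhere.\<close>

lemma positive_density_exists:
  assumes "prob_space P" "prob_space Q"
    and Z: "Z \<in> borel_measurable P" "Z \<in> borel_measurable Q" "AE \<omega> in P. Z \<omega> \<in> Ups" "AE \<omega> in Q. Z \<omega> \<in> Ups"
    and eq: "equivalent_measures (law Q Z) (law P Z)"
  obtains f :: "real \<Rightarrow> real" where "f \<in> borel_measurable borel" "\<And>x. 0 < f x"
    "density (law P Z) (\<lambda>x. ennreal (f x)) = law Q Z"
proof -
  interpret LP: prob_space "law P Z" using prob_space.prob_space_law[OF assms(1) Z(1,3)] .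
  interpret LQ: prob_space "law Q Z" using prob_space.prob_space_law[OF assms(2) Z(2,4)] .
  have ac: "absolutely_continuous (law P Z) (law Q Z)" "absolutely_continuous (law Q Z) (law P Z)"
    using eq by (auto simp: equivalent_measures_def)
  obtain D where D: "D \<in> borel_measurable (law P Z)" "AE x in law P Z. RN_deriv (law P Z) (law Q Z) x = ennreal (D x)"
    "AE x in law Q Z. 0 < D x" "\<And>x. 0 \<le> D x"
    using LP.real_RN_deriv[OF LQ.finite_measure_axioms ac(1)] by (auto simp: sets_law)
  have pos: "AE x in law P Z. 0 < D x"
    using absolutely_continuous_AE[OF _ ac(2) D(3)] by (simp add: sets_law)
  define f where "f x = (if x \<in> Ups \<and> 0 < D x then D x else 1)" for x
  have DUps: "D \<in> borel_measurable borel_Ups"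
    using D(1) unfolding measurable_cong_sets[OF sets_law refl] .
  then have ext: "(\<lambda>x. indicator Ups x * D x) \<in> borel_measurable borel"
    by (subst (asm) borel_measurable_restrict_space_iff) simp_all
  have "f = (\<lambda>x. if 0 < indicator Ups x * D x then indicator Ups x * D x else 1)"
    by (auto simp: f_def indicator_def fun_eq_iff)
  then have f: "f \<in> borel_measurable borel" using ext by simp
  have "density (law P Z) (\<lambda>x. ennreal (f x)) = density (law P Z) (RN_deriv (law P Z) (law Q Z))"
  proof (rule density_cong)
    show "(\<lambda>x. ennreal (f x)) \<in> borel_measurable (law P Z)" using f by (intro measurable_law) simp
    show "AE x in law P Z. ennreal (f x) = RN_deriv (law P Z) (law Q Z) x"
      using D(2) pos AE_space by eventually_elim (simp add: f_def)
  qed simp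
  also have "\<dots> = law Q Z" by (rule LP.density_RN_deriv[OF ac(1)]) (simp add: sets_law)
  finally show thesis by (intro that[OF f]) (auto simp: f_def)
qed

text \<open>That \<open>q\<close> is the conditional expectation of \<open>f\<close> means that the
  measures with densities \<open>f\<close> and \<open>q\<close> agree on \<open>G\<close>.
  Integrating against these two measures allows any \<open>G\<close>-measurable \<phi> with values
  in [0, \<infinity>], without integrability.\<close>

lemma nn_integral_real_cond_exp:
  assumes sub: "finite_measure_subalgebra M G" and f: "integrable M f" "\<And>\<omega>. 0 \<le> f \<omega>"
    and q: "q \<in> borel_measurable G" "AE \<omega> in M. 0 \<le> q \<omega>" "AE \<omega> in M. real_cond_exp M G f \<omega> = q \<omega>"
    and \<phi>: "\<phi> \<in> borel_measurable G"
  shows "(\<integral>\<^sup>+\<omega>. \<phi> \<omega> * ennreal (f \<omega>) \<partial>M) = (\<integral>\<^sup>+\<omega>. \<phi> \<omega> * ennreal (q \<omega>) \<partial>M)"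
proof -
  interpret finite_measure_subalgebra M G by fact
  have [measurable]: "f \<in> borel_measurable M" using f by simp
  have [measurable]: "q \<in> borel_measurable M" "\<phi> \<in> borel_measurable M"
    using measurable_from_subalg[OF subalg] q(1) \<phi> by auto
  have qi: "integrable M q"
    using integrable_cong_AE[THEN iffD1, OF _ _ q(3) real_cond_exp_int(1)[OF f(1)]] by simp
  have subd: "subalgebra (density M u) G" for u
    using subalg by (simp add: subalgebra_def)
  have "restr_to_subalg (density M f) G = restr_to_subalg (density M q) G"
  proof (rule measure_eqI)
    fix A assume "A \<in> sets (restr_to_subalg (density M f) G)"
    then have AG: "A \<in> sets G" using sets_restr_to_subalg[OF subd] by simp
    then have A [measurable]: "A \<in> sets M" using subalg by (auto simp: subalgebra_def)
    have i: "emeasure (density M (\<lambda>x. ennreal (u x))) A = ennreal (LINT x:A|M. u x)"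
      if "integrable M u" "AE x in M. 0 \<le> u x" for u
    proof -
      have "emeasure (density M (\<lambda>x. ennreal (u x))) A = (\<integral>\<^sup>+x. ennreal (indicator A x * u x) \<partial>M)"
        using that by (subst emeasure_density) (auto intro!: nn_integral_cong split: split_indicator)
      also have "\<dots> = ennreal (LINT x:A|M. u x)"
        unfolding set_lebesgue_integral_def
        using that integrable_mult_indicator[OF A that(1)]
        by (subst nn_integral_eq_integral) (auto split: split_indicator)
      finally show ?thesis .
    qed
    have "(LINT x:A|M. f x) = (LINT x:A|M. real_cond_exp M G f x)"
      by (rule real_cond_exp_intA[OF f(1) AG])
    also have "\<dots> = (LINT x:A|M. q x)"
      unfolding set_lebesgue_integral_def by (rule integral_cong_AE) (use q(3) in auto)
    finally show "emeasure (restr_to_subalg (density M f) G) A = emeasure (restr_to_subalg (density M q) G) A"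
      using AG f q qi by (simp add: emeasure_restr_to_subalg[OF subd] i)
  qed (simp add: sets_restr_to_subalg subd)
  then have "(\<integral>\<^sup>+\<omega>. \<phi> \<omega> \<partial>density M f) = (\<integral>\<^sup>+\<omega>. \<phi> \<omega> \<partial>density M q)"
    using nn_integral_subalgebra2[OF subd \<phi>] by metis
  then show ?thesis
    by (simp add: nn_integral_density mult.commute)
qed

text \<open>The probability that a Poisson process of rate \<mu> has increment \<open>ks j\<close>
  between \<open>\<tau> j\<close> and \<open>\<tau> (Suc j)\<close> for every j < n.\<close>

definition poisson_fdd :: "(nat \<Rightarrow> real) \<Rightarrow> (nat \<Rightarrow> nat) \<Rightarrow> nat \<Rightarrow> real \<Rightarrow> real" where
  "poisson_fdd \<tau> ks n \<mu> =
     (\<Prod>j<n. ((\<tau> (Suc j) - \<tau> j) * \<mu>) ^ ks j / fact (ks j) * exp (- ((\<tau> (Suc j) - \<tau> j) * \<mu>)))"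

lemma poisson_fdd_measurable [measurable]: "poisson_fdd \<tau> ks n \<in> borel_measurable borel"
  unfolding poisson_fdd_def[abs_def] by measurable

lemma poisson_fdd_nonneg:
  assumes "\<And>j. j < n \<Longrightarrow> \<tau> j \<le> \<tau> (Suc j)" "0 \<le> \<mu>"
  shows "0 \<le> poisson_fdd \<tau> ks n \<mu>"
  unfolding poisson_fdd_def using assms by (intro prod_nonneg) auto

text \<open>This is where the exponent of the density comes from. Passing from rate \<mu> to \<mu>
  e^a multiplies the weight of k jumps in time d by exp(a k - d \<mu> (e^a - 1)); over successive
  intervals the counts and the lengths add up.\<close>

lemma poisson_fdd_scale:
  "poisson_fdd \<tau> ks n (\<mu> * exp a) =
     poisson_fdd \<tau> ks n \<mu> * exp (a * real (\<Sum>j<n. ks j) - (\<tau> n - \<tau> 0) * \<mu> * (exp a - 1))"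
proof (induction n)
  case (Suc n)
  let ?d = "\<tau> (Suc n) - \<tau> n"
  have e: "exp (a * real (\<Sum>j<Suc n. ks j) - (\<tau> (Suc n) - \<tau> 0) * \<mu> * (exp a - 1)) =
    exp (a * real (\<Sum>j<n. ks j) - (\<tau> n - \<tau> 0) * \<mu> * (exp a - 1)) *
    (exp (- (?d * (\<mu> * exp a))) * exp (?d * \<mu>) * exp a ^ ks n)"
    unfolding exp_of_nat_mult[symmetric] mult_exp_exp by (simp add: algebra_simps)
  have step: "poisson_fdd \<tau> ks (Suc n) x = poisson_fdd \<tau> ks n x * ((?d * x) ^ ks n / fact (ks n) * exp (- (?d * x)))" for x
    by (simp add: poisson_fdd_def)
  \<comment> \<open>The old exponential is inserted together with its reciprocal, so that the weight
    at the old rate splits off.\<close>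
  have factor: "(d * (\<mu> * b)) ^ k / f * A = ((d * \<mu>) ^ k / f * E) * (A * E' * b ^ k)"
    if "E * E' = 1" for d b f A E E' :: real and k
  proof -
    have "((d * \<mu>) ^ k / f * E) * (A * E' * b ^ k) = (d * \<mu>) ^ k * b ^ k / f * A * (E * E')"
      by (simp add: mult_ac)
    with that show ?thesis by (simp add: power_mult_distrib mult_ac)
  qed
  have inv: "exp (- (?d * \<mu>)) * exp (?d * \<mu>) = 1" by (simp flip: exp_add)
  show ?case
    unfolding step Suc e by (subst factor[OF inv]) (simp only: mult_ac)
qed (simp add: poisson_fdd_def)

section \<open>Independence of the claims\<close>

text \<open>One set of assumptions for both measures: the rate is the identity under
  \<open>P\<close> and a Borel extension of \<open>g\<close> to the whole line under
  \<open>Q\<close>.\<close>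

locale mixed_poisson_claims = claim_process R \<Theta> N X + prob_space R
  for R :: "'a measure" and \<Theta> N X +
  fixes rate :: "real \<Rightarrow> real"
  assumes \<Theta>_pos: "AE \<omega> in R. 0 < \<Theta> \<omega>"
    and rate_measurable: "rate \<in> borel_measurable borel"
    and rate_pos: "\<And>\<theta>. 0 < \<theta> \<Longrightarrow> 0 < rate \<theta>"
    and a1: "condition_a1 R \<Theta> N X" and a2: "condition_a2 R \<Theta> X" and cmpp: "CMPP R \<Theta> rate N X"
begin

definition "GW = process_algebra (space R) {1..} (interarrival N) borel"
definition "GX = process_algebra (space R) {1..} X borel"

lemma space_GW [simp]: "space GW = space R" and space_GX [simp]: "space GX = space R"
  by (simp_all add: GW_def GX_def)

lemma sets_GW_eq: "sets GW = process_sigma (space R) {1..} (interarrival N) borel"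
  and sets_GX_eq: "sets GX = process_sigma (space R) {1..} X borel"
  by (simp_all only: GW_def GX_def sets_process_algebra)

lemma subalgebra_\<Theta>: "subalgebra R (sigma_of R \<Theta>)"
  using measurable_sets[OF \<Theta>_measurable] by (auto simp: subalgebra_def sets_vimage_algebra2)

lemma \<Theta>_measurable_sigma_of: "\<Theta> \<in> borel_measurable (sigma_of R \<Theta>)"
  by (rule measurable_vimage_algebra1) simp

sublocale C: finite_measure_subalgebra R "sigma_of R \<Theta>"
  by unfold_locales (rule subalgebra_\<Theta>)

lemma sets_GX: "sets GX \<subseteq> sets R" and sets_GW: "sets GW \<subseteq> sets R"
  using a1 by (auto simp: sets_GX_eq sets_GW_eq condition_a1_def cond_indep_set_def cond_indep_sets_def
      split: bool.splits)

text \<open>By (a2), the constant \<open>prob D\<close> has the same integral as the indicator of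
  \<open>D\<close> over every event in the \<sigma>-algebra of \<Theta>, and this characterizes the
  conditional expectation.\<close>

lemma cond_exp_claims:
  assumes D: "D \<in> sets GX"
  shows "AE \<omega> in R. real_cond_exp R (sigma_of R \<Theta>) (indicator D) \<omega> = prob D"
proof (rule C.real_cond_exp_charact)
  have DR [measurable]: "D \<in> sets R" using D sets_GX by auto
  show "integrable R (indicat_real D)"
    by (auto intro!: integrable_real_indicator simp: emeasure_eq_measure)
  fix A assume A: "A \<in> sets (sigma_of R \<Theta>)"
  then have AR [measurable]: "A \<in> sets R" using subalgebra_\<Theta> by (auto simp: subalgebra_def)
  have "prob (A \<inter> D) = prob A * prob D"
    using a2 A D unfolding condition_a2_def by (intro indep_setD) (simp_all only: sets_GX_eq)
  moreover have "indicat_real A x * indicator D x = indicator (A \<inter> D) x" for x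
    by (auto split: split_indicator)
  ultimately show "(LINT x:A|R. indicator D x) = (LINT x:A|R. prob D)"
    unfolding set_lebesgue_integral_def by simp
qed simp_all

lemma cond_exp_Int:
  assumes C: "C \<in> sets GW" and D: "D \<in> sets GX"
  shows "AE \<omega> in R. real_cond_exp R (sigma_of R \<Theta>) (indicator (C \<inter> D)) \<omega> =
    real_cond_exp R (sigma_of R \<Theta>) (indicator C) \<omega> * prob D"
proof -
  have "\<forall>A\<in>Pi UNIV (case_bool (sets GW) (sets GX)). AE \<omega> in R.
      real_cond_exp R (sigma_of R \<Theta>) (indicator (\<Inter>j\<in>UNIV. A j)) \<omega> =
      (\<Prod>j\<in>UNIV. real_cond_exp R (sigma_of R \<Theta>) (indicator (A j)) \<omega>)"
    using a1 unfolding condition_a1_def cond_indep_set_def cond_indep_sets_def sets_GX_eq sets_GW_eq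
    by simp
  moreover have "case_bool C D \<in> Pi UNIV (case_bool (sets GW) (sets GX))"
    using C D by (auto split: bool.splits)
  ultimately have "AE \<omega> in R.
      real_cond_exp R (sigma_of R \<Theta>) (indicator (\<Inter>j\<in>UNIV. case_bool C D j)) \<omega> =
      (\<Prod>j\<in>UNIV. real_cond_exp R (sigma_of R \<Theta>) (indicator (case_bool C D j)) \<omega>)"
    by blast
  moreover have "(\<Inter>j\<in>UNIV. case_bool C D j) = C \<inter> D"
    by (auto simp: UNIV_bool)
  ultimately have "AE \<omega> in R. real_cond_exp R (sigma_of R \<Theta>) (indicator (C \<inter> D)) \<omega> =
      real_cond_exp R (sigma_of R \<Theta>) (indicator C) \<omega> * real_cond_exp R (sigma_of R \<Theta>) (indicator D) \<omega>"
    by (simp add: UNIV_bool mult.commute)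
  with cond_exp_claims[OF D] show ?thesis by eventually_elim simp
qed

text \<open>For an indicator \<open>Z\<close> this is (a1) combined with (a2). In general both sides
  integrate \<open>Z\<close> against measures that agree on \<open>GX\<close>: one has density
  \<phi>(\<Theta>) times the indicator of \<open>C\<close>, the other is a multiple of
  \<open>R\<close>.\<close>

lemma nn_integral_cond_independent:
  assumes C: "C \<in> sets GW" and Z: "Z \<in> borel_measurable GX" and \<phi>: "\<phi> \<in> borel_measurable borel"
    and q: "q \<in> borel_measurable borel" "AE \<omega> in R. 0 \<le> q (\<Theta> \<omega>)"
      "AE \<omega> in R. real_cond_exp R (sigma_of R \<Theta>) (indicator C) \<omega> = q (\<Theta> \<omega>)"
  shows "(\<integral>\<^sup>+\<omega>. \<phi> (\<Theta> \<omega>) * indicator C \<omega> * Z \<omega> \<partial>R) =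
    (\<integral>\<^sup>+\<omega>. \<phi> (\<Theta> \<omega>) * ennreal (q (\<Theta> \<omega>)) \<partial>R) * (\<integral>\<^sup>+\<omega>. Z \<omega> \<partial>R)"
proof -
  note [measurable] = \<phi> q(1)
  have CR [measurable]: "C \<in> sets R" using C sets_GW by auto
  let ?K = "\<integral>\<^sup>+\<omega>. \<phi> (\<Theta> \<omega>) * ennreal (q (\<Theta> \<omega>)) \<partial>R"
  let ?\<mu> = "density R (\<lambda>\<omega>. \<phi> (\<Theta> \<omega>) * indicator C \<omega>)" and ?\<nu> = "scale_measure ?K R"
  have sub: "subalgebra M GX" if "sets M = sets R" for M
    using sets_GX that sets_eq_imp_space_eq[OF that] by (simp add: subalgebra_def)
  have "restr_to_subalg ?\<mu> GX = restr_to_subalg ?\<nu> GX"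
  proof (rule measure_eqI)
    fix D assume "D \<in> sets (restr_to_subalg ?\<mu> GX)"
    then have D: "D \<in> sets GX" by (simp add: sets_restr_to_subalg sub)
    then have DR [measurable]: "D \<in> sets R" using sets_GX by auto
    have "emeasure ?\<mu> D = (\<integral>\<^sup>+\<omega>. \<phi> (\<Theta> \<omega>) * ennreal (indicator (C \<inter> D) \<omega>) \<partial>R)"
      by (subst emeasure_density) (auto intro!: nn_integral_cong split: split_indicator)
    also have "\<dots> = (\<integral>\<^sup>+\<omega>. \<phi> (\<Theta> \<omega>) * ennreal (q (\<Theta> \<omega>) * prob D) \<partial>R)"
    proof (rule nn_integral_real_cond_exp)
      show "finite_measure_subalgebra R (sigma_of R \<Theta>)" by unfold_locales
      show "AE \<omega> in R. real_cond_exp R (sigma_of R \<Theta>) (indicator (C \<inter> D)) \<omega> = q (\<Theta> \<omega>) * prob D"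
        using cond_exp_Int[OF C D] q(3) by eventually_elim simp
      show "AE \<omega> in R. 0 \<le> q (\<Theta> \<omega>) * prob D"
        using q(2) by eventually_elim simp
      show "(\<lambda>\<omega>. q (\<Theta> \<omega>) * prob D) \<in> borel_measurable (sigma_of R \<Theta>)"
        "(\<lambda>\<omega>. \<phi> (\<Theta> \<omega>)) \<in> borel_measurable (sigma_of R \<Theta>)"
        using measurable_compose[OF \<Theta>_measurable_sigma_of \<phi>] measurable_compose[OF \<Theta>_measurable_sigma_of q(1)]
        by auto
      show "integrable R (indicat_real (C \<inter> D))"
        by (auto intro!: integrable_real_indicator simp: emeasure_eq_measure)
    qed auto
    also have "\<dots> = (\<integral>\<^sup>+\<omega>. \<phi> (\<Theta> \<omega>) * ennreal (q (\<Theta> \<omega>)) * ennreal (prob D) \<partial>R)"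
      by (rule nn_integral_cong_AE) (use q(2) in \<open>auto simp: ennreal_mult mult.assoc\<close>)
    also have "\<dots> = ?K * emeasure R D"
      by (subst nn_integral_multc) (auto simp: emeasure_eq_measure)
    finally show "emeasure (restr_to_subalg ?\<mu> GX) D = emeasure (restr_to_subalg ?\<nu> GX) D"
      using D by (simp add: emeasure_restr_to_subalg sub)
  qed (simp add: sets_restr_to_subalg sub)
  then have "(\<integral>\<^sup>+\<omega>. Z \<omega> \<partial>?\<mu>) = (\<integral>\<^sup>+\<omega>. Z \<omega> \<partial>?\<nu>)"
    using nn_integral_subalgebra2[OF sub[of ?\<mu>] Z] nn_integral_subalgebra2[OF sub[of ?\<nu>] Z]
    by simp
  moreover have ZR: "Z \<in> borel_measurable R" using measurable_from_subalg[OF sub Z] by simp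
  ultimately show ?thesis
    by (simp add: nn_integral_density nn_integral_scale_measure)
qed

section \<open>Conditional law of the increments given the mixing variable\<close>

lemma cond_exp_increment:
  assumes "0 \<le> s" "s < t"
  shows "AE \<omega> in R. real_cond_exp R (sigma_of R \<Theta>) (indicator {\<omega>\<in>space R. N t \<omega> - N s \<omega> = k}) \<omega> =
    ((t - s) * rate (\<Theta> \<omega>)) ^ k / fact k * exp (- ((t - s) * rate (\<Theta> \<omega>)))"
proof -
  \<comment> \<open>Stationarity is applied with shift h = s, which moves the increment to the
    interval from 0 to t - s; there it is the count itself, whose conditional law is
    Poisson.\<close>
  have st: "AE \<omega> in R.
           real_cond_exp R (sigma_of R \<Theta>) (indicator {\<omega>\<in>space R. N (t - s + s) \<omega> - N (0 + s) \<omega> \<in> {k}}) \<omega> =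
           real_cond_exp R (sigma_of R \<Theta>) (indicator {\<omega>\<in>space R. N (t - s) \<omega> - N 0 \<omega> \<in> {k}}) \<omega>"
  proof -
    have "cond_stationary_increments R (sigma_of R \<Theta>) N"
      using cmpp unfolding CMPP_def by blast
    then show ?thesis
      using assms by (intro cond_stationary_increments_def[THEN iffD1, rule_format]) auto
  qed
  have p: "AE \<omega> in R. real_cond_exp R (sigma_of R \<Theta>) (indicator {\<omega>\<in>space R. N (t - s) \<omega> \<in> {k}}) \<omega> =
                   measure_pmf.prob (poisson_pmf ((t - s) * rate (\<Theta> \<omega>))) {k}"
  proof -
    have pois: "\<forall>t>0. \<forall>B. AE \<omega> in R. real_cond_exp R (sigma_of R \<Theta>) (indicator {\<omega>\<in>space R. N t \<omega> \<in> B}) \<omega> =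
        measure_pmf.prob (poisson_pmf (t * rate (\<Theta> \<omega>))) B"
      using cmpp unfolding CMPP_def by blast
    show ?thesis
      by (rule pois[rule_format]) (use assms in simp)
  qed
  have start: "{\<omega>\<in>space R. N (t - s) \<omega> - N 0 \<omega> \<in> {k}} = {\<omega>\<in>space R. N (t - s) \<omega> \<in> {k}}"
    using N_zero by auto
  from st p \<Theta>_pos show ?thesis
  proof eventually_elim
    case (elim \<omega>)
    have "0 < (t - s) * rate (\<Theta> \<omega>)"
      using elim(3) assms rate_pos[of "\<Theta> \<omega>"] by simp
    with elim(1,2) show ?case
      unfolding start by (simp add: measure_pmf_single pmf_poisson)
  qed
qed

lemma increment_event_GW:
  assumes "\<And>j. j \<le> n \<Longrightarrow> 0 \<le> \<tau> j"
  shows "{\<omega>\<in>space R. \<forall>j<n. N (\<tau> (Suc j)) \<omega> - N (\<tau> j) \<omega> = ks j} \<in> sets GW"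
proof -
  have "{\<omega>\<in>space GW. N (\<tau> (Suc j)) \<omega> - N (\<tau> j) \<omega> = ks j} \<in> sets GW" if "j < n" for j
  proof -
    have N_GW: "N u \<in> measurable GW (count_space UNIV)" if "0 \<le> u" for u
      unfolding GW_def by (rule counting_process_interarrival_measurable[OF counting that])
    have [measurable]: "N (\<tau> (Suc j)) \<in> measurable GW (count_space UNIV)" "N (\<tau> j) \<in> measurable GW (count_space UNIV)"
      using assms that by (auto intro!: N_GW)
    show ?thesis by measurable
  qed
  then have "{\<omega>\<in>space GW. \<forall>j\<in>{..<n}. N (\<tau> (Suc j)) \<omega> - N (\<tau> j) \<omega> = ks j} \<in> sets GW"
    by (intro sets.sets_Collect_finite_All) auto
  then show ?thesis unfolding space_GW Ball_def lessThan_iff .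
qed

lemma cond_exp_increments:
  assumes "0 \<le> \<tau> 0" "\<And>j. j < n \<Longrightarrow> \<tau> j < \<tau> (Suc j)"
  shows "AE \<omega> in R. real_cond_exp R (sigma_of R \<Theta>)
      (indicator {\<omega>\<in>space R. \<forall>j<n. N (\<tau> (Suc j)) \<omega> - N (\<tau> j) \<omega> = ks j}) \<omega> =
    poisson_fdd \<tau> ks n (rate (\<Theta> \<omega>))"
proof (cases "n = 0")
  case True
  \<comment> \<open>Conditional independence speaks of non-empty index sets only. Without increments
    the event is the whole space and the empty product is 1.\<close>
  have "AE \<omega> in R. real_cond_exp R (sigma_of R \<Theta>) (indicator (space R)) \<omega> = indicator (space R) \<omega>"
    by (rule C.real_cond_exp_F_meas) (use sets.top[of "sigma_of R \<Theta>"] in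
        \<open>auto intro!: integrable_real_indicator simp: emeasure_eq_measure\<close>)
  then show ?thesis
    using AE_space by eventually_elim (use True in \<open>simp add: poisson_fdd_def\<close>)
next
  case False
  have pos: "0 \<le> \<tau> j" if "j \<le> n" for j
    using that
  proof (induction j)
    case (Suc j)
    then show ?case using assms(2)[of j] by simp
  qed (simp add: assms)
  define I where "I j = {\<omega>\<in>space R. N (\<tau> (Suc j)) \<omega> - N (\<tau> j) \<omega> = ks j}" for j
  have indep: "cond_indep_vars R (sigma_of R \<Theta>) (\<lambda>_. count_space UNIV)
          (\<lambda>j \<omega>. N (\<tau> (Suc j)) \<omega> - N (\<tau> j) \<omega>) {..<n}"
    using cmpp assms unfolding CMPP_def cond_independent_increments_def by blast
  have IPi: "I \<in> Pi {..<n} (\<lambda>i. {(\<lambda>\<omega>. N (\<tau> (Suc i)) \<omega> - N (\<tau> i) \<omega>) -` A \<inter> space R |A. A \<in> sets (count_space UNIV)})"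
  proof
    fix j
    have "I j = (\<lambda>\<omega>. N (\<tau> (Suc j)) \<omega> - N (\<tau> j) \<omega>) -` {ks j} \<inter> space R" by (auto simp: I_def)
    then show "I j \<in> {(\<lambda>\<omega>. N (\<tau> (Suc j)) \<omega> - N (\<tau> j) \<omega>) -` A \<inter> space R |A. A \<in> sets (count_space UNIV)}"
      by auto
  qed
  have prod: "AE \<omega> in R. real_cond_exp R (sigma_of R \<Theta>) (indicator (\<Inter>j\<in>{..<n}. I j)) \<omega> =
      (\<Prod>j\<in>{..<n}. real_cond_exp R (sigma_of R \<Theta>) (indicator (I j)) \<omega>)"
    by (rule indep[unfolded cond_indep_vars_def cond_indep_sets_def, THEN conjunct2, THEN conjunct2,
          rule_format, OF _ _ _ IPi]) (use False in auto)
  have "AE \<omega> in R. \<forall>j\<in>{..<n}. real_cond_exp R (sigma_of R \<Theta>) (indicator (I j)) \<omega> =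
    ((\<tau> (Suc j) - \<tau> j) * rate (\<Theta> \<omega>)) ^ ks j / fact (ks j) * exp (- ((\<tau> (Suc j) - \<tau> j) * rate (\<Theta> \<omega>)))"
    using pos assms(2) unfolding I_def by (intro AE_finite_allI cond_exp_increment) auto
  with prod have "AE \<omega> in R. real_cond_exp R (sigma_of R \<Theta>) (indicator (\<Inter>j\<in>{..<n}. I j)) \<omega> =
      poisson_fdd \<tau> ks n (rate (\<Theta> \<omega>))"
  proof eventually_elim
    case (elim \<omega>)
    show ?case
      unfolding elim(1) poisson_fdd_def by (rule prod.cong[OF refl]) (use elim(2) in blast)
  qed
  moreover have "(\<Inter>j\<in>{..<n}. I j) = {\<omega>\<in>space R. \<forall>j<n. N (\<tau> (Suc j)) \<omega> - N (\<tau> j) \<omega> = ks j}"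
    using False by (auto simp: I_def)
  ultimately show ?thesis by simp
qed

lemma X_distr: "1 \<le> n \<Longrightarrow> distr R borel (X n) = distr R borel (X 1)"
  using cmpp unfolding CMPP_def by blast

lemma nn_integral_claims:
  assumes [measurable]: "\<And>k. \<psi> k \<in> borel_measurable borel"
  shows "(\<integral>\<^sup>+\<omega>. (\<Prod>k=1..m. \<psi> k (X k \<omega>)) \<partial>R) = (\<Prod>k=1..m. \<integral>\<^sup>+\<omega>. \<psi> k (X 1 \<omega>) \<partial>R)"
proof -
  have "indep_vars (\<lambda>_. borel) X {1..m}"
    using cmpp unfolding CMPP_def by (auto intro: indep_vars_subset)
  then have "indep_vars (\<lambda>_. borel) (\<lambda>k \<omega>. \<psi> k (X k \<omega>)) {1..m}"
    by (rule indep_vars_compose2) auto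
  then have "(\<integral>\<^sup>+\<omega>. (\<Prod>k=1..m. \<psi> k (X k \<omega>)) \<partial>R) = (\<Prod>k=1..m. \<integral>\<^sup>+\<omega>. \<psi> k (X k \<omega>) \<partial>R)"
    by (intro indep_vars_nn_integral) auto
  also have "\<dots> = (\<Prod>k=1..m. \<integral>\<^sup>+\<omega>. \<psi> k (X 1 \<omega>) \<partial>R)"
  proof (rule prod.cong[OF refl])
    fix k assume "k \<in> {1..m}"
    then have k: "1 \<le> k" by simp
    have "(\<integral>\<^sup>+\<omega>. \<psi> k (X k \<omega>) \<partial>R) = (\<integral>\<^sup>+x. \<psi> k x \<partial>distr R borel (X k))"
      using k by (intro nn_integral_distr[symmetric]) auto
    also have "\<dots> = (\<integral>\<^sup>+\<omega>. \<psi> k (X 1 \<omega>) \<partial>R)"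
      unfolding X_distr[OF k] by (intro nn_integral_distr) auto
    finally show "(\<integral>\<^sup>+\<omega>. \<psi> k (X k \<omega>) \<partial>R) = (\<integral>\<^sup>+\<omega>. \<psi> k (X 1 \<omega>) \<partial>R)" .
  qed
  finally show ?thesis .
qed

text \<open>The factorization used on both sides of the change of measure. Under \<open>Q\<close>
  the functions \<phi> and \<psi> are indicators; under \<open>P\<close> they also carry the factors
  of the density that depend on \<Theta> and on the single claims.\<close>

lemma nn_integral_increments_claims:
  assumes \<tau>: "0 \<le> \<tau> 0" "\<And>j. j < n \<Longrightarrow> \<tau> j < \<tau> (Suc j)"
    and \<phi>: "\<phi> \<in> borel_measurable borel" and \<psi>: "\<And>k. \<psi> k \<in> borel_measurable borel"
  shows "(\<integral>\<^sup>+\<omega>. \<phi> (\<Theta> \<omega>) * indicator {\<omega>\<in>space R. \<forall>j<n. N (\<tau> (Suc j)) \<omega> - N (\<tau> j) \<omega> = ks j} \<omega> *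
      (\<Prod>k=1..m. \<psi> k (X k \<omega>)) \<partial>R) =
    (\<integral>\<^sup>+\<omega>. \<phi> (\<Theta> \<omega>) * ennreal (poisson_fdd \<tau> ks n (rate (\<Theta> \<omega>))) \<partial>R) *
    (\<Prod>k=1..m. \<integral>\<^sup>+\<omega>. \<psi> k (X 1 \<omega>) \<partial>R)"
proof -
  have pos: "0 \<le> \<tau> j" if "j \<le> n" for j
    using that
  proof (induction j)
    case (Suc j)
    then show ?case using \<tau>(2)[of j] by simp
  qed (simp add: \<tau>)
  have [measurable]: "X k \<in> borel_measurable GX" if "1 \<le> k" for k
    unfolding GX_def by (rule measurable_process_algebra) (use that in auto)
  note [measurable] = \<psi>
  have Z: "(\<lambda>\<omega>. \<Prod>k=1..m. \<psi> k (X k \<omega>)) \<in> borel_measurable GX"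
    by (intro borel_measurable_prod_ennreal) auto
  show ?thesis
    unfolding nn_integral_claims[OF \<psi>, symmetric]
  proof (intro nn_integral_cond_independent \<phi>)
    show "{\<omega>\<in>space R. \<forall>j<n. N (\<tau> (Suc j)) \<omega> - N (\<tau> j) \<omega> = ks j} \<in> sets GW"
      by (rule increment_event_GW) (use pos in auto)
    show "AE \<omega> in R. 0 \<le> poisson_fdd \<tau> ks n (rate (\<Theta> \<omega>))"
      using \<Theta>_pos by eventually_elim (intro poisson_fdd_nonneg less_imp_le \<tau>(2) rate_pos)
    show "AE \<omega> in R. real_cond_exp R (sigma_of R \<Theta>)
      (indicator {\<omega>\<in>space R. \<forall>j<n. N (\<tau> (Suc j)) \<omega> - N (\<tau> j) \<omega> = ks j}) \<omega> =
      poisson_fdd \<tau> ks n (rate (\<Theta> \<omega>))"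
      by (rule cond_exp_increments[OF \<tau>])
    show "(\<lambda>\<theta>. poisson_fdd \<tau> ks n (rate \<theta>)) \<in> borel_measurable borel"
      using rate_measurable poisson_fdd_measurable by (rule measurable_compose)
  qed (fact Z)
qed

end

section \<open>The change of measure formula\<close>

text \<open>On an event of \<open>F s\<close>, the densities at times s and t both integrate to its
  \<open>R'\<close>-measure, which is the martingale property. Integrability follows from the finite
  total mass of \<open>R'\<close>. The lemma serves for the pair \<open>P\<close>, \<open>Q\<close>
  and for the conditional measures at a single parameter.\<close>

lemma density_process_martingale:
  assumes R: "prob_space R" and R': "prob_space R'" "sets R' = sets R"
    and sub: "\<And>t. subalgebra R (F t)" and mono: "\<And>s t. s \<le> t \<Longrightarrow> sets (F s) \<subseteq> sets (F t)"
    and Y: "\<And>t. 0 \<le> t \<Longrightarrow> Y t \<in> borel_measurable (F t)" "\<And>t \<omega>. 0 \<le> Y t \<omega>"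
    and dens: "\<And>t A. 0 \<le> t \<Longrightarrow> A \<in> sets (F t) \<Longrightarrow> emeasure R' A = (\<integral>\<^sup>+\<omega>. indicator A \<omega> * ennreal (Y t \<omega>) \<partial>R)"
  shows "0 \<le> s \<Longrightarrow> s \<le> t \<Longrightarrow> A \<in> sets (F s) \<Longrightarrow> measure R' A = (LINT \<omega>:A|R. Y t \<omega>)"
    and "L1_martingale R F Y"
proof -
  interpret R: prob_space R by fact
  interpret R': prob_space R' by fact
  have YR [measurable]: "Y t \<in> borel_measurable R" if "0 \<le> t" for t
    using measurable_from_subalg[OF sub Y(1)[OF that]] .
  have space: "space (F t) = space R" for t using sub[of t] by (simp add: subalgebra_def)
  have int: "integrable R (Y t)" if "0 \<le> t" for t
  proof (rule integrableI_nonneg)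
    have "(\<integral>\<^sup>+\<omega>. ennreal (Y t \<omega>) \<partial>R) = (\<integral>\<^sup>+\<omega>. indicator (space R) \<omega> * ennreal (Y t \<omega>) \<partial>R)"
      by (rule nn_integral_cong) simp
    also have "\<dots> = emeasure R' (space R)"
      by (rule dens[symmetric, OF that]) (metis space sets.top)
    also have "\<dots> < \<infinity>" by (simp add: R'.emeasure_eq_measure)
    finally show "(\<integral>\<^sup>+\<omega>. ennreal (Y t \<omega>) \<partial>R) < \<infinity>" .
  qed (use that Y YR in auto)
  have formula: "measure R' A = (LINT \<omega>:A|R. Y t \<omega>)" if "0 \<le> s" "s \<le> t" "A \<in> sets (F s)" for s t A
  proof -
    have t: "0 \<le> t" "A \<in> sets (F t)" using that mono[OF that(2)] by auto
    have A: "A \<in> sets R" using t sub[of t] by (auto simp: subalgebra_def)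
    have "ennreal (measure R' A) = (\<integral>\<^sup>+\<omega>. ennreal (indicator A \<omega> * Y t \<omega>) \<partial>R)"
      unfolding R'.emeasure_eq_measure[symmetric] dens[OF t]
      by (rule nn_integral_cong) (simp split: split_indicator)
    also have "\<dots> = ennreal (LINT \<omega>:A|R. Y t \<omega>)"
      unfolding set_lebesgue_integral_def
      using integrable_mult_indicator[OF A int[OF t(1)]] Y(2)
      by (subst nn_integral_eq_integral) auto
    finally show ?thesis
      using Y(2) unfolding set_lebesgue_integral_def by (subst (asm) ennreal_inj) auto
  qed
  then show "0 \<le> s \<Longrightarrow> s \<le> t \<Longrightarrow> A \<in> sets (F s) \<Longrightarrow> measure R' A = (LINT \<omega>:A|R. Y t \<omega>)" .
  have "AE \<omega> in R. real_cond_exp R (F s) (Y t) \<omega> = Y s \<omega>" if st: "0 \<le> s" "s \<le> t" for s t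
  proof -
    interpret finite_measure_subalgebra R "F s" by unfold_locales (rule sub)
    show ?thesis
      by (rule real_cond_exp_charact) (use st int Y formula[OF _ _, of s, symmetric] formula[of s s, symmetric] in auto)
  qed
  then show "L1_martingale R F Y" using int Y(1) by (simp add: L1_martingale_def)
qed

text \<open>Here \<open>f\<close> and \<open>\<xi>\<close> are positive everywhere, as
  \<open>positive_density_exists\<close> permits. Hence \<open>\<gamma>\<close> is the logarithm of
  \<open>f\<close> at every point, and \<open>\<xi>\<close> can be cancelled at every
  parameter.\<close>

locale density_change =
  P: mixed_poisson_claims P \<Theta> N X "\<lambda>\<theta>. \<theta>" + Q: mixed_poisson_claims Q \<Theta> N X h
  for P Q :: "'a measure" and \<Theta> N X h +
  fixes \<alpha> \<gamma> \<xi> f :: "real \<Rightarrow> real"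
  assumes sets_Q: "sets Q = sets P"
    and f [measurable]: "f \<in> borel_measurable borel" and f_pos: "\<And>x. 0 < f x"
    and f_density: "density (law P (X 1)) (\<lambda>x. ennreal (f x)) = law Q (X 1)"
    and \<xi> [measurable]: "\<xi> \<in> borel_measurable borel" and \<xi>_pos: "\<And>x. 0 < \<xi> x"
    and \<xi>_density: "density (law P \<Theta>) (\<lambda>x. ennreal (\<xi> x)) = law Q \<Theta>"
    and \<alpha> [measurable]: "\<alpha> \<in> borel_measurable borel" and h_eq: "\<And>\<theta>. 0 < \<theta> \<Longrightarrow> h \<theta> = \<theta> * exp (\<alpha> \<theta>)"
    and \<gamma>_eq: "\<And>x. \<gamma> x = ln (f x)"
begin

lemma space_Q: "space Q = space P"
  by (rule sets_eq_imp_space_eq[OF sets_Q])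

abbreviation "M \<equiv> M_mixed \<Theta> N X (\<lambda>x \<theta>. \<alpha> \<theta> + \<gamma> x) \<alpha> \<xi>"

lemma M_nonneg: "0 \<le> M t \<omega>"
  using \<xi>_pos[of "\<Theta> \<omega>"] by (simp add: M_mixed_def)

lemma M_measurable: "0 \<le> t \<Longrightarrow> M t \<in> borel_measurable (P.F t)"
proof -
  assume t: "0 \<le> t"
  have "\<gamma> = (\<lambda>x. ln (f x))" by (rule ext) (rule \<gamma>_eq)
  then have \<gamma>: "\<gamma> \<in> borel_measurable borel" by simp
  have [measurable]: "(\<lambda>\<omega>. \<Sum>k=1..N t \<omega>. \<gamma> (X k \<omega>)) \<in> borel_measurable (P.F t)"
    "\<Theta> \<in> borel_measurable (P.F t)" "N t \<in> measurable (P.F t) (count_space UNIV)"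
    by (rule P.random_sum_measurable_F[OF t measurable_borel_Ups[OF \<gamma>]]
        P.\<Theta>_measurable_F P.N_measurable_F_self[OF t])+
  have "M t = (\<lambda>\<omega>. if \<Theta> \<omega> \<in> Ups then \<xi> (\<Theta> \<omega>) * exp (real (N t \<omega>) * \<alpha> (\<Theta> \<omega>) +
      (\<Sum>k=1..N t \<omega>. \<gamma> (X k \<omega>)) - t * \<Theta> \<omega> * (exp (\<alpha> (\<Theta> \<omega>)) - 1)) else 0)"
    by (auto simp: M_mixed_def S_beta_def sum.distrib fun_eq_iff)
  also have "\<dots> \<in> borel_measurable (P.F t)" by measurable
  finally show ?thesis .
qed

lemma emeasure_elementary_event:
  assumes t: "0 \<le> t" and E: "E \<in> P.elementary_events t"
  shows "emeasure Q E = (\<integral>\<^sup>+\<omega>. indicator E \<omega> * ennreal (M t \<omega>) \<partial>P)"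
proof (cases "E = {}")
  case True
  then show ?thesis by simp
next
  case False
  obtain B U D c where 1: "B \<in> sets borel" "finite U" "U \<subseteq> {0..t}" "t \<in> U" "\<forall>k. D k \<in> sets borel"
    "E = {\<omega>\<in>space P. \<Theta> \<omega> \<in> B \<and> (\<forall>u\<in>U. N u \<omega> = c u) \<and> (\<forall>k\<in>{1..c t}. X k \<omega> \<in> D k)}"
    by (rule P.elementary_eventsE[OF E])
  note [measurable] = 1(1) 1(5)[rule_format]
  \<comment> \<open>Non-emptiness supplies the sample path from which the increments are
    read.\<close>
  obtain \<omega>0 where \<omega>0: "\<omega>0 \<in> space P" "\<forall>u\<in>U. N u \<omega>0 = c u" using False 1(6) by blast
  obtain \<tau> n ks where \<tau>: "\<tau> 0 = 0" "\<tau> n = t" "\<forall>j<n. \<tau> j < \<tau> (Suc j)" "(\<Sum>j<n. ks j) = c t"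
    "{\<omega>\<in>space P. \<forall>u\<in>U. N u \<omega> = c u} = {\<omega>\<in>space P. \<forall>j<n. N (\<tau> (Suc j)) \<omega> - N (\<tau> j) \<omega> = ks j}"
    by (rule P.elementary_event_increments[OF 1(2,3,4) \<omega>0])
  note \<tau>_less = \<tau>(3)[rule_format]
  define C where "C = {\<omega>\<in>space P. \<forall>j<n. N (\<tau> (Suc j)) \<omega> - N (\<tau> j) \<omega> = ks j}"
  define m where "m = c t"
  have E_iff: "\<omega> \<in> E \<longleftrightarrow> \<Theta> \<omega> \<in> B \<and> \<omega> \<in> C \<and> (\<forall>k\<in>{1..m}. X k \<omega> \<in> D k)" for \<omega>
    unfolding C_def \<tau>(5)[symmetric] 1(6) m_def by auto
  have N_E: "N t \<omega> = m" if "\<omega> \<in> E" for \<omega> using that 1(4) unfolding 1(6) m_def by auto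
  have \<tau>0: "0 \<le> \<tau> 0" using \<tau> by simp
  have ER: "E \<in> sets Q"
    using E P.elementary_events_sets by (auto simp: sets_Q)
  have prod_indicator: "(\<Prod>k=1..m. indicator (D k) (X k \<omega>) :: ennreal) = indicator {\<omega>. \<forall>k\<in>{1..m}. X k \<omega> \<in> D k} \<omega>" for \<omega>
    by (induction m) (auto simp: prod.nat_ivl_Suc' atLeastAtMostSuc_conv split: split_indicator)
  \<comment> \<open>The part of the density that depends on \<Theta> alone once
    \<open>N t = m\<close>. The remaining factors are \<open>\<xi>\<close> and one value of
    \<open>f\<close> for each of the m claims.\<close>
  define e where "e \<theta> = exp (\<alpha> \<theta> * real m - t * \<theta> * (exp (\<alpha> \<theta>) - 1))" for \<theta>
  have [measurable]: "e \<in> borel_measurable borel" unfolding e_def[abs_def] by measurable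

  have "emeasure Q E = (\<integral>\<^sup>+\<omega>. indicator B (\<Theta> \<omega>) * indicator C \<omega> * (\<Prod>k=1..m. indicator (D k) (X k \<omega>)) \<partial>Q)"
    unfolding nn_integral_indicator[OF ER, symmetric] prod_indicator
    by (rule nn_integral_cong) (auto simp: E_iff split: split_indicator)
  also have "\<dots> = (\<integral>\<^sup>+\<omega>. indicator B (\<Theta> \<omega>) * ennreal (poisson_fdd \<tau> ks n (h (\<Theta> \<omega>))) \<partial>Q) *
    (\<Prod>k=1..m. \<integral>\<^sup>+\<omega>. indicator (D k) (X 1 \<omega>) \<partial>Q)"
    unfolding C_def space_Q[symmetric]
    by (rule Q.nn_integral_increments_claims[OF \<tau>0 \<tau>_less]) auto
  \<comment> \<open>The integral over \<Theta> moves from \<open>Q\<close> to \<open>P\<close> at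
    the price of the factor \<open>\<xi>\<close>. The Poisson weights are then rescaled from rate
    \<open>h\<close> to the identity, which produces \<open>e\<close>.\<close>
  also have "(\<integral>\<^sup>+\<omega>. indicator B (\<Theta> \<omega>) * ennreal (poisson_fdd \<tau> ks n (h (\<Theta> \<omega>))) \<partial>Q) =
      (\<integral>\<^sup>+\<omega>. ennreal (\<xi> (\<Theta> \<omega>)) * (indicator B (\<Theta> \<omega>) * ennreal (poisson_fdd \<tau> ks n (h (\<Theta> \<omega>)))) \<partial>P)"
    using P.\<Theta>_pos Q.\<Theta>_pos Q.rate_measurable
    by (intro nn_integral_law_density[where h = "\<lambda>\<theta>. indicator B \<theta> * ennreal (poisson_fdd \<tau> ks n (h \<theta>))" and f = "\<lambda>x. ennreal (\<xi> x)"])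
      (auto simp: \<xi>_density)
  also have "\<dots> = (\<integral>\<^sup>+\<omega>. (indicator B (\<Theta> \<omega>) * ennreal (\<xi> (\<Theta> \<omega>)) * ennreal (e (\<Theta> \<omega>))) * ennreal (poisson_fdd \<tau> ks n (\<Theta> \<omega>)) \<partial>P)"
  proof (rule nn_integral_cong_AE)
    show "AE \<omega> in P. ennreal (\<xi> (\<Theta> \<omega>)) * (indicator B (\<Theta> \<omega>) * ennreal (poisson_fdd \<tau> ks n (h (\<Theta> \<omega>)))) =
        (indicator B (\<Theta> \<omega>) * ennreal (\<xi> (\<Theta> \<omega>)) * ennreal (e (\<Theta> \<omega>))) * ennreal (poisson_fdd \<tau> ks n (\<Theta> \<omega>))"
      using P.\<Theta>_pos
    proof eventually_elim
      case (elim \<omega>)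
      have "poisson_fdd \<tau> ks n (h (\<Theta> \<omega>)) = poisson_fdd \<tau> ks n (\<Theta> \<omega>) * e (\<Theta> \<omega>)"
        unfolding h_eq[OF elim] poisson_fdd_scale e_def \<tau> m_def by simp
      moreover have "0 \<le> poisson_fdd \<tau> ks n (\<Theta> \<omega>)"
        by (rule poisson_fdd_nonneg) (use \<tau>_less elim in \<open>auto intro: less_imp_le\<close>)
      ultimately show ?case
        by (simp add: ennreal_mult e_def mult_ac)
    qed
  qed
  \<comment> \<open>Likewise each claim integral moves to \<open>P\<close> with a factor
    \<open>f\<close>.\<close>
  also have "(\<Prod>k=1..m. \<integral>\<^sup>+\<omega>. indicator (D k) (X 1 \<omega>) \<partial>Q) =
      (\<Prod>k=1..m. \<integral>\<^sup>+\<omega>. ennreal (f (X 1 \<omega>)) * indicator (D k) (X 1 \<omega>) \<partial>P)"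
    using P.claim_pos[of 1] Q.claim_pos[of 1] P.claim_measurable[of 1] Q.claim_measurable[of 1]
    by (intro prod.cong refl nn_integral_law_density) (auto simp: f_density[simplified])
  \<comment> \<open>The factorization is now applied backwards under \<open>P\<close>, reassembling
    the factors into one integral over the event.\<close>
  also have "(\<integral>\<^sup>+\<omega>. (indicator B (\<Theta> \<omega>) * ennreal (\<xi> (\<Theta> \<omega>)) * ennreal (e (\<Theta> \<omega>))) * ennreal (poisson_fdd \<tau> ks n (\<Theta> \<omega>)) \<partial>P) *
      (\<Prod>k=1..m. \<integral>\<^sup>+\<omega>. ennreal (f (X 1 \<omega>)) * indicator (D k) (X 1 \<omega>) \<partial>P) =
    (\<integral>\<^sup>+\<omega>. (indicator B (\<Theta> \<omega>) * ennreal (\<xi> (\<Theta> \<omega>)) * ennreal (e (\<Theta> \<omega>))) * indicator C \<omega> *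
      (\<Prod>k=1..m. ennreal (f (X k \<omega>)) * indicator (D k) (X k \<omega>)) \<partial>P)"
    unfolding C_def
    by (rule P.nn_integral_increments_claims[OF \<tau>0 \<tau>_less, symmetric,
          where \<phi> = "\<lambda>\<theta>. indicator B \<theta> * ennreal (\<xi> \<theta>) * ennreal (e \<theta>)" and \<psi> = "\<lambda>k x. ennreal (f x) * indicator (D k) x"]) auto
  also have "\<dots> = (\<integral>\<^sup>+\<omega>. indicator E \<omega> * ennreal (M t \<omega>) \<partial>P)"
  proof (rule nn_integral_cong_AE)
    show "AE \<omega> in P. (indicator B (\<Theta> \<omega>) * ennreal (\<xi> (\<Theta> \<omega>)) * ennreal (e (\<Theta> \<omega>))) * indicator C \<omega> *
      (\<Prod>k=1..m. ennreal (f (X k \<omega>)) * indicator (D k) (X k \<omega>)) = indicator E \<omega> * ennreal (M t \<omega>)"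
      using P.\<Theta>_pos
    proof eventually_elim
      case (elim \<omega>)
      have M_E: "indicator E \<omega> * ennreal (M t \<omega>) = indicator E \<omega> * (ennreal (\<xi> (\<Theta> \<omega>)) * ennreal (e (\<Theta> \<omega>)) * (\<Prod>k=1..m. ennreal (f (X k \<omega>))))"
      proof (cases "\<omega> \<in> E")
        case True
        have "(\<Prod>k=1..m. exp (\<gamma> (X k \<omega>))) = (\<Prod>k=1..m. f (X k \<omega>))"
          using f_pos by (simp add: \<gamma>_eq)
        then have "M t \<omega> = \<xi> (\<Theta> \<omega>) * (e (\<Theta> \<omega>) * (\<Prod>k=1..m. f (X k \<omega>)))"
          using elim N_E[OF True]
          by (simp add: M_mixed_def S_beta_def e_def sum.distrib exp_add exp_diff exp_sum mult_ac)
        moreover have "(\<Prod>k=1..m. ennreal (f (X k \<omega>))) = ennreal (\<Prod>k=1..m. f (X k \<omega>))"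
          by (rule prod_ennreal) (use f_pos in \<open>auto intro: less_imp_le\<close>)
        moreover have "0 \<le> (\<Prod>k=1..m. f (X k \<omega>))" by (rule prod_nonneg) (use f_pos in \<open>auto intro: less_imp_le\<close>)
        ultimately show ?thesis
          using \<xi>_pos[of "\<Theta> \<omega>"] by (simp add: ennreal_mult e_def mult_ac)
      qed simp
      have ind_E: "indicator E \<omega> = indicator B (\<Theta> \<omega>) * indicator C \<omega> * (\<Prod>k=1..m. indicator (D k) (X k \<omega>) :: ennreal)"
        unfolding prod_indicator by (auto simp: E_iff split: split_indicator)
      show ?case unfolding M_E by (simp only: ind_E prod.distrib mult_ac)
    qed
  qed
  finally show ?thesis .
qed

text \<open>Two measures that agree on an intersection-stable family agree on the \<sigma>-algebra
  it generates. The comparison takes place on the one generated by the elementary events, which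
  contains \<open>F t\<close>.\<close>

lemma emeasure_Q_F:
  assumes t: "0 \<le> t" and A: "A \<in> sets (P.F t)"
  shows "emeasure Q A = (\<integral>\<^sup>+\<omega>. indicator A \<omega> * ennreal (M t \<omega>) \<partial>P)"
proof -
  have M [measurable]: "M t \<in> borel_measurable P"
    using measurable_from_subalg[OF P.subalgebra_F M_measurable[OF t]] .
  define G where "G = sigma (space P) (P.elementary_events t)"
  have G_pow: "P.elementary_events t \<subseteq> Pow (space P)"
    by (auto simp: P.elementary_events_def)
  then have G: "space G = space P" "sets G = sigma_sets (space P) (P.elementary_events t)"
    by (simp_all add: G_def)
  have GP: "sets G \<subseteq> sets P"
    unfolding G(2) by (rule sets.sigma_sets_subset[OF P.elementary_events_sets])
  have sub: "subalgebra K G" if "sets K = sets P" for K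
    unfolding subalgebra_def that sets_eq_imp_space_eq[OF that] using GP G(1) by blast
  have emeas: "emeasure (density P (\<lambda>\<omega>. ennreal (M t \<omega>))) A = (\<integral>\<^sup>+\<omega>. indicator A \<omega> * ennreal (M t \<omega>) \<partial>P)"
    if "A \<in> sets P" for A
  proof -
    have "(\<lambda>\<omega>. ennreal (M t \<omega>)) \<in> borel_measurable P" using M by (rule measurable_compose) simp
    then show ?thesis using that by (subst emeasure_density) (simp_all only: mult.commute)
  qed
  \<comment> \<open>The whole space need not be elementary, because elementary events fix the count
    at t. The events on which this count equals n exhaust it and have finite mass.\<close>
  define B where "B n = {\<omega>\<in>space P. \<Theta> \<omega> \<in> UNIV \<and> (\<forall>u\<in>{t}. N u \<omega> = n) \<and> (\<forall>k\<in>{1..n}. X k \<omega> \<in> UNIV)}" for n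
  have B: "B n \<in> P.elementary_events t" for n
    by (rule P.elementary_eventsI[of UNIV "{t}" _ "\<lambda>_. UNIV" _ "\<lambda>_. n"]) (use t in \<open>auto simp: B_def\<close>)
  have "restr_to_subalg Q G = restr_to_subalg (density P (\<lambda>\<omega>. ennreal (M t \<omega>))) G"
  proof (rule measure_eqI_generator_eq[OF P.Int_stable_elementary_events G_pow])
    fix E assume E: "E \<in> P.elementary_events t"
    then have EG: "E \<in> sets G" by (auto simp: G(2))
    then have "E \<in> sets P" using GP by auto
    then show "emeasure (restr_to_subalg Q G) E = emeasure (restr_to_subalg (density P (\<lambda>\<omega>. ennreal (M t \<omega>))) G) E"
      using EG by (simp add: emeasure_restr_to_subalg sub sets_Q emeas emeasure_elementary_event[OF t E])
  next
    show "range B \<subseteq> P.elementary_events t" using B by auto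
    show "(\<Union>n. B n) = space P" by (auto simp: B_def)
    show "emeasure (restr_to_subalg Q G) (B n) \<noteq> \<infinity>" for n
      using B[of n] by (subst emeasure_restr_to_subalg) (auto simp: sub sets_Q G(2))
  qed (simp_all add: sets_restr_to_subalg sub sets_Q G(2))
  then have "emeasure (restr_to_subalg Q G) A = emeasure (restr_to_subalg (density P (\<lambda>\<omega>. ennreal (M t \<omega>))) G) A"
    by simp
  moreover have "A \<in> sets G" using A P.sets_F_elementary_events[OF t] by (auto simp: G(2))
  ultimately show ?thesis
    using GP by (simp add: emeasure_restr_to_subalg sub sets_Q emeas subset_eq)
qed

lemma measure_Q_F:
  assumes "0 \<le> s" "s \<le> t" "A \<in> sets (P.F s)"
  shows "measure Q A = (LINT \<omega>:A|P. M t \<omega>)"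
  by (rule density_process_martingale(1)[where F = P.F and Y = M, OF P.prob_space_axioms Q.prob_space_axioms sets_Q
        P.subalgebra_F P.sets_F_mono M_measurable M_nonneg emeasure_Q_F assms])

lemma M_martingale: "L1_martingale P P.F M"
  by (rule density_process_martingale(2)[where F = P.F and Y = M, OF P.prob_space_axioms Q.prob_space_axioms sets_Q
        P.subalgebra_F P.sets_F_mono M_measurable M_nonneg emeasure_Q_F])

end

section \<open>Disintegration\<close>

lemma regular_cond_prob_kernel:
  assumes "regular_cond_prob R \<Theta> K"
  shows "K \<in> measurable (law R \<Theta>) (subprob_algebra R)"
proof (rule measurable_subprob_algebra)
  have K: "prob_space (K \<theta>)" "sets (K \<theta>) = sets R" if "0 < \<theta>" for \<theta>
    using assms that by (auto simp: regular_cond_prob_def)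
  show "subprob_space (K \<theta>)" "sets (K \<theta>) = sets R" if "\<theta> \<in> space (law R \<Theta>)" for \<theta>
    using K[of \<theta>] that by (auto intro: prob_space_imp_subprob_space)
  fix A assume "A \<in> sets R"
  then have m: "(\<lambda>\<theta>. measure (K \<theta>) A) \<in> borel_measurable (law R \<Theta>)"
    using assms unfolding regular_cond_prob_def measurable_cong_sets[OF sets_law refl] by blast
  show "(\<lambda>\<theta>. emeasure (K \<theta>) A) \<in> borel_measurable (law R \<Theta>)"
  proof (rule measurable_cong[THEN iffD1])
    show "(\<lambda>\<theta>. ennreal (measure (K \<theta>) A)) \<in> borel_measurable (law R \<Theta>)"
      using m by (rule measurable_compose) simp
    show "ennreal (measure (K \<theta>) A) = emeasure (K \<theta>) A" if "\<theta> \<in> space (law R \<Theta>)" for \<theta>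
    proof -
      interpret prob_space "K \<theta>" by (rule K(1)) (use that in simp)
      show ?thesis by (simp add: emeasure_eq_measure)
    qed
  qed
qed

text \<open>Expressing the measure as a mixture of the kernel gives the disintegration of arbitrary
  non-negative integrands through \<open>nn_integral_bind\<close>.\<close>

lemma (in prob_space) regular_cond_prob_bind:
  assumes \<Theta>: "\<Theta> \<in> borel_measurable M" "AE \<omega> in M. \<Theta> \<omega> \<in> Ups" and K: "regular_cond_prob M \<Theta> K"
  shows "law M \<Theta> \<bind> K = M"
proof (rule measure_eqI)
  interpret L: prob_space "law M \<Theta>" using \<Theta> by (rule prob_space_law)
  note ker = regular_cond_prob_kernel[OF K]
  have ne: "space (law M \<Theta>) \<noteq> {}" by (rule L.not_empty)
  show sets: "sets (law M \<Theta> \<bind> K) = sets M"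
    by (rule sets_bind[OF _ ne]) (use K in \<open>auto simp: regular_cond_prob_def\<close>)
  fix A assume "A \<in> sets (law M \<Theta> \<bind> K)"
  then have A: "A \<in> sets M" by (simp only: sets)
  have m: "(\<lambda>\<theta>. measure (K \<theta>) A) \<in> borel_measurable (law M \<Theta>)"
    using K A unfolding regular_cond_prob_def measurable_cong_sets[OF sets_law refl] by blast
  have p: "prob_space (K \<theta>)" if "\<theta> \<in> space (law M \<Theta>)" for \<theta>
    using K that by (simp add: regular_cond_prob_def)
  have int: "integrable (law M \<Theta>) (\<lambda>\<theta>. measure (K \<theta>) A)"
  proof (rule L.integrable_const_bound[where B = 1])
    show "AE \<theta> in law M \<Theta>. norm (measure (K \<theta>) A) \<le> 1"
      using AE_space by eventually_elim (use p prob_space.prob_le_1 in auto)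
  qed (rule m)
  have "emeasure (law M \<Theta> \<bind> K) A = (\<integral>\<^sup>+\<theta>. emeasure (K \<theta>) A \<partial>law M \<Theta>)"
    by (rule emeasure_bind[OF ne ker A])
  also have "\<dots> = (\<integral>\<^sup>+\<theta>. ennreal (measure (K \<theta>) A) \<partial>law M \<Theta>)"
    by (rule nn_integral_cong) (simp add: finite_measure.emeasure_eq_measure prob_space.finite_measure p)
  also have "\<dots> = ennreal (\<integral>\<theta>. measure (K \<theta>) A \<partial>law M \<Theta>)"
    by (rule nn_integral_eq_integral[OF int]) simp
  also have "\<dots> = emeasure M A"
    using K A by (simp add: regular_cond_prob_def emeasure_eq_measure)
  finally show "emeasure (law M \<Theta> \<bind> K) A = emeasure M A" .
qed

text \<open>The null set in the consistency condition depends on the event \<open>B\<close>.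
  Intervals with rational endpoints are countably many and separate points, so a single null set
  suffices for concentration of \<open>K \<theta>\<close> on the fibre over \<theta>.\<close>

lemma consistent_with_AE:
  assumes K: "regular_cond_prob R \<Theta> K" and c: "consistent_with R \<Theta> K" and \<Theta>: "\<Theta> \<in> borel_measurable R"
  shows "AE \<theta> in law R \<Theta>. AE \<omega> in K \<theta>. \<Theta> \<omega> = \<theta>"
proof -
  define I where "I q = Ups \<inter> {fst q<..<snd q}" for q :: "real \<times> real"
  have cnt: "countable (\<rat> \<times> \<rat> :: (real \<times> real) set)" by (intro countable_SIGMA countable_rat)
  have "AE \<theta> in law R \<Theta>. \<forall>q\<in>\<rat>\<times>\<rat>. \<theta> \<in> I q \<longrightarrow> measure (K \<theta>) (\<Theta> -` I q \<inter> space R) = 1"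
  proof (intro AE_ball_countable' cnt)
    fix q
    have "I q \<in> sets borel_Ups" by (auto simp: I_def sets_borel_Ups_iff)
    then show "AE \<theta> in law R \<Theta>. \<theta> \<in> I q \<longrightarrow> measure (K \<theta>) (\<Theta> -` I q \<inter> space R) = 1"
      using c unfolding consistent_with_def by blast
  qed
  then show ?thesis
    using AE_space
  proof eventually_elim
    case (elim \<theta>)
    then have \<theta>: "0 < \<theta>" by simp
    interpret prob_space "K \<theta>" using K \<theta> by (simp add: regular_cond_prob_def)
    have sp: "space (K \<theta>) = space R"
      by (rule sets_eq_imp_space_eq) (use K \<theta> in \<open>simp add: regular_cond_prob_def\<close>)
    have "AE \<omega> in K \<theta>. \<forall>q\<in>\<rat>\<times>\<rat>. \<theta> \<in> I q \<longrightarrow> \<Theta> \<omega> \<in> I q"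
    proof (intro AE_ball_countable' cnt)
      fix q :: "real \<times> real" assume q: "q \<in> \<rat> \<times> \<rat>"
      show "AE \<omega> in K \<theta>. \<theta> \<in> I q \<longrightarrow> \<Theta> \<omega> \<in> I q"
      proof (cases "\<theta> \<in> I q")
        case True
        then have "measure (K \<theta>) (\<Theta> -` I q \<inter> space R) = 1" using elim q by blast
        then show ?thesis using AE_prob_1[of "\<Theta> -` I q \<inter> space R"] by auto
      qed simp
    qed
    then show ?case
    proof eventually_elim
      case (elim \<omega>)
      show ?case
      proof (rule ccontr)
        assume ne: "\<Theta> \<omega> \<noteq> \<theta>"
        obtain a where a: "a \<in> \<rat>" "\<theta> - \<bar>\<Theta> \<omega> - \<theta>\<bar> < a" "a < \<theta>"
          using Rats_dense_in_real[of "\<theta> - \<bar>\<Theta> \<omega> - \<theta>\<bar>" \<theta>] ne by auto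
        obtain b where b: "b \<in> \<rat>" "\<theta> < b" "b < \<theta> + \<bar>\<Theta> \<omega> - \<theta>\<bar>"
          using Rats_dense_in_real[of \<theta> "\<theta> + \<bar>\<Theta> \<omega> - \<theta>\<bar>"] ne by auto
        have "\<theta> \<in> I (a, b)" using a b \<theta> by (simp add: I_def)
        then have "\<Theta> \<omega> \<in> I (a, b)" using elim a b by (auto dest!: bspec[of _ _ "(a, b)"])
        then show False using a b by (auto simp: I_def)
      qed
    qed
  qed
qed

text \<open>Because almost every \<open>K \<theta>\<close> is concentrated on the fibre over
  \<theta>, the indicator of \<open>B\<close> is constant under it and leaves the inner
  integral.\<close>

lemma (in prob_space) regular_cond_prob_disintegration:
  assumes \<Theta>: "\<Theta> \<in> borel_measurable M" "AE \<omega> in M. \<Theta> \<omega> \<in> Ups" and K: "regular_cond_prob M \<Theta> K" "consistent_with M \<Theta> K"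
    and H: "H \<in> borel_measurable M" and B: "B \<in> sets borel"
  shows "(\<integral>\<^sup>+\<omega>. indicator B (\<Theta> \<omega>) * H \<omega> \<partial>M) = (\<integral>\<^sup>+\<theta>. indicator B \<theta> * (\<integral>\<^sup>+\<omega>. H \<omega> \<partial>K \<theta>) \<partial>law M \<Theta>)"
    and "(\<lambda>\<theta>. \<integral>\<^sup>+\<omega>. H \<omega> \<partial>K \<theta>) \<in> borel_measurable (law M \<Theta>)"
proof -
  note [measurable] = \<Theta>(1) H B
  note ker = regular_cond_prob_kernel[OF K(1)]
  show "(\<lambda>\<theta>. \<integral>\<^sup>+\<omega>. H \<omega> \<partial>K \<theta>) \<in> borel_measurable (law M \<Theta>)"
    by (rule measurable_compose[OF ker nn_integral_measurable_subprob_algebra[OF H]])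
  have "(\<integral>\<^sup>+\<omega>. indicator B (\<Theta> \<omega>) * H \<omega> \<partial>(law M \<Theta> \<bind> K)) =
      (\<integral>\<^sup>+\<theta>. (\<integral>\<^sup>+\<omega>. indicator B (\<Theta> \<omega>) * H \<omega> \<partial>K \<theta>) \<partial>law M \<Theta>)"
    by (rule nn_integral_bind[OF _ ker]) measurable
  also have "\<dots> = (\<integral>\<^sup>+\<theta>. indicator B \<theta> * (\<integral>\<^sup>+\<omega>. H \<omega> \<partial>K \<theta>) \<partial>law M \<Theta>)"
  proof (rule nn_integral_cong_AE)
    show "AE \<theta> in law M \<Theta>. (\<integral>\<^sup>+\<omega>. indicator B (\<Theta> \<omega>) * H \<omega> \<partial>K \<theta>) = indicator B \<theta> * (\<integral>\<^sup>+\<omega>. H \<omega> \<partial>K \<theta>)"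
      using consistent_with_AE[OF K \<Theta>(1)] AE_space
    proof eventually_elim
      case (elim \<theta>)
      have "sets (K \<theta>) = sets M" using K(1) elim(2) by (simp add: regular_cond_prob_def)
      then have HK: "H \<in> borel_measurable (K \<theta>)" using H measurable_cong_sets by blast
      have "(\<integral>\<^sup>+\<omega>. indicator B (\<Theta> \<omega>) * H \<omega> \<partial>K \<theta>) = (\<integral>\<^sup>+\<omega>. indicator B \<theta> * H \<omega> \<partial>K \<theta>)"
        by (rule nn_integral_cong_AE) (use elim(1) in eventually_elim, simp)
      then show ?case using HK by (simp add: nn_integral_cmult)
    qed
  qed
  finally show "(\<integral>\<^sup>+\<omega>. indicator B (\<Theta> \<omega>) * H \<omega> \<partial>M) = (\<integral>\<^sup>+\<theta>. indicator B \<theta> * (\<integral>\<^sup>+\<omega>. H \<omega> \<partial>K \<theta>) \<partial>law M \<Theta>)"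
    unfolding regular_cond_prob_bind[OF \<Theta> K(1)] .
qed

section \<open>The density under the conditional measures, off a single null set\<close>

context density_change
begin

abbreviation "Mt \<equiv> M_tilde N X (\<lambda>x \<theta>. \<alpha> \<theta> + \<gamma> x) \<alpha>"

lemma Mt_measurable: "0 \<le> t \<Longrightarrow> Mt \<theta> t \<in> borel_measurable (P.F t)"
proof -
  assume t: "0 \<le> t"
  have "\<gamma> = (\<lambda>x. ln (f x))" by (rule ext) (rule \<gamma>_eq)
  then have \<gamma>: "\<gamma> \<in> borel_measurable borel" by simp
  have [measurable]: "(\<lambda>\<omega>. \<Sum>k=1..N t \<omega>. \<gamma> (X k \<omega>)) \<in> borel_measurable (P.F t)"
    "N t \<in> measurable (P.F t) (count_space UNIV)"
    by (rule P.random_sum_measurable_F[OF t measurable_borel_Ups[OF \<gamma>]] P.N_measurable_F_self[OF t])+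
  have "Mt \<theta> t = (\<lambda>\<omega>. exp (real (N t \<omega>) * \<alpha> \<theta> +
      (\<Sum>k=1..N t \<omega>. \<gamma> (X k \<omega>)) - t * \<theta> * (exp (\<alpha> \<theta>) - 1)))"
    by (auto simp: M_tilde_def S_beta_def sum.distrib fun_eq_iff)
  also have "\<dots> \<in> borel_measurable (P.F t)" by measurable
  finally show ?thesis .
qed

lemma M_eq_Mt: "0 < \<theta> \<Longrightarrow> \<Theta> \<omega> = \<theta> \<Longrightarrow> M t \<omega> = \<xi> \<theta> * Mt \<theta> t \<omega>"
  by (simp add: M_mixed_def M_tilde_def)

context
  fixes Pk Qk
  assumes Pk: "regular_cond_prob P \<Theta> Pk" "consistent_with P \<Theta> Pk"
    and Qk: "regular_cond_prob Q \<Theta> Qk" "consistent_with Q \<Theta> Qk"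
begin

text \<open>Testing against an arbitrary set \<open>B\<close> of parameters, Q(\<Theta> \<in> B, A)
  is disintegrated once under \<open>Q\<close> and once, through the density \<open>M t\<close>,
  under \<open>P\<close>. Uniqueness of densities gives equality for almost every \<theta>. Since
  \<open>M t\<close> is \<open>\<xi> \<theta>\<close> times \<open>Mt \<theta> t\<close> on the
  fibre, the positive factor \<open>\<xi> \<theta>\<close> cancels.\<close>

lemma AE_disintegrated_event:
  assumes t: "0 \<le> t" and A: "A \<in> sets (P.F t)"
  shows "AE \<theta> in law P \<Theta>. emeasure (Qk \<theta>) A = (\<integral>\<^sup>+\<omega>. indicator A \<omega> * ennreal (Mt \<theta> t \<omega>) \<partial>Pk \<theta>)"
proof -
  have AE: "AE \<omega> in P. \<Theta> \<omega> \<in> Ups" "AE \<omega> in Q. \<Theta> \<omega> \<in> Ups"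
    using P.\<Theta>_pos Q.\<Theta>_pos by auto
  interpret LP: prob_space "law P \<Theta>" by (rule P.prob_space_law[OF P.\<Theta>_measurable AE(1)])
  have AP [measurable]: "A \<in> sets P" using P.sets_F_R[OF A] .
  have AQ: "A \<in> sets Q" by (simp add: sets_Q AP)
  have MP [measurable]: "M t \<in> borel_measurable P"
    using measurable_from_subalg[OF P.subalgebra_F M_measurable[OF t]] .
  define H where "H \<omega> = indicator A \<omega> * ennreal (M t \<omega>)" for \<omega>
  have H: "H \<in> borel_measurable P" unfolding H_def[abs_def] by measurable
  have HA: "indicator A \<in> borel_measurable Q" using AQ by simp
  let ?u = "\<lambda>\<theta>. ennreal (\<xi> \<theta>) * (\<integral>\<^sup>+\<omega>. indicator A \<omega> \<partial>Qk \<theta>)" and ?v = "\<lambda>\<theta>. \<integral>\<^sup>+\<omega>. H \<omega> \<partial>Pk \<theta>"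
  note disP = P.regular_cond_prob_disintegration[OF P.\<Theta>_measurable AE(1) Pk H]
  note disQ = Q.regular_cond_prob_disintegration[OF Q.\<Theta>_measurable AE(2) Qk HA]
  have \<xi>_law: "(\<lambda>\<theta>. ennreal (\<xi> \<theta>)) \<in> borel_measurable (law P \<Theta>)" by (rule measurable_law) simp
  have q: "(\<lambda>\<theta>. \<integral>\<^sup>+\<omega>. indicator A \<omega> \<partial>Qk \<theta>) \<in> borel_measurable (law P \<Theta>)"
    using disQ(2)[of UNIV] unfolding measurable_cong_sets[OF sets_law refl] by simp
  have u: "?u \<in> borel_measurable (law P \<Theta>)" using \<xi>_law q by simp
  have v: "?v \<in> borel_measurable (law P \<Theta>)" by (rule disP(2)[of UNIV]) simp
  have "density (law P \<Theta>) ?u = density (law P \<Theta>) ?v"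
  proof (rule measure_eqI)
    fix B assume "B \<in> sets (density (law P \<Theta>) ?u)"
    then have BL: "B \<in> sets (law P \<Theta>)" by simp
    then have B: "B \<in> sets borel" using sets_borel_Ups_iff by (simp add: sets_law)
    have ind: "(indicator B :: real \<Rightarrow> ennreal) \<in> borel_measurable (law P \<Theta>)" using BL by simp
    have "emeasure (density (law P \<Theta>) ?u) B = (\<integral>\<^sup>+\<theta>. ennreal (\<xi> \<theta>) * (indicator B \<theta> * (\<integral>\<^sup>+\<omega>. indicator A \<omega> \<partial>Qk \<theta>)) \<partial>law P \<Theta>)"
      unfolding emeasure_density[OF u BL] by (rule nn_integral_cong) (simp only: mult_ac)
    also have "\<dots> = (\<integral>\<^sup>+\<theta>. indicator B \<theta> * (\<integral>\<^sup>+\<omega>. indicator A \<omega> \<partial>Qk \<theta>) \<partial>law Q \<Theta>)"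
      unfolding \<xi>_density[symmetric] by (rule nn_integral_density[symmetric, OF \<xi>_law]) (use ind q in simp)
    also have "\<dots> = (\<integral>\<^sup>+\<omega>. indicator B (\<Theta> \<omega>) * indicator A \<omega> \<partial>Q)"
      by (rule disQ(1)[symmetric, OF B])
    also have "\<dots> = (\<integral>\<^sup>+\<omega>. indicator ((\<Theta> -` B \<inter> space P) \<inter> A) \<omega> \<partial>Q)"
      by (rule nn_integral_cong) (simp split: split_indicator add: space_Q)
    also have "\<dots> = emeasure Q ((\<Theta> -` B \<inter> space P) \<inter> A)"
      using AQ measurable_sets[OF P.\<Theta>_measurable B] by (intro nn_integral_indicator) (simp add: sets_Q)
    also have "\<dots> = (\<integral>\<^sup>+\<omega>. indicator ((\<Theta> -` B \<inter> space P) \<inter> A) \<omega> * ennreal (M t \<omega>) \<partial>P)"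
    proof (rule emeasure_Q_F[OF t])
      show "(\<Theta> -` B \<inter> space P) \<inter> A \<in> sets (P.F t)"
        using A measurable_sets[OF P.\<Theta>_measurable_F B, of t] by auto
    qed
    also have "\<dots> = (\<integral>\<^sup>+\<omega>. indicator B (\<Theta> \<omega>) * H \<omega> \<partial>P)"
      by (rule nn_integral_cong) (simp add: H_def split: split_indicator)
    also have "\<dots> = (\<integral>\<^sup>+\<theta>. indicator B \<theta> * ?v \<theta> \<partial>law P \<Theta>)"
      by (rule disP(1)[OF B])
    also have "\<dots> = emeasure (density (law P \<Theta>) ?v) B"
      unfolding emeasure_density[OF v BL] by (rule nn_integral_cong) (simp only: mult_ac)
    finally show "emeasure (density (law P \<Theta>) ?u) B = emeasure (density (law P \<Theta>) ?v) B" .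
  qed simp
  then have "AE \<theta> in law P \<Theta>. ?u \<theta> = ?v \<theta>"
    by (rule LP.density_unique[OF u v])
  then show ?thesis
    using consistent_with_AE[OF Pk P.\<Theta>_measurable] AE_space
  proof eventually_elim
    case (elim \<theta>)
    then have \<theta>: "0 < \<theta>" by simp
    have setsP: "sets (Pk \<theta>) = sets P" and setsQ: "sets (Qk \<theta>) = sets Q"
      using Pk(1) Qk(1) \<theta> by (auto simp: regular_cond_prob_def)
    have Mt: "Mt \<theta> t \<in> borel_measurable (Pk \<theta>)"
      unfolding measurable_cong_sets[OF setsP refl]
      by (rule measurable_from_subalg[OF P.subalgebra_F Mt_measurable[OF t]])
    have ind: "(\<lambda>\<omega>. indicator A \<omega> * ennreal (Mt \<theta> t \<omega>)) \<in> borel_measurable (Pk \<theta>)"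
    proof -
      note [measurable] = Mt
      have [measurable]: "A \<in> sets (Pk \<theta>)" using AP by (simp add: setsP)
      show ?thesis by measurable
    qed
    have "ennreal (\<xi> \<theta>) * emeasure (Qk \<theta>) A = ?v \<theta>"
      using elim(1) AQ setsQ by simp
    also have "\<dots> = (\<integral>\<^sup>+\<omega>. ennreal (\<xi> \<theta>) * (indicator A \<omega> * ennreal (Mt \<theta> t \<omega>)) \<partial>Pk \<theta>)"
    proof (rule nn_integral_cong_AE)
      show "AE \<omega> in Pk \<theta>. H \<omega> = ennreal (\<xi> \<theta>) * (indicator A \<omega> * ennreal (Mt \<theta> t \<omega>))"
        using elim(2)
      proof eventually_elim
        case (elim \<omega>)
        have "0 \<le> \<xi> \<theta>" "0 \<le> Mt \<theta> t \<omega>" using \<xi>_pos[of \<theta>] by (auto simp: M_tilde_def)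
        then show ?case unfolding H_def M_eq_Mt[OF \<theta> elim] by (simp only: ennreal_mult mult_ac)
      qed
    qed
    also have "\<dots> = ennreal (\<xi> \<theta>) * (\<integral>\<^sup>+\<omega>. indicator A \<omega> * ennreal (Mt \<theta> t \<omega>) \<partial>Pk \<theta>)"
      by (rule nn_integral_cmult[OF ind])
    finally show ?case
      using \<xi>_pos[of \<theta>] by (simp add: ennreal_mult_cancel_left)
  qed
qed

definition "rational_times_density \<theta> \<longleftrightarrow> (\<forall>t\<in>\<rat> \<inter> {0..}. \<forall>A\<in>sets (P.F t).
    emeasure (Qk \<theta>) A = (\<integral>\<^sup>+\<omega>. indicator A \<omega> * ennreal (Mt \<theta> t \<omega>) \<partial>Pk \<theta>))"

text \<open>Each pair of a time and an event has its own null set. Over rational times and the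
  finite intersections of the countable generator these null sets are countably many; off their
  union, stability under intersection extends the identity to all events.\<close>

lemma AE_rational_times_density: "AE \<theta> in law P \<Theta>. rational_times_density \<theta>"
proof -
  \<comment> \<open>The empty subfamily is included; intersected with \<open>space P\<close> it
    yields the whole space, which shows equality and finiteness of the total masses.\<close>
  define J where "J t = {J. finite J \<and> J \<subseteq> P.rational_generator t}" for t
  have J_F: "space P \<inter> \<Inter>K \<in> sets (P.F t)" if "K \<in> J t" "t \<in> \<rat>" for K t
  proof -
    have "finite K" "K \<subseteq> sets (P.F t)"
      using that unfolding P.sets_F_rational_generator[OF that(2)] J_def by auto
    then show ?thesis
    proof (induction K)
      case (insert A K)
      then have "A \<in> sets (P.F t)" "space P \<inter> \<Inter>K \<in> sets (P.F t)" by auto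
      then have "A \<inter> (space P \<inter> \<Inter>K) \<in> sets (P.F t)" by (rule sets.Int)
      moreover have "A \<inter> (space P \<inter> \<Inter>K) = space P \<inter> \<Inter>(insert A K)" by auto
      ultimately show ?case by metis
    qed (use sets.top[of "P.F t"] in simp)
  qed
  have "AE \<theta> in law P \<Theta>. \<forall>t\<in>\<rat> \<inter> {0..}. \<forall>K\<in>J t. emeasure (Qk \<theta>) (space P \<inter> \<Inter>K) =
      (\<integral>\<^sup>+\<omega>. indicator (space P \<inter> \<Inter>K) \<omega> * ennreal (Mt \<theta> t \<omega>) \<partial>Pk \<theta>)"
    unfolding J_def
    by (intro AE_ball_countable' countable_Int1 countable_rat countable_Collect_finite_subset
        P.countable_rational_generator AE_disintegrated_event J_F[unfolded J_def]) auto
  then show ?thesis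
    using AE_space
  proof eventually_elim
    case (elim \<theta>)
    then have \<theta>: "0 < \<theta>" by simp
    have setsP: "sets (Pk \<theta>) = sets P" and setsQ: "sets (Qk \<theta>) = sets P" and pQ: "prob_space (Qk \<theta>)"
      using Pk(1) Qk(1) \<theta> by (auto simp: regular_cond_prob_def sets_Q)
    interpret Qk: prob_space "Qk \<theta>" by fact
    show ?case
      unfolding rational_times_density_def
    proof (intro ballI)
      fix t A assume t: "t \<in> \<rat> \<inter> {0..}" and A: "A \<in> sets (P.F t)"
      define E where "E = (\<lambda>K. space P \<inter> \<Inter>K) ` J t"
      define D where "D = density (Pk \<theta>) (\<lambda>\<omega>. ennreal (Mt \<theta> t \<omega>))"
      have sub: "subalgebra L (P.F t)" if "sets L = sets P" for L
        using P.subalgebra_F[of t] unfolding subalgebra_def that sets_eq_imp_space_eq[OF that] .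
      have Mt: "(\<lambda>\<omega>. ennreal (Mt \<theta> t \<omega>)) \<in> borel_measurable (Pk \<theta>)"
        using measurable_from_subalg[OF sub[OF setsP] Mt_measurable] t by simp
      have setsD: "sets D = sets P" by (simp add: D_def setsP)
      have emeas: "emeasure D B = (\<integral>\<^sup>+\<omega>. indicator B \<omega> * ennreal (Mt \<theta> t \<omega>) \<partial>Pk \<theta>)" if "B \<in> sets (P.F t)" for B
        unfolding D_def using P.sets_F_R[OF that] by (subst emeasure_density[OF Mt]) (simp_all only: setsP mult.commute)
      have E_F: "E \<subseteq> sets (P.F t)" using J_F t by (auto simp: E_def)
      have gen: "P.rational_generator t \<subseteq> E"
      proof
        fix B assume B: "B \<in> P.rational_generator t"
        then have "B \<subseteq> space P" by (auto simp: P.rational_generator_def)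
        then have "B = space P \<inter> \<Inter>{B}" by auto
        moreover have "{B} \<in> J t" using B by (simp add: J_def)
        ultimately show "B \<in> E" unfolding E_def by (rule image_eqI)
      qed
      have sigma: "sets (P.F t) = sigma_sets (space P) E"
      proof
        show "sets (P.F t) \<subseteq> sigma_sets (space P) E"
          using t sigma_sets_mono'[OF gen] by (subst P.sets_F_rational_generator) auto
        show "sigma_sets (space P) E \<subseteq> sets (P.F t)"
          using sets.sigma_sets_subset[OF E_F] by simp
      qed
      have "restr_to_subalg (Qk \<theta>) (P.F t) = restr_to_subalg D (P.F t)"
      proof (rule measure_eqI_generator_eq)
        show "Int_stable E"
        proof (rule Int_stableI)
          fix a b assume "a \<in> E" "b \<in> E"
          then obtain K L where "K \<in> J t" "L \<in> J t" "a = space P \<inter> \<Inter>K" "b = space P \<inter> \<Inter>L"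
            by (auto simp: E_def)
          then have "a \<inter> b = space P \<inter> \<Inter>(K \<union> L)" "K \<union> L \<in> J t" by (auto simp: J_def)
          then show "a \<inter> b \<in> E" unfolding E_def by (rule image_eqI)
        qed
        show "E \<subseteq> Pow (space P)" by (auto simp: E_def)
        show "range (\<lambda>_::nat. space P) \<subseteq> E" by (auto simp: E_def J_def intro!: image_eqI[of _ _ "{}"])
        fix B assume B: "B \<in> E"
        then have "B \<in> sets (P.F t)" using E_F by auto
        then show "emeasure (restr_to_subalg (Qk \<theta>) (P.F t)) B = emeasure (restr_to_subalg D (P.F t)) B"
          using elim B t by (auto simp: emeasure_restr_to_subalg sub setsQ setsD emeas E_def)
      next
        show "emeasure (restr_to_subalg (Qk \<theta>) (P.F t)) (space P) \<noteq> \<infinity>"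
          using sets.top[of "P.F t"] by (subst emeasure_restr_to_subalg) (simp_all add: sub setsQ)
      qed (simp_all add: sets_restr_to_subalg sub setsQ setsD sigma)
      then have "emeasure (restr_to_subalg (Qk \<theta>) (P.F t)) A = emeasure (restr_to_subalg D (P.F t)) A"
        by simp
      then show "emeasure (Qk \<theta>) A = (\<integral>\<^sup>+\<omega>. indicator A \<omega> * ennreal (Mt \<theta> t \<omega>) \<partial>Pk \<theta>)"
        using A by (simp add: emeasure_restr_to_subalg sub setsQ setsD emeas)
    qed
  qed
qed

text \<open>Passing from rational to real times: on \<open>{N q = N t}\<close> with \<open>q\<close> slightly larger than \<open>t\<close>, the
  densities at \<open>q\<close> and \<open>t\<close> differ by a deterministic factor close to 1, and these events increase
  to the whole space as \<open>q\<close> decreases to \<open>t\<close>.\<close>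

lemma rational_times_density_all_times:
  assumes rat: "rational_times_density \<theta>" and \<theta>: "0 < \<theta>" and t: "0 \<le> t" and A: "A \<in> sets (P.F t)"
  shows "emeasure (Qk \<theta>) A = (\<integral>\<^sup>+\<omega>. indicator A \<omega> * ennreal (Mt \<theta> t \<omega>) \<partial>Pk \<theta>)"
proof -
  have setsP: "sets (Pk \<theta>) = sets P" and setsQ: "sets (Qk \<theta>) = sets P"
    using Pk(1) Qk(1) \<theta> by (auto simp: regular_cond_prob_def sets_Q)
  have sub: "subalgebra L (P.F t)" if "sets L = sets P" for L t
    using P.subalgebra_F[of t] unfolding subalgebra_def that sets_eq_imp_space_eq[OF that] .
  define D where "D = density (Pk \<theta>) (\<lambda>\<omega>. ennreal (Mt \<theta> t \<omega>))"
  have Mt: "(\<lambda>\<omega>. ennreal (Mt \<theta> t \<omega>)) \<in> borel_measurable (Pk \<theta>)"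
    using measurable_from_subalg[OF sub[OF setsP] Mt_measurable[OF t]] by simp
  have setsD: "sets D = sets P" by (simp add: D_def setsP)
  have emeas: "emeasure D B = (\<integral>\<^sup>+\<omega>. indicator B \<omega> * ennreal (Mt \<theta> t \<omega>) \<partial>Pk \<theta>)" if "B \<in> sets P" for B
    unfolding D_def using that by (subst emeasure_density[OF Mt]) (simp_all only: setsP mult.commute)
  \<comment> \<open>Choosing one rational in each gap between successive points t + 1/(n + 1) makes
    \<open>q\<close> decreasing, and hence the events \<open>C n\<close> increasing.\<close>
  have "\<exists>r. r \<in> \<rat> \<and> t + 1 / real (Suc (Suc n)) < r \<and> r < t + 1 / real (Suc n)" for n
    using Rats_dense_in_real[of "t + 1 / real (Suc (Suc n))" "t + 1 / real (Suc n)"]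
    by (auto simp: field_simps)
  then obtain q where q: "\<And>n. q n \<in> \<rat>" "\<And>n. t + 1 / real (Suc (Suc n)) < q n" "\<And>n. q n < t + 1 / real (Suc n)"
    by metis
  have q_t: "t < q n" for n
  proof -
    have "0 < 1 / real (Suc (Suc n))" by simp
    with q(2)[of n] show ?thesis by linarith
  qed
  have q_lim: "q \<longlonglongrightarrow> t"
  proof -
    have lim: "(\<lambda>n. t + 1 / real (Suc n)) \<longlonglongrightarrow> t"
      using tendsto_add[OF tendsto_const[of t] LIMSEQ_Suc[OF lim_1_over_n]] by simp
    show ?thesis
      by (rule tendsto_sandwich[OF _ _ tendsto_const lim])
        (intro always_eventually allI less_imp_le q_t q(3))+
  qed
  define C where "C n = A \<inter> {\<omega>\<in>space P. N (q n) \<omega> = N t \<omega>}" for n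
  have C_F: "C n \<in> sets (P.F (q n))" for n
  proof -
    have N_real: "(\<lambda>\<omega>. real (N s \<omega>)) \<in> borel_measurable (P.F (q n))" if "0 \<le> s" "s \<le> q n" for s
      by (rule measurable_compose[OF P.N_measurable_F[OF that]]) simp
    have "{\<omega>\<in>space (P.F (q n)). real (N (q n) \<omega>) = real (N t \<omega>)} \<in> sets (P.F (q n))"
      using t q_t[of n] by (intro borel_measurable_eq N_real) auto
    moreover have "A \<in> sets (P.F (q n))" using A P.sets_F_mono[of t "q n"] q_t[of n] by auto
    ultimately show ?thesis by (auto simp: C_def)
  qed
  have C_P: "C n \<in> sets P" for n using P.sets_F_R[OF C_F] .
  have C_inc: "incseq C"
  proof (rule incseq_SucI)
    fix n
    have "q (Suc n) \<le> q n" using q(2)[of n] q(3)[of "Suc n"] by simp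
    then have "N t \<omega> \<le> N (q (Suc n)) \<omega> \<and> N (q (Suc n)) \<omega> \<le> N (q n) \<omega>" if "\<omega> \<in> space P" for \<omega>
      using P.N_mono[OF that t less_imp_le[OF q_t]] P.N_mono[OF that, of "q (Suc n)" "q n"] t q_t[of "Suc n"] by auto
    then show "C n \<subseteq> C (Suc n)" unfolding C_def by fastforce
  qed
  have C_UN: "(\<Union>n. C n) = A"
  proof
    show "A \<subseteq> (\<Union>n. C n)"
    proof
      fix \<omega> assume \<omega>: "\<omega> \<in> A"
      then have sp: "\<omega> \<in> space P" using P.sets_F_R[OF A] sets.sets_into_space by auto
      obtain v where v: "t < v" "\<And>s. t \<le> s \<Longrightarrow> s < v \<Longrightarrow> N s \<omega> = N t \<omega>"
        using counting_process_const_right[OF P.counting sp t] by metis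
      obtain n where "q n < v"
        using order_tendstoD(2)[OF q_lim v(1)] by (auto dest: eventually_happens)
      then have "N (q n) \<omega> = N t \<omega>" using v(2) less_imp_le[OF q_t[of n]] by blast
      with \<omega> sp show "\<omega> \<in> (\<Union>n. C n)" by (auto simp: C_def)
    qed
  qed (auto simp: C_def)
  \<comment> \<open>The rate at which the exponent is compensated. On \<open>C n\<close> the same
    claims enter at times t and \<open>q n\<close>, so only this term changes.\<close>
  define c where "c = \<theta> * (exp (\<alpha> \<theta>) - 1)"
  have step: "emeasure (Qk \<theta>) (C n) = ennreal (exp ((t - q n) * c)) * emeasure D (C n)" for n
  proof -
    have "emeasure (Qk \<theta>) (C n) = (\<integral>\<^sup>+\<omega>. indicator (C n) \<omega> * ennreal (Mt \<theta> (q n) \<omega>) \<partial>Pk \<theta>)"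
      using rat q(1)[of n] C_F[of n] q_t[of n] t unfolding rational_times_density_def by force
    also have "\<dots> = (\<integral>\<^sup>+\<omega>. ennreal (exp ((t - q n) * c)) * (indicator (C n) \<omega> * ennreal (Mt \<theta> t \<omega>)) \<partial>Pk \<theta>)"
    proof (rule nn_integral_cong)
      fix \<omega>
      show "indicator (C n) \<omega> * ennreal (Mt \<theta> (q n) \<omega>) =
          ennreal (exp ((t - q n) * c)) * (indicator (C n) \<omega> * ennreal (Mt \<theta> t \<omega>))"
      proof (cases "\<omega> \<in> C n")
        case True
        then have "N (q n) \<omega> = N t \<omega>" by (simp add: C_def)
        then have "Mt \<theta> (q n) \<omega> = exp ((t - q n) * c) * Mt \<theta> t \<omega>"
          by (simp add: M_tilde_def S_beta_def mult_exp_exp c_def algebra_simps)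
        with True show ?thesis by (simp add: ennreal_mult M_tilde_def)
      qed simp
    qed
    also have "\<dots> = ennreal (exp ((t - q n) * c)) * emeasure D (C n)"
      unfolding emeas[OF C_P] by (intro nn_integral_cmult borel_measurable_times_ennreal Mt borel_measurable_indicator)
        (simp add: setsP C_P)
    finally show ?thesis .
  qed
  have "(\<lambda>n. emeasure (Qk \<theta>) (C n)) \<longlonglongrightarrow> emeasure (Qk \<theta>) A"
    using Lim_emeasure_incseq[OF _ C_inc, of "Qk \<theta>"] C_P by (auto simp: C_UN setsQ)
  \<comment> \<open>The deterministic factor tends to 1, so the limit of the product exists even
    before \<open>D\<close> is known to be finite.\<close>
  moreover have "(\<lambda>n. ennreal (exp ((t - q n) * c)) * emeasure D (C n)) \<longlonglongrightarrow> ennreal 1 * emeasure D A"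
  proof (rule tendsto_mult_ennreal)
    have "(\<lambda>n. exp ((t - q n) * c)) \<longlonglongrightarrow> exp ((t - t) * c)"
      by (intro tendsto_intros q_lim)
    then show "(\<lambda>n. ennreal (exp ((t - q n) * c))) \<longlonglongrightarrow> ennreal 1" by (intro tendsto_ennrealI) simp
    show "(\<lambda>n. emeasure D (C n)) \<longlonglongrightarrow> emeasure D A"
      using Lim_emeasure_incseq[OF _ C_inc, of D] C_P by (auto simp: C_UN setsD)
  qed simp
  ultimately have "emeasure (Qk \<theta>) A = ennreal 1 * emeasure D A"
    unfolding step by (rule LIMSEQ_unique)
  then show ?thesis using emeas[OF P.sets_F_R[OF A]] by simp
qed

lemma disintegrated:
  assumes rat: "rational_times_density \<theta>" and \<theta>: "0 < \<theta>"
  shows "0 \<le> s \<Longrightarrow> s \<le> t \<Longrightarrow> A \<in> sets (P.F s) \<Longrightarrow> measure (Qk \<theta>) A = (LINT \<omega>:A|Pk \<theta>. Mt \<theta> t \<omega>)"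
    and "L1_martingale (Pk \<theta>) P.F (Mt \<theta>)"
proof -
  have K: "prob_space (Pk \<theta>)" "prob_space (Qk \<theta>)" "sets (Qk \<theta>) = sets (Pk \<theta>)" "sets (Pk \<theta>) = sets P"
    using Pk(1) Qk(1) \<theta> by (auto simp: regular_cond_prob_def sets_Q)
  have sub: "subalgebra (Pk \<theta>) (P.F t)" for t
    using P.subalgebra_F[of t] unfolding subalgebra_def K(4) sets_eq_imp_space_eq[OF K(4)] .
  have nonneg: "0 \<le> Mt \<theta> t \<omega>" for t \<omega> by (simp add: M_tilde_def)
  note * = density_process_martingale[where F = P.F and Y = "Mt \<theta>", OF K(1-3) sub P.sets_F_mono
      Mt_measurable nonneg rational_times_density_all_times[OF rat \<theta>]]
  show "0 \<le> s \<Longrightarrow> s \<le> t \<Longrightarrow> A \<in> sets (P.F s) \<Longrightarrow> measure (Qk \<theta>) A = (LINT \<omega>:A|Pk \<theta>. Mt \<theta> t \<omega>)"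
    by (rule *(1))
  show "L1_martingale (Pk \<theta>) P.F (Mt \<theta>)" by (rule *(2))
qed

end

end

section \<open>Equivalence and uniqueness\<close>

text \<open>Allows \<open>g\<close> to be replaced by its extension to the whole line, which changes
  the rate only where \<Theta> is not positive.\<close>

lemma CMPP_cong:
  assumes C: "CMPP R \<Theta> g N X" and AE: "AE \<omega> in R. g (\<Theta> \<omega>) = g' (\<Theta> \<omega>)"
  shows "CMPP R \<Theta> g' N X"
proof -
  have "AE \<omega> in R. real_cond_exp R (sigma_of R \<Theta>) (indicator {\<omega>\<in>space R. N t \<omega> \<in> B}) \<omega> =
      measure_pmf.prob (poisson_pmf (t * g' (\<Theta> \<omega>))) B" if "0 < t" for t B
  proof -
    have "AE \<omega> in R. real_cond_exp R (sigma_of R \<Theta>) (indicator {\<omega>\<in>space R. N t \<omega> \<in> B}) \<omega> =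
        measure_pmf.prob (poisson_pmf (t * g (\<Theta> \<omega>))) B"
      using C that unfolding CMPP_def by blast
    with AE show ?thesis by eventually_elim simp
  qed
  then show ?thesis using C unfolding CMPP_def by blast
qed

lemma equivalent_lawsI:
  assumes Z: "Z \<in> borel_measurable P" "Z \<in> borel_measurable Q" and sp: "space Q = space P"
    and iff: "\<And>B. B \<in> sets borel_Ups \<Longrightarrow>
      emeasure Q (Z -` B \<inter> space P) = 0 \<longleftrightarrow> emeasure P (Z -` B \<inter> space P) = 0"
  shows "equivalent_measures (law Q Z) (law P Z)"
proof -
  have "B \<in> null_sets (law Q Z) \<longleftrightarrow> B \<in> null_sets (law P Z)" for B
    using iff[of B] Z sp by (auto simp: null_sets_def sets_law emeasure_law)
  then show ?thesis by (auto simp: equivalent_measures_def absolutely_continuous_def)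
qed

lemma equivalent_measures_density:
  assumes f: "is_RN_derivative f M' M" and pos: "AE x in M. 0 < f x"
  shows "equivalent_measures M' M"
proof -
  have f': "(\<lambda>x. ennreal (f x)) \<in> borel_measurable M" "density M (\<lambda>x. ennreal (f x)) = M'"
    using f by (auto simp: is_RN_derivative_def)
  have "A \<in> null_sets M" if "A \<in> null_sets (density M (\<lambda>x. ennreal (f x)))" for A
  proof -
    have A: "A \<in> sets M" "AE x in M. x \<in> A \<longrightarrow> ennreal (f x) = 0"
      using that unfolding null_sets_density_iff[OF f'(1)] by auto
    from A(2) pos have "AE x in M. x \<notin> A" by eventually_elim auto
    with A(1) show ?thesis by (simp add: AE_iff_null_sets)
  qed
  then show ?thesis
    using absolutely_continuousI_density[OF f'(1)] f'(2)
    by (auto simp: equivalent_measures_def absolutely_continuous_def)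
qed

lemma RN_derivative_unique:
  assumes "prob_space M" "is_RN_derivative f M' M" "is_RN_derivative f' M' M"
  shows "AE x in M. f x = f' x"
proof -
  interpret prob_space M by fact
  have "AE x in M. ennreal (f x) = ennreal (f' x)"
    using assms(2,3) by (intro density_unique) (auto simp: is_RN_derivative_def)
  moreover have "AE x in M. 0 \<le> f x" "AE x in M. 0 \<le> f' x"
    using assms(2,3) by (auto simp: is_RN_derivative_def)
  ultimately show ?thesis by eventually_elim simp
qed

text \<open>The logarithm is prescribed only where the density is positive; that is almost
  everywhere, so uniqueness passes from the density to its logarithm.\<close>

lemma log_RN_unique:
  assumes "prob_space (law P (X 1))" "log_RN P Q X \<gamma>" "log_RN P Q X \<gamma>'"
  shows "AE x in law P (X 1). \<gamma>' x = \<gamma> x"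
proof -
  obtain f where f: "is_RN_derivative f (law Q (X 1)) (law P (X 1))" "AE x in law P (X 1). 0 < f x"
    "\<forall>x\<in>Ups. 0 < f x \<longrightarrow> \<gamma> x = ln (f x)"
    using assms(2) unfolding log_RN_def by blast
  obtain f' where f': "is_RN_derivative f' (law Q (X 1)) (law P (X 1))" "AE x in law P (X 1). 0 < f' x"
    "\<forall>x\<in>Ups. 0 < f' x \<longrightarrow> \<gamma>' x = ln (f' x)"
    using assms(3) unfolding log_RN_def by blast
  show ?thesis
    using RN_derivative_unique[OF assms(1) f(1) f'(1)] f(2) f'(2) AE_space
    by eventually_elim (use f(3) f'(3) in simp)
qed

section \<open>Observing the first claim with positive probability\<close>

context mixed_poisson_claims
begin

text \<open>The law of the first claim cannot be tested before that claim is made. Requiring at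
  least one claim by time t puts the event into \<open>F t\<close>, and independence of
  \<open>N\<close> and the claims splits off the additional factor.\<close>

lemma first_claim_event:
  assumes t: "0 \<le> t" and B: "B \<in> sets borel"
  shows "{\<omega>\<in>space R. X 1 \<omega> \<in> B \<and> 1 \<le> N t \<omega>} \<in> sets (F t)"
    and "prob {\<omega>\<in>space R. X 1 \<omega> \<in> B \<and> 1 \<le> N t \<omega>} = prob (X 1 -` B \<inter> space R) * prob {\<omega>\<in>space R. 1 \<le> N t \<omega>}"
proof -
  have "{\<omega>\<in>space R. X 1 \<omega> \<in> B \<and> 1 \<le> N t \<omega>} = (visible_claim t 1 -` B \<inter> space (F t)) \<inter> {\<omega>\<in>space R. 1 \<le> N t \<omega>}"
    by (auto simp: visible_claim_def)
  also have "\<dots> \<in> sets (F t)"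
    by (rule sets.Int[OF measurable_sets[OF visible_claim_measurable_F[OF t] B] N_ge_in_F[OF t]]) simp
  finally show "{\<omega>\<in>space R. X 1 \<omega> \<in> B \<and> 1 \<le> N t \<omega>} \<in> sets (F t)" .
  have indep: "indep_set (process_sigma (space R) {0..} N (count_space UNIV)) (process_sigma (space R) {1..} X borel)"
    using cmpp unfolding CMPP_def by blast
  have N: "{\<omega>\<in>space R. 1 \<le> N t \<omega>} \<in> process_sigma (space R) {0..} N (count_space UNIV)"
  proof -
    have "{\<omega>\<in>space R. 1 \<le> N t \<omega>} = N t -` {1..} \<inter> space R" by auto
    then show ?thesis
      unfolding process_sigma_def by (intro sigma_sets.Basic) (use t in auto)
  qed
  have X: "X 1 -` B \<inter> space R \<in> process_sigma (space R) {1..} X borel"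
    unfolding process_sigma_def by (intro sigma_sets.Basic) (use B in auto)
  have "{\<omega>\<in>space R. X 1 \<omega> \<in> B \<and> 1 \<le> N t \<omega>} = {\<omega>\<in>space R. 1 \<le> N t \<omega>} \<inter> (X 1 -` B \<inter> space R)" by auto
  then show "prob {\<omega>\<in>space R. X 1 \<omega> \<in> B \<and> 1 \<le> N t \<omega>} = prob (X 1 -` B \<inter> space R) * prob {\<omega>\<in>space R. 1 \<le> N t \<omega>}"
    using indep_setD[OF indep N X] by simp
qed

text \<open>Every path eventually makes a claim, so these probabilities increase to 1. Stating this
  for all large n allows a common time to be chosen for \<open>P\<close> and
  \<open>Q\<close>.\<close>

lemma eventually_claim_likely: "eventually (\<lambda>n. 0 < prob {\<omega>\<in>space R. 1 \<le> N (real n) \<omega>}) sequentially"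
proof -
  have "{\<omega>\<in>space R. 1 \<le> N (real n) \<omega>} \<in> sets R" for n
    using N_ge_in_F[of "real n" 1] by (auto intro: sets_F_R)
  moreover have "incseq (\<lambda>n. {\<omega>\<in>space R. 1 \<le> N (real n) \<omega>})"
    by (rule incseq_SucI) (use N_mono[of _ "real n" "real (Suc n)" for n] in \<open>auto intro: order_trans\<close>)
  ultimately have "(\<lambda>n. prob {\<omega>\<in>space R. 1 \<le> N (real n) \<omega>}) \<longlonglongrightarrow> prob (\<Union>n. {\<omega>\<in>space R. 1 \<le> N (real n) \<omega>})"
    by (intro finite_Lim_measure_incseq) auto
  also have "(\<Union>n. {\<omega>\<in>space R. 1 \<le> N (real n) \<omega>}) = space R"
  proof
    show "space R \<subseteq> (\<Union>n. {\<omega>\<in>space R. 1 \<le> N (real n) \<omega>})"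
    proof
      fix \<omega> assume \<omega>: "\<omega> \<in> space R"
      obtain t where t: "0 \<le> t" "1 \<le> N t \<omega>" using counting_process_unbounded[OF counting \<omega>] by blast
      obtain n where "t \<le> real n" using real_arch_simple by blast
      then have "1 \<le> N (real n) \<omega>" using N_mono[OF \<omega> t(1), of "real n"] t(2) by simp
      with \<omega> show "\<omega> \<in> (\<Union>n. {\<omega>\<in>space R. 1 \<le> N (real n) \<omega>})" by auto
    qed
  qed auto
  finally show ?thesis by (rule order_tendstoD) (simp add: prob_space)
qed

end

section \<open>The constructed functions have the properties required in (iii) and (iv)\<close>

context density_change
begin

lemma nn_integral_f: "(\<integral>\<^sup>+\<omega>. ennreal (f (X 1 \<omega>)) \<partial>P) = 1"
proof -
  have "(\<integral>\<^sup>+\<omega>. 1 \<partial>Q) = (\<integral>\<^sup>+\<omega>. ennreal (f (X 1 \<omega>)) * 1 \<partial>P)"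
    using P.claim_pos[of 1] Q.claim_pos[of 1]
    by (intro nn_integral_law_density[where Z = "X 1" and h = "\<lambda>_. 1", OF _ _ _ _ _ _ f_density]
        P.claim_measurable Q.claim_measurable) auto
  then show ?thesis by (simp add: Q.emeasure_space_1)
qed

lemma FP_decomposition: "FP_decomposition P X (\<lambda>x \<theta>. \<alpha> \<theta> + \<gamma> x) \<alpha> \<gamma>"
proof -
  have "\<gamma> = (\<lambda>x. ln (f x))" by (rule ext) (rule \<gamma>_eq)
  then have \<gamma>: "\<gamma> \<in> borel_measurable borel" by simp
  have e: "exp (\<gamma> x) = f x" for x using f_pos by (simp add: \<gamma>_eq)
  have fX: "(\<lambda>\<omega>. f (X 1 \<omega>)) \<in> borel_measurable P"
    by (rule measurable_compose[OF P.claim_measurable f]) simp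
  have int: "integrable P (\<lambda>\<omega>. f (X 1 \<omega>))"
    by (rule integrableI_nonneg[OF fX]) (use f_pos nn_integral_f in \<open>auto intro: less_imp_le\<close>)
  have "(\<integral>\<omega>. f (X 1 \<omega>) \<partial>P) = 1"
    by (subst integral_eq_nn_integral[OF fX]) (use f_pos nn_integral_f in \<open>auto intro: less_imp_le\<close>)
  then show ?thesis
    unfolding FP_decomposition_def e using int \<gamma> \<alpha> by (auto intro: measurable_borel_Ups)
qed

lemma log_RN: "log_RN P Q X \<gamma>"
  unfolding log_RN_def
  by (rule exI[of _ f]) (use f_pos f_density f \<gamma>_eq measurable_law[OF f] in
      \<open>auto simp: is_RN_derivative_def intro: less_imp_le\<close>)

lemma \<xi>_RN: "is_RN_derivative \<xi> (law Q \<Theta>) (law P \<Theta>)"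
  using \<xi>_pos \<xi>_density measurable_law[OF \<xi>] by (auto simp: is_RN_derivative_def intro: less_imp_le)

lemma \<xi>_R_plus: "\<xi> \<in> R_plus P \<Theta>"
proof -
  have "AE \<omega> in Q. \<Theta> \<omega> \<in> Ups" using Q.\<Theta>_pos by auto
  then interpret LQ: prob_space "law Q \<Theta>" by (rule Q.prob_space_law[OF Q.\<Theta>_measurable])
  have m: "\<xi> \<in> borel_measurable (law P \<Theta>)" by (rule measurable_law[OF \<xi>])
  have "(\<integral>\<^sup>+x. ennreal (\<xi> x) \<partial>law P \<Theta>) = (\<integral>\<^sup>+x. ennreal (\<xi> x) * indicator (space (law P \<Theta>)) x \<partial>law P \<Theta>)"
    by (rule nn_integral_cong) simp
  also have "\<dots> = emeasure (density (law P \<Theta>) (\<lambda>x. ennreal (\<xi> x))) (space (law P \<Theta>))"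
    by (rule emeasure_density[symmetric, OF _ sets.top]) (use m in simp)
  also have "\<dots> = 1"
    unfolding \<xi>_density using LQ.emeasure_space_1 by simp
  finally have nn: "(\<integral>\<^sup>+x. ennreal (\<xi> x) \<partial>law P \<Theta>) = 1" .
  have "integrable (law P \<Theta>) \<xi>"
    by (rule integrableI_nonneg[OF m]) (use \<xi>_pos nn in \<open>auto intro: less_imp_le\<close>)
  moreover have "(\<integral>x. \<xi> x \<partial>law P \<Theta>) = 1"
    by (subst integral_eq_nn_integral[OF m]) (use \<xi>_pos nn in \<open>auto intro: less_imp_le\<close>)
  ultimately show ?thesis
    using \<xi>_pos by (simp add: R_plus_def measurable_borel_Ups)
qed

lemma mixed_density:
  assumes "\<And>\<theta>. 0 < \<theta> \<Longrightarrow> g \<theta> = h \<theta>"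
  shows "mixed_density P Q \<Theta> N X g (\<lambda>x \<theta>. \<alpha> \<theta> + \<gamma> x) \<alpha> \<gamma> \<xi>"
  unfolding mixed_density_def
  using FP_decomposition \<xi>_R_plus \<xi>_RN log_RN measure_Q_F M_martingale P.\<Theta>_pos assms h_eq by auto

lemma disintegrated_density:
  assumes Pk: "regular_cond_prob P \<Theta> Pk" "consistent_with P \<Theta> Pk"
    and Qk: "regular_cond_prob Q \<Theta> Qk" "consistent_with Q \<Theta> Qk"
    and g: "\<And>\<theta>. 0 < \<theta> \<Longrightarrow> g \<theta> = h \<theta>"
  shows "disintegrated_density P Q \<Theta> N X g Pk Qk (\<lambda>x \<theta>. \<alpha> \<theta> + \<gamma> x) \<alpha> \<gamma>"
proof -
  obtain V where V: "{\<theta>\<in>space (law P \<Theta>). \<not> rational_times_density Pk Qk \<theta>} \<subseteq> V"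
    "emeasure (law P \<Theta>) V = 0" "V \<in> sets (law P \<Theta>)"
    by (rule AE_E[OF AE_rational_times_density[OF Pk Qk]])
  have rat: "0 < \<theta> \<and> rational_times_density Pk Qk \<theta>" if "\<theta> \<in> Ups - V" for \<theta>
    using that V(1) by auto
  have "\<exists>V\<in>null_sets (law P \<Theta>). \<forall>\<theta>\<in>Ups - V.
        (\<forall>s t. 0 \<le> s \<and> s \<le> t \<longrightarrow>
           (\<forall>A\<in>sets (P.F s). measure (Qk \<theta>) A = (LINT \<omega>:A|Pk \<theta>. Mt \<theta> t \<omega>))) \<and>
        L1_martingale (Pk \<theta>) P.F (Mt \<theta>)"
  proof (intro bexI[of _ V] ballI conjI allI impI)
    show "V \<in> null_sets (law P \<Theta>)" using V by (simp add: null_sets_def)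
    fix \<theta> assume "\<theta> \<in> Ups - V"
    from rat[OF this] have \<theta>: "0 < \<theta>" "rational_times_density Pk Qk \<theta>" by auto
    show "L1_martingale (Pk \<theta>) P.F (Mt \<theta>)" by (rule disintegrated(2)[OF Pk Qk \<theta>(2,1)])
    fix s t A assume "0 \<le> s \<and> s \<le> t" "A \<in> sets (P.F s)"
    then show "measure (Qk \<theta>) A = (LINT \<omega>:A|Pk \<theta>. Mt \<theta> t \<omega>)"
      by (intro disintegrated(1)[OF Pk Qk \<theta>(2,1)]) auto
  qed
  then show ?thesis
    unfolding disintegrated_density_def using FP_decomposition log_RN g h_eq by auto
qed

end

section \<open>The implications between the four conditions\<close>

lemma mixed_density_imp_prog_equivalent:
  assumes "claim_process P \<Theta> N X" and P: "prob_space P" and \<Theta>_pos: "AE \<omega> in P. \<Theta> \<omega> \<in> Ups"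
    and Q: "prob_space Q" "sets Q = sets P" and D: "mixed_density P Q \<Theta> N X g \<beta> \<alpha> \<gamma> \<xi>"
  shows "prog_equivalent (filt (space P) \<Theta> (aggregate N X)) Q P"
proof -
  interpret claim_process P \<Theta> N X by fact
  interpret P: prob_space P by fact
  interpret Q: prob_space Q by fact
  let ?M = "M_mixed \<Theta> N X \<beta> \<alpha> \<xi>"
  have "AE \<theta> in law P \<Theta>. 0 < \<xi> \<theta>" using D by (simp add: mixed_density_def R_plus_def)
  from AE_law_D[OF \<Theta>_measurable this] \<Theta>_pos have pos: "AE \<omega> in P. 0 < ?M t \<omega>" for t
    by eventually_elim (simp add: M_mixed_def)
  have sub: "subalgebra Q (F t)" for t
    using subalgebra_F[of t] unfolding subalgebra_def Q(2) sets_eq_imp_space_eq[OF Q(2)] .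
  have iff: "emeasure Q A = 0 \<longleftrightarrow> emeasure P A = 0" if t: "0 \<le> t" and A: "A \<in> sets (F t)" for t A
  proof -
    have AP: "A \<in> sets P" using sets_F_R[OF A] .
    have int: "integrable P (?M t)" using D t by (auto simp: mixed_density_def L1_martingale_def)
    have int': "integrable P (\<lambda>\<omega>. indicator A \<omega> *\<^sub>R ?M t \<omega>)" by (rule integrable_mult_indicator[OF AP int])
    have nonneg: "AE \<omega> in P. 0 \<le> indicator A \<omega> *\<^sub>R ?M t \<omega>"
      using pos[of t] by eventually_elim (simp split: split_indicator)
    have "measure Q A = (LINT \<omega>:A|P. ?M t \<omega>)"
      using D t A unfolding mixed_density_def by blast
    then have "measure Q A = 0 \<longleftrightarrow> (AE \<omega> in P. indicator A \<omega> *\<^sub>R ?M t \<omega> = 0)"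
      unfolding set_lebesgue_integral_def using integral_nonneg_eq_0_iff_AE[OF int' nonneg] by simp
    also have "\<dots> \<longleftrightarrow> (AE \<omega> in P. \<omega> \<notin> A)"
    proof
      assume "AE \<omega> in P. indicator A \<omega> *\<^sub>R ?M t \<omega> = 0"
      then show "AE \<omega> in P. \<omega> \<notin> A"
        using pos[of t] by eventually_elim (auto split: split_indicator_asm)
    next
      assume "AE \<omega> in P. \<omega> \<notin> A"
      then show "AE \<omega> in P. indicator A \<omega> *\<^sub>R ?M t \<omega> = 0" by eventually_elim simp
    qed
    also have "\<dots> \<longleftrightarrow> emeasure P A = 0" using AP by (simp add: AE_iff_null_sets[symmetric] null_sets_def)
    finally show ?thesis by (simp add: Q.emeasure_eq_measure)
  qed
  have "null_sets (restr_to_subalg Q (F t)) = null_sets (restr_to_subalg P (F t))" if "0 \<le> t" for t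
    unfolding null_sets_restr_to_subalg[OF sub] null_sets_restr_to_subalg[OF subalgebra_F]
    using iff[OF that] sets_F_R[of _ t] by (auto simp: null_sets_def Q)
  then show ?thesis
    by (simp add: prog_equivalent_def equivalent_measures_def absolutely_continuous_def)
qed

lemma prog_equivalent_imp_equivalent_laws:
  assumes P: "mixed_poisson_claims P \<Theta> N X h" and Q: "mixed_poisson_claims Q \<Theta> N X h'" "sets Q = sets P"
    and pe: "prog_equivalent (filt (space P) \<Theta> (aggregate N X)) Q P"
  shows "equivalent_measures (law Q (X 1)) (law P (X 1))" and "equivalent_measures (law Q \<Theta>) (law P \<Theta>)"
proof -
  interpret P: mixed_poisson_claims P \<Theta> N X h by fact
  interpret Q: mixed_poisson_claims Q \<Theta> N X h' by fact
  have sp: "space Q = space P" by (rule sets_eq_imp_space_eq[OF Q(2)])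
  have sub: "subalgebra Q (P.F t)" for t
    using P.subalgebra_F[of t] unfolding subalgebra_def Q(2) sp .
  have iff: "emeasure Q A = 0 \<longleftrightarrow> emeasure P A = 0" if t: "0 \<le> t" and A: "A \<in> sets (P.F t)" for t A
  proof -
    have "null_sets (restr_to_subalg Q (P.F t)) = null_sets (restr_to_subalg P (P.F t))"
      using pe t by (auto simp: prog_equivalent_def equivalent_measures_def absolutely_continuous_def)
    then have "A \<in> null_sets Q \<inter> sets (P.F t) \<longleftrightarrow> A \<in> null_sets P \<inter> sets (P.F t)"
      unfolding null_sets_restr_to_subalg[OF sub] null_sets_restr_to_subalg[OF P.subalgebra_F] by simp
    then show ?thesis using A P.sets_F_R[OF A] by (auto simp: null_sets_def Q(2))
  qed
  show "equivalent_measures (law Q \<Theta>) (law P \<Theta>)"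
  proof (rule equivalent_lawsI[OF P.\<Theta>_measurable Q.\<Theta>_measurable sp])
    fix B assume "B \<in> sets borel_Ups"
    then have B: "B \<in> sets borel" by (simp add: sets_borel_Ups_iff)
    \<comment> \<open>Events of \<Theta> already belong to \<open>F 0\<close>, so time 0 is
      enough.\<close>
    show "emeasure Q (\<Theta> -` B \<inter> space P) = 0 \<longleftrightarrow> emeasure P (\<Theta> -` B \<inter> space P) = 0"
      using measurable_sets[OF P.\<Theta>_measurable_F B, of 0] by (intro iff[of 0]) auto
  qed
  obtain n where n: "0 < P.prob {\<omega>\<in>space P. 1 \<le> N (real n) \<omega>}" "0 < Q.prob {\<omega>\<in>space Q. 1 \<le> N (real n) \<omega>}"
    using eventually_conj[OF P.eventually_claim_likely Q.eventually_claim_likely]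
    by (auto dest: eventually_happens)
  show "equivalent_measures (law Q (X 1)) (law P (X 1))"
  proof (rule equivalent_lawsI[OF _ _ sp])
    show "X 1 \<in> borel_measurable P" "X 1 \<in> borel_measurable Q"
      by (rule P.claim_measurable Q.claim_measurable; simp)+
    fix B assume "B \<in> sets borel_Ups"
    then have B: "B \<in> sets borel" by (simp add: sets_borel_Ups_iff)
    note eP = P.first_claim_event[OF of_nat_0_le_iff B, of n] and eQ = Q.first_claim_event(2)[OF of_nat_0_le_iff B, of n]
    have "Q.prob (X 1 -` B \<inter> space P) = 0 \<longleftrightarrow> Q.prob {\<omega>\<in>space P. X 1 \<omega> \<in> B \<and> 1 \<le> N (real n) \<omega>} = 0"
      using eQ n(2) unfolding sp by simp
    also have "\<dots> \<longleftrightarrow> P.prob {\<omega>\<in>space P. X 1 \<omega> \<in> B \<and> 1 \<le> N (real n) \<omega>} = 0"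
      using iff[OF _ eP(1)] by (simp add: P.emeasure_eq_measure Q.emeasure_eq_measure)
    also have "\<dots> \<longleftrightarrow> P.prob (X 1 -` B \<inter> space P) = 0"
      using eP(2) n(1) by simp
    finally show "emeasure Q (X 1 -` B \<inter> space P) = 0 \<longleftrightarrow> emeasure P (X 1 -` B \<inter> space P) = 0"
      by (simp add: P.emeasure_eq_measure Q.emeasure_eq_measure)
  qed
qed

theorem proposition3p4:
  fixes P Q :: "'a measure" and \<Theta> :: "'a \<Rightarrow> real"
    and N :: "real \<Rightarrow> 'a \<Rightarrow> nat" and X :: "nat \<Rightarrow> 'a \<Rightarrow> real"
    and g :: "real \<Rightarrow> real" and Pk Qk :: "real \<Rightarrow> 'a measure"
  assumes "prob_space P"
    and "\<Theta> \<in> borel_measurable P" and "measure P {\<omega>\<in>space P. \<Theta> \<omega> \<in> Ups} = 1"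
    and "counting_process P N"
    and "\<forall>n\<ge>1. X n \<in> borel_measurable P \<and> (\<forall>\<omega>\<in>space P. 0 < X n \<omega>)"
    and "condition_a1 P \<Theta> N X" and "condition_a2 P \<Theta> X"
    and "CMPP P \<Theta> (\<lambda>\<theta>. \<theta>) N X"
    and "regular_cond_prob P \<Theta> Pk" and "consistent_with P \<Theta> Pk"
    and "g \<in> borel_measurable borel_Ups" and "\<forall>\<theta>\<in>Ups. 0 < g \<theta>"
    and "prob_space Q" and "sets Q = sets P"
    and "measure Q {\<omega>\<in>space Q. \<Theta> \<omega> \<in> Ups} = 1"
    and "condition_a1 Q \<Theta> N X" and "condition_a2 Q \<Theta> X"
    and "CMPP Q \<Theta> g N X"
    and "regular_cond_prob Q \<Theta> Qk" and "consistent_with Q \<Theta> Qk"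
  defines "cond_i \<equiv> prog_equivalent (filt (space P) \<Theta> (aggregate N X)) Q P"
    and "cond_ii \<equiv> equivalent_measures (law Q (X 1)) (law P (X 1)) \<and>
                    equivalent_measures (law Q \<Theta>) (law P \<Theta>)"
    and "cond_iii \<equiv> (\<exists>\<beta> \<alpha> \<gamma>. disintegrated_density P Q \<Theta> N X g Pk Qk \<beta> \<alpha> \<gamma> \<and>
           (\<forall>\<beta>' \<alpha>' \<gamma>'. disintegrated_density P Q \<Theta> N X g Pk Qk \<beta>' \<alpha>' \<gamma>' \<longrightarrow>
              (AE \<theta> in law P \<Theta>. \<alpha>' \<theta> = \<alpha> \<theta>) \<and> (AE x in law P (X 1). \<gamma>' x = \<gamma> x)))"
    and "cond_iv \<equiv> (\<exists>\<beta> \<alpha> \<gamma> \<xi>. mixed_density P Q \<Theta> N X g \<beta> \<alpha> \<gamma> \<xi> \<and>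
           (\<forall>\<beta>' \<alpha>' \<gamma>' \<xi>'. mixed_density P Q \<Theta> N X g \<beta>' \<alpha>' \<gamma>' \<xi>' \<longrightarrow>
              (AE \<theta> in law P \<Theta>. \<alpha>' \<theta> = \<alpha> \<theta>) \<and> (AE x in law P (X 1). \<gamma>' x = \<gamma> x) \<and>
              (AE \<theta> in law P \<Theta>. \<xi>' \<theta> = \<xi> \<theta>)))"
  shows "(cond_i \<longleftrightarrow> cond_ii) \<and>
         (cond_i \<longleftrightarrow> cond_iii \<and> equivalent_measures (law Q \<Theta>) (law P \<Theta>)) \<and>
         (cond_i \<longleftrightarrow> cond_iv)"
proof -
  interpret P: prob_space P by fact
  interpret Q: prob_space Q by fact
  have spQ: "space Q = space P" by (rule sets_eq_imp_space_eq[OF assms(14)])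
  have \<Theta>Q: "\<Theta> \<in> borel_measurable Q"
    using assms(2) unfolding measurable_cong_sets[OF assms(14) refl] .
  have \<Theta>_pos: "AE \<omega> in P. 0 < \<Theta> \<omega>"
    using P.AE_prob_1[OF assms(3)] by eventually_elim simp
  have \<Theta>_posQ: "AE \<omega> in Q. 0 < \<Theta> \<omega>"
    using Q.AE_prob_1[OF assms(15)] by eventually_elim simp
  \<comment> \<open>Outside \<open>Ups\<close> the value 1 is arbitrary apart from being positive;
    it makes the rate Borel and positive on the whole line.\<close>
  define g0 where "g0 \<theta> = (if 0 < \<theta> then g \<theta> else 1)" for \<theta>
  have g0: "g0 \<in> borel_measurable borel"
  proof -
    have "(\<lambda>\<theta>. indicat_real Ups \<theta> * g \<theta>) \<in> borel_measurable borel"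
      using assms(11) by (subst (asm) borel_measurable_restrict_space_iff) simp_all
    moreover have "g0 = (\<lambda>\<theta>. if 0 < \<theta> then indicat_real Ups \<theta> * g \<theta> else 1)"
      by (auto simp: g0_def fun_eq_iff)
    ultimately show ?thesis by simp
  qed
  have g0_pos: "0 < g0 \<theta>" for \<theta> using assms(12) by (simp add: g0_def)
  have CP: "claim_process P \<Theta> N X"
    by unfold_locales (fact assms)+
  have CQ: "claim_process Q \<Theta> N X"
  proof
    show "counting_process Q N"
      using assms(4) unfolding counting_process_def spQ measurable_cong_sets[OF assms(14) refl] .
    show "\<forall>n\<ge>1. X n \<in> borel_measurable Q \<and> (\<forall>\<omega>\<in>space Q. 0 < X n \<omega>)"
      using assms(5) unfolding spQ measurable_cong_sets[OF assms(14) refl] .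
  qed (fact \<Theta>Q)
  have PP: "mixed_poisson_claims P \<Theta> N X (\<lambda>\<theta>. \<theta>)"
    by (intro mixed_poisson_claims.intro CP assms(1) mixed_poisson_claims_axioms.intro \<Theta>_pos assms) simp_all
  have "AE \<omega> in Q. g (\<Theta> \<omega>) = g0 (\<Theta> \<omega>)" using \<Theta>_posQ by eventually_elim (simp add: g0_def)
  from CMPP_cong[OF assms(18) this] have QQ: "mixed_poisson_claims Q \<Theta> N X g0"
    by (intro mixed_poisson_claims.intro CQ assms(13) mixed_poisson_claims_axioms.intro \<Theta>_posQ g0 g0_pos assms)
  interpret P: mixed_poisson_claims P \<Theta> N X "\<lambda>\<theta>. \<theta>" by (fact PP)
  interpret Q: mixed_poisson_claims Q \<Theta> N X g0 by (fact QQ)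
  have Ups: "AE \<omega> in P. \<Theta> \<omega> \<in> Ups" "AE \<omega> in Q. \<Theta> \<omega> \<in> Ups" using \<Theta>_pos \<Theta>_posQ by auto
  have XUps: "AE \<omega> in P. X 1 \<omega> \<in> Ups" "AE \<omega> in Q. X 1 \<omega> \<in> Ups"
    using P.claim_pos[of 1] Q.claim_pos[of 1] by auto
  have X1: "X 1 \<in> borel_measurable P" "X 1 \<in> borel_measurable Q"
    by (rule P.claim_measurable Q.claim_measurable; simp)+
  have L\<Theta>: "prob_space (law P \<Theta>)" by (rule P.prob_space_law[OF assms(2) Ups(1)])
  have LX: "prob_space (law P (X 1))" by (rule P.prob_space_law[OF X1(1) XUps(1)])
  \<comment> \<open>The only solution of g(\<theta>) = \<theta> exp(\<alpha>(\<theta>)) on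
    \<open>Ups\<close>; \<open>\<alpha>_unique\<close> below turns this into essential
    uniqueness.\<close>
  define \<alpha> where "\<alpha> \<theta> = ln (g0 \<theta> / \<theta>)" for \<theta>
  have "\<alpha> = (\<lambda>\<theta>. ln (g0 \<theta> / \<theta>))" by (rule ext) (rule \<alpha>_def)
  then have \<alpha>: "\<alpha> \<in> borel_measurable borel"
    by (simp only:) (intro borel_measurable_ln borel_measurable_divide g0 measurable_ident_sets refl)
  have \<alpha>_eq: "g0 \<theta> = \<theta> * exp (\<alpha> \<theta>)" if "0 < \<theta>" for \<theta>
    using that g0_pos[of \<theta>] by (simp add: \<alpha>_def)
  have \<alpha>_unique: "\<alpha>' \<theta> = \<alpha> \<theta>" if "0 < \<theta>" "g \<theta> = \<theta> * exp (\<alpha>' \<theta>)" for \<alpha>' \<theta>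
    using that \<alpha>_eq[OF that(1)] by (simp add: g0_def)
  have densities: "cond_iii \<and> cond_iv" if cond_ii
  proof -
    from that have eq: "equivalent_measures (law Q (X 1)) (law P (X 1))" "equivalent_measures (law Q \<Theta>) (law P \<Theta>)"
      unfolding cond_ii_def by blast+
    obtain f :: "real \<Rightarrow> real" where f: "f \<in> borel_measurable borel" "\<And>x. 0 < f x"
      "density (law P (X 1)) (\<lambda>x. ennreal (f x)) = law Q (X 1)"
      by (rule positive_density_exists[OF assms(1,13) X1 XUps eq(1)]) (rule that, assumption, simp, assumption)
    obtain \<xi> :: "real \<Rightarrow> real" where \<xi>: "\<xi> \<in> borel_measurable borel" "\<And>x. 0 < \<xi> x"
      "density (law P \<Theta>) (\<lambda>x. ennreal (\<xi> x)) = law Q \<Theta>"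
      by (rule positive_density_exists[OF assms(1,13,2) \<Theta>Q Ups eq(2)]) (rule that, assumption, simp, assumption)
    interpret density_change P Q \<Theta> N X g0 \<alpha> "\<lambda>x. ln (f x)" \<xi> f
      by unfold_locales (fact assms f \<xi> \<alpha> \<alpha>_eq refl)+
    have g_eq: "g \<theta> = g0 \<theta>" if "0 < \<theta>" for \<theta> using that by (simp add: g0_def)
    have cond_iii
      unfolding cond_iii_def
    proof (intro exI conjI allI impI)
      show dd: "disintegrated_density P Q \<Theta> N X g Pk Qk (\<lambda>x \<theta>. \<alpha> \<theta> + ln (f x)) \<alpha> (\<lambda>x. ln (f x))"
        by (rule disintegrated_density[OF assms(9,10,19,20) g_eq])
      fix \<beta>' \<alpha>' \<gamma>' assume dd': "disintegrated_density P Q \<Theta> N X g Pk Qk \<beta>' \<alpha>' \<gamma>'"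
      show "AE \<theta> in law P \<Theta>. \<alpha>' \<theta> = \<alpha> \<theta>"
        using AE_space by eventually_elim (use dd' \<alpha>_unique in \<open>auto simp: disintegrated_density_def\<close>)
      show "AE x in law P (X 1). \<gamma>' x = ln (f x)"
        by (rule log_RN_unique[OF LX log_RN]) (use dd' in \<open>simp add: disintegrated_density_def\<close>)
    qed
    moreover have cond_iv
      unfolding cond_iv_def
    proof (intro exI conjI allI impI)
      show md: "mixed_density P Q \<Theta> N X g (\<lambda>x \<theta>. \<alpha> \<theta> + ln (f x)) \<alpha> (\<lambda>x. ln (f x)) \<xi>"
        by (rule mixed_density[OF g_eq])
      fix \<beta>' \<alpha>' \<gamma>' \<xi>' assume md': "mixed_density P Q \<Theta> N X g \<beta>' \<alpha>' \<gamma>' \<xi>'"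
      have \<alpha>': "\<alpha>' \<in> borel_measurable borel_Ups"
        using md' by (simp add: mixed_density_def FP_decomposition_def)
      \<comment> \<open>In (iv) the relation between \<open>g\<close> and \<open>\<alpha>'\<close>
        holds only almost surely under \<open>P\<close>. Measurability of the set where it holds is
        what carries it over to the law of \<Theta>.\<close>
      have "{\<theta>\<in>space borel_Ups. g \<theta> = \<theta> * exp (\<alpha>' \<theta>)} \<in> sets borel_Ups"
        by (intro borel_measurable_eq assms(11) borel_measurable_times measurable_borel_Ups[OF measurable_ident_sets]
            measurable_compose[OF \<alpha>' borel_measurable_exp]) simp
      then have ms: "{\<theta>\<in>Ups. g \<theta> = \<theta> * exp (\<alpha>' \<theta>)} \<in> sets borel_Ups" by (simp add: space_restrict_space)
      have "AE \<omega> in P. \<Theta> \<omega> \<in> Ups \<longrightarrow> g (\<Theta> \<omega>) = \<Theta> \<omega> * exp (\<alpha>' (\<Theta> \<omega>))"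
        using md' unfolding mixed_density_def by auto
      from AE_law_I[OF assms(2) ms this] show "AE \<theta> in law P \<Theta>. \<alpha>' \<theta> = \<alpha> \<theta>"
        using AE_space by eventually_elim (use \<alpha>_unique in auto)
      show "AE x in law P (X 1). \<gamma>' x = ln (f x)"
        by (rule log_RN_unique[OF LX log_RN]) (use md' in \<open>simp add: mixed_density_def\<close>)
      show "AE \<theta> in law P \<Theta>. \<xi>' \<theta> = \<xi> \<theta>"
        by (rule RN_derivative_unique[OF L\<Theta> _ \<xi>_RN]) (use md' in \<open>simp add: mixed_density_def\<close>)
    qed
    ultimately show ?thesis by blast
  qed
  have iv_i: cond_i if cond_iv
  proof -
    obtain \<beta> \<alpha> \<gamma> \<xi> where "mixed_density P Q \<Theta> N X g \<beta> \<alpha> \<gamma> \<xi>" using \<open>cond_iv\<close> unfolding cond_iv_def by blast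
    then show ?thesis
      unfolding cond_i_def by (rule mixed_density_imp_prog_equivalent[OF CP assms(1) Ups(1) assms(13,14)])
  qed
  have i_ii: cond_ii if cond_i
    using prog_equivalent_imp_equivalent_laws[OF PP QQ assms(14)] that
    unfolding cond_i_def cond_ii_def by blast
  \<comment> \<open>Condition (iii) contributes the positive density of the claim laws; equivalence
    of the laws of \<Theta> enters as a separate premise.\<close>
  have iii_ii: cond_ii if cond_iii "equivalent_measures (law Q \<Theta>) (law P \<Theta>)"
  proof -
    obtain \<gamma> where "log_RN P Q X \<gamma>"
      using \<open>cond_iii\<close> unfolding cond_iii_def disintegrated_density_def by blast
    then have "equivalent_measures (law Q (X 1)) (law P (X 1))"
      unfolding log_RN_def by (blast intro: equivalent_measures_density)
    with that(2) show ?thesis by (simp add: cond_ii_def)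
  qed
  have ii_\<Theta>: "equivalent_measures (law Q \<Theta>) (law P \<Theta>)" if cond_ii
    using that by (simp add: cond_ii_def)
  \<comment> \<open>The cycle (ii), (iv), (i), (ii) closes, and (iii) joined with the equivalence of
    the laws of \<Theta> is linked to (ii) in both directions.\<close>
  show ?thesis using densities iv_i i_ii iii_ii ii_\<Theta> by blast
qed

end
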